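(* Let $d\ge1$, $K\subset\mathbb{R}^d$ compact convex with volume one, $(\theta_t)_{t\ge1}$ positive reals with $\lim_{t\to\infty}t^2\theta_t^d=\infty$, and $a>0$. Let $\mu_t$ be either a homogeneous Poisson process of intensity $t$ on $K$ or a binomial process of $\lceil t\rceil$ independent uniform points in $K$, $t\ge1$, and let $$\xi_{t,a}:=\frac12\sum_{(x,y)\in\mu^2_{t,\neq}}\mathbf{1}\big(\|x-y\|\le\min\{\theta_t,t^{-2/d}a\}\big)\,\delta_{(x+y)/2}.$$ Let $\zeta$ be a Poisson process on $K$ with intensity measure $\frac{\kappa_d}{2}a^d\,\mathrm{vol}|_K$. Then $t_0:=\sup(\{t\ge1:t^2\theta_t^d<a^d\}\cup\{1\})<\infty$, and there is a constant $C>0$ depending only on $a$, $d$ and $K$ such that $$\mathbf{d}_{\mathbf{KR}}(\xi_{t,a},\zeta)\le C\,t^{-\min\{2/d,1\}},\qquad t>t_0.$$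
   Context: $\kappa_d$ is the volume of the $d$-dimensional unit ball; $\mathrm{vol}|_K$ is Lebesgue measure restricted to $K$; $\mu^2_{t,\neq}$ the pairs of distinct points of $\mu_t$. For counting measures, $\mathbf{d}_{\mathbf{TV}}(\omega_1,\omega_2):=\sup\{|\omega_1(A)-\omega_2(A)|:\omega_1(A),\omega_2(A)<\infty\}$; for point processes $\xi,\zeta$, $\mathbf{d}_{\mathbf{KR}}(\xi,\zeta):=\inf_{\mathbb{C}}\int\mathbf{d}_{\mathbf{TV}}(\omega_1,\omega_2)\,\mathbb{C}(d(\omega_1,\omega_2))$ over all couplings $\mathbb{C}$ of their distributions. *)

theory Defs
  imports "HOL-Probability.Probability"
begin

text \<open>Finite counting measures are represented as multisets of points.
  The count of a configuration in a set A.\<close>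
definition mcount :: "'a multiset \<Rightarrow> 'a set \<Rightarrow> nat" where
  "mcount \<omega> A = size (filter_mset (\<lambda>x. x \<in> A) \<omega>)"

definition conf_space :: "('a::topological_space) multiset measure" where
  "conf_space = sigma UNIV {{\<omega>. mcount \<omega> A = n} | A n. A \<in> sets borel}"

definition dTV :: "('a::topological_space) multiset \<Rightarrow> 'a multiset \<Rightarrow> real" where
  "dTV \<omega>1 \<omega>2 = (SUP A \<in> sets borel. \<bar>real (mcount \<omega>1 A) - real (mcount \<omega>2 A)\<bar>)"

definition couplings ::
  "('a::topological_space) multiset measure \<Rightarrow> 'a multiset measure \<Rightarrow> ('a multiset \<times> 'a multiset) measure set" where
  "couplings P Q = {C. prob_space C \<and> sets C = sets (conf_space \<Otimes>\<^sub>M conf_space) \<and>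
      distr C conf_space fst = P \<and> distr C conf_space snd = Q}"

definition dKR :: "('a::topological_space) multiset measure \<Rightarrow> 'a multiset measure \<Rightarrow> ennreal" where
  "dKR P Q = (INF C \<in> couplings P Q. \<integral>\<^sup>+ p. ennreal (dTV (fst p) (snd p)) \<partial>C)"

definition poisson_process_law :: "('a::topological_space) measure \<Rightarrow> 'a multiset measure \<Rightarrow> bool" where
  "poisson_process_law lam P \<longleftrightarrow>
     prob_space P \<and> sets P = sets conf_space \<and>
     (\<forall>A \<in> sets borel. emeasure lam A < \<infinity> \<longrightarrow>
        (\<forall>n. measure P {\<omega> \<in> space P. mcount \<omega> A = n} =
              (measure lam A) ^ n / fact n * exp (- measure lam A))) \<and>
     (\<forall>(k::nat) As. (\<forall>i<k. As i \<in> sets borel) \<and> disjoint_family_on As {..<k} \<longrightarrow>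
        prob_space.indep_vars P (\<lambda>_. count_space UNIV) (\<lambda>i \<omega>. mcount \<omega> (As i)) {..<k})"

definition binomial_process_law :: "('a::euclidean_space) set \<Rightarrow> nat \<Rightarrow> 'a multiset measure" where
  "binomial_process_law K n =
     distr (PiM {..<n} (\<lambda>_. uniform_measure lborel K)) conf_space (\<lambda>x. mset (map x [0..<n]))"

definition scaled_vol :: "real \<Rightarrow> ('a::euclidean_space) set \<Rightarrow> 'a measure" where
  "scaled_vol c K = density lborel (\<lambda>x. ennreal c * indicator K x)"

definition kappa :: "('a::euclidean_space) itself \<Rightarrow> real" where
  "kappa _ = measure lborel (ball (0::'a) 1)"

definition pairs_neq :: "'a multiset \<Rightarrow> ('a \<times> 'a) multiset" where
  "pairs_neq \<omega> = sum_mset (image_mset (\<lambda>x. image_mset (Pair x) (\<omega> - {#x#})) \<omega>)"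

text \<open>xi(omega) = 1/2 * sum over (x,y) in pairs_neq with norm(x-y) <= r of delta_{(x+y)/2}.
  Since the summand is symmetric, each unordered pair contributes twice, so halving the
  counts gives an integer-valued counting measure.\<close>
definition xi_map :: "real \<Rightarrow> ('a::real_normed_vector) multiset \<Rightarrow> 'a multiset" where
  "xi_map r \<omega> = Abs_multiset (\<lambda>z. count (image_mset (\<lambda>(x,y). (1/2) *\<^sub>R (x + y))
        (filter_mset (\<lambda>(x,y). norm (x - y) \<le> r) (pairs_neq \<omega>))) z div 2)"

end

theory Submission
  imports Defs
begin

text \<open>
  If a measure \<open>R\<close> lies below the laws of both \<open>\<xi>\<close> and \<open>\<zeta>\<close>, coupling along \<open>R\<close> on the
  diagonal shows that the Kantorovich-Rubinstein distance is at most
  \<open>E|\<xi>| + E|\<zeta>| - 2 \<integral>|\<omega>| dR\<close>. So only first moments and a lower bound for the law of \<open>\<xi>\<close>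
  are needed, and no upper bounds for its densities.

  Both input processes consist of a random number \<open>N\<close> of independent uniform points. The lower
  bound keeps the configurations in which exactly \<open>k\<close> edges occur and these form a matching:
  given \<open>N = n\<close> there are \<open>n (n - 1) \<dots> (n - 2 k + 1) / (2^k k!)\<close> ways to choose the matching;
  for each edge, the change of variables \<open>(x, y) \<mapsto> ((x + y) / 2, x - y)\<close> produces a factor
  \<open>b\<close>, the volume of a ball of radius \<open>r\<close>; and if the remaining points are placed one after
  another, each has to avoid the balls of radius \<open>r\<close> around the points already present. Averaging
  over \<open>N\<close> yields the Poisson weights up to a relative error \<open>O((1 + k^2) / t)\<close>. The density
  of the midpoints is uniform as long as they stay at distance \<open>r / 2\<close> from the boundary, which
  costs \<open>O(r) = O(t^(-2/d))\<close>, and at distance \<open>2 r\<close> from each other.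
\<close>

section \<open>The space of finite configurations\<close>

text \<open>For \<open>t > t0\<close> the minimum in the radius is \<open>a t^(-2/d)\<close>, so
  \<open>\<theta>\<close> drops out. A ball of radius \<open>r\<close> then has volume
  \<open>b = 2 l / t^2\<close>, with \<open>l\<close> the total mass of the limit, and the mean
  number of edges, at most \<open>n (n - 1) b / 2\<close> given \<open>N = n\<close>, is close to
  \<open>l\<close>. Closeness of the laws in total variation would not suffice: a configuration of
  \<open>k\<close> points missing from the common part costs \<open>k\<close>, so the relative error
  \<open>1 + k^2\<close> is integrated against \<open>k\<close>, and a third Poisson moment enters
  the constant. The missing mass counts twice, once in each remainder. Midpoints have to be
  \<open>2 r\<close> apart because endpoints lie within \<open>r / 2\<close> of them: endpoints of
  different edges are then farther than \<open>r\<close> apart, and the chosen edges are the only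
  ones among them. Two obstacles are measure theoretic. A Poisson process is given by its counts on
  disjoint sets, so its law must first be identified with the mixture over \<open>N\<close>. And
  points carry no measurable enumeration, so measurability of \<open>xi_map\<close> has to be drawn
  from counts.\<close>

lemma space_conf_space [simp]: "space conf_space = UNIV"
  by (simp add: conf_space_def)

lemma sets_conf_space:
  "sets conf_space = sigma_sets UNIV {{\<omega>. mcount \<omega> A = n} | A n. A \<in> sets borel}"
  by (simp add: conf_space_def)

lemma mcount_empty [simp]: "mcount {#} A = 0"
  by (simp add: mcount_def)

lemma mcount_add_mset [simp]: "mcount (add_mset x \<omega>) A = (if x \<in> A then Suc (mcount \<omega> A) else mcount \<omega> A)"
  by (simp add: mcount_def)

lemma mcount_plus [simp]: "mcount (\<omega> + \<eta>) A = mcount \<omega> A + mcount \<eta> A"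
  by (simp add: mcount_def)

lemma mcount_UNIV [simp]: "mcount \<omega> UNIV = size \<omega>"
  by (simp add: mcount_def)

lemma mcount_le_size: "mcount \<omega> A \<le> size \<omega>"
  by (simp add: mcount_def size_filter_mset_lesseq)

lemma mcount_eq_0_iff: "mcount \<omega> A = 0 \<longleftrightarrow> set_mset \<omega> \<inter> A = {}"
  by (auto simp: mcount_def filter_mset_eq_mempty_iff)

lemma sets_mcount_eq: "A \<in> sets borel \<Longrightarrow> {\<omega>. mcount \<omega> A = n} \<in> sets conf_space"
  unfolding sets_conf_space by (rule sigma_sets.Basic) blast

lemma measurable_mcount:
  assumes "A \<in> sets borel"
  shows "(\<lambda>\<omega>. mcount \<omega> A) \<in> conf_space \<rightarrow>\<^sub>M count_space UNIV"
  using sets_mcount_eq[OF assms]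
  by (subst measurable_count_space_eq2_countable) (auto simp: vimage_def)

lemma measurable_mcount' [measurable (raw)]:
  assumes "f \<in> M \<rightarrow>\<^sub>M conf_space" "A \<in> sets borel"
  shows "(\<lambda>x. mcount (f x) A) \<in> M \<rightarrow>\<^sub>M count_space UNIV"
  using measurable_compose[OF assms(1) measurable_mcount[OF assms(2)]] .

lemma measurable_size [measurable (raw)]:
  assumes "f \<in> M \<rightarrow>\<^sub>M conf_space"
  shows "(\<lambda>x. size (f x)) \<in> M \<rightarrow>\<^sub>M count_space UNIV"
  using measurable_mcount'[OF assms, of UNIV] by simp

lemma measurable_conf_spaceI:
  fixes f :: "'b \<Rightarrow> ('a::topological_space) multiset"
  assumes "\<And>A. A \<in> sets borel \<Longrightarrow> (\<lambda>x. mcount (f x) A) \<in> M \<rightarrow>\<^sub>M count_space UNIV"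
  shows "f \<in> M \<rightarrow>\<^sub>M conf_space"
  unfolding conf_space_def
proof (rule measurable_measure_of)
  fix S :: "'a multiset set" assume "S \<in> {{\<omega>. mcount \<omega> A = n} | A n. A \<in> sets borel}"
  then obtain A n where S: "S = {\<omega>. mcount \<omega> A = n}" and A: "A \<in> sets borel" by auto
  have "f -` S \<inter> space M = (\<lambda>x. mcount (f x) A) -` {n} \<inter> space M" using S by auto
  also have "\<dots> \<in> sets M" by (rule measurable_sets[OF assms[OF A]]) simp
  finally show "f -` S \<inter> space M \<in> sets M" .
qed auto

lemma measurable_add_mset [measurable (raw)]:
  assumes [measurable]: "f \<in> M \<rightarrow>\<^sub>M borel" "g \<in> M \<rightarrow>\<^sub>M conf_space"
  shows "(\<lambda>x. add_mset (f x) (g x)) \<in> M \<rightarrow>\<^sub>M conf_space"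
proof (rule measurable_conf_spaceI)
  fix A :: "'b set" assume [measurable]: "A \<in> sets borel"
  show "(\<lambda>x. mcount (add_mset (f x) (g x)) A) \<in> M \<rightarrow>\<^sub>M count_space UNIV"
    by simp
qed

lemma measurable_subset_conf [measurable (raw)]:
  assumes "f \<in> M \<rightarrow>\<^sub>M conf_space" "W \<in> sets borel"
  shows "Measurable.pred M (\<lambda>x. set_mset (f x) \<subseteq> W)"
proof -
  have "(\<lambda>x. set_mset (f x) \<subseteq> W) = (\<lambda>x. mcount (f x) (- W) = 0)"
    by (auto simp: mcount_eq_0_iff)
  moreover have "Measurable.pred M (\<lambda>x. mcount (f x) (- W) = 0)"
    using assms by measurable
  ultimately show ?thesis by simp
qed

text \<open>The generating events of \<open>conf_space\<close> constrain one count each and need not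
  be closed under intersection. Lists of constraints, with overlapping sets allowed, are:
  intersecting means appending.\<close>

definition cylinder :: "('a set \<times> nat) list \<Rightarrow> 'a multiset set" where
  "cylinder L = {\<omega>. \<forall>(A, n) \<in> set L. mcount \<omega> A = n}"

definition cylinders :: "('a::topological_space) multiset set set" where
  "cylinders = {cylinder L | L. fst ` set L \<subseteq> sets borel}"

lemma cylinder_Nil [simp]: "cylinder [] = UNIV"
  by (simp add: cylinder_def)

lemma cylinder_Cons: "cylinder ((A, n) # L) = {\<omega>. mcount \<omega> A = n} \<inter> cylinder L"
  by (auto simp: cylinder_def)

lemma cylinder_measurable: "fst ` set L \<subseteq> sets borel \<Longrightarrow> cylinder L \<in> sets conf_space"
proof (induction L)
  case (Cons a L)
  then show ?case by (cases a) (auto simp: cylinder_Cons intro!: sets.Int sets_mcount_eq)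
qed (use sets.top[of conf_space] in simp)

lemma Int_stable_cylinders: "Int_stable cylinders"
proof (rule Int_stableI)
  fix S T :: "'a multiset set" assume "S \<in> cylinders" "T \<in> cylinders"
  then obtain L L' where "S = cylinder L" "T = cylinder L'" "fst ` set L \<subseteq> sets borel" "fst ` set L' \<subseteq> sets borel"
    by (auto simp: cylinders_def)
  then have "S \<inter> T = cylinder (L @ L')" "fst ` set (L @ L') \<subseteq> sets borel"
    by (simp_all add: cylinder_def ball_Un Collect_conj_eq image_Un)
  then show "S \<inter> T \<in> cylinders"
    unfolding cylinders_def by blast
qed

lemma sets_conf_space_cylinders:
  "sets (conf_space :: ('a::topological_space) multiset measure) = sigma_sets UNIV cylinders"
proof
  show "sets (conf_space :: 'a multiset measure) \<subseteq> sigma_sets UNIV cylinders"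
    unfolding sets_conf_space
  proof (rule sigma_sets_mono, rule subsetI)
    fix S :: "'a multiset set" assume "S \<in> {{\<omega>. mcount \<omega> A = n} | A n. A \<in> sets borel}"
    then obtain A n where "S = cylinder [(A, n)]" "A \<in> sets borel"
      by (auto simp: cylinder_def)
    then have "S \<in> cylinders"
      unfolding cylinders_def by force
    then show "S \<in> sigma_sets UNIV cylinders" by (rule sigma_sets.Basic)
  qed
  have "cylinders \<subseteq> sets (conf_space :: 'a multiset measure)"
    using cylinder_measurable unfolding cylinders_def by blast
  from sets.sigma_sets_subset[OF this] show "sigma_sets UNIV cylinders \<subseteq> sets (conf_space :: 'a multiset measure)" by simp
qed

section \<open>Measurability of sums over the points of a configuration\<close>

lemma sum_mset_SUP_ennreal:
  fixes f :: "nat \<Rightarrow> 'a \<Rightarrow> ennreal"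
  assumes "incseq f"
  shows "(\<Sum>x\<in>#\<omega>. SUP i. f i x) = (SUP i. \<Sum>x\<in>#\<omega>. f i x)"
proof (induction \<omega>)
  case (add x \<omega>)
  have "incseq (\<lambda>i. f i x)" using assms by (auto simp: incseq_def le_fun_def)
  moreover have "incseq (\<lambda>i. \<Sum>x\<in>#\<omega>. f i x)"
    using assms by (auto simp: incseq_def le_fun_def intro!: sum_mset_mono)
  ultimately show ?case using add by (simp add: ennreal_SUP_add)
qed simp

lemma sum_mset_indicator_neq_top: "(\<Sum>x\<in>#\<omega>. indicator A (h x) :: ennreal) \<noteq> top"
  by (induction \<omega>) (auto simp: indicator_def)

text \<open>Without an enumeration of the points of \<open>m q\<close>, measurability cannot be read
  off the summands; a Dynkin class argument replaces this. Complements are handled by subtracting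
  from the total \<open>size (m q)\<close>, which works because all sums are finite.\<close>

lemma measurable_sum_mset_indicator:
  fixes m :: "'q \<Rightarrow> 'a multiset" and h :: "'q \<Rightarrow> 'a \<Rightarrow> 'c"
  assumes E: "Int_stable E" "E \<subseteq> Pow \<Omega>"
    and h: "\<And>q x. q \<in> space M \<Longrightarrow> h q x \<in> \<Omega>"
    and size: "(\<lambda>q. of_nat (size (m q)) :: ennreal) \<in> borel_measurable M"
    and basic: "\<And>S. S \<in> E \<Longrightarrow> (\<lambda>q. \<Sum>x\<in>#m q. indicator S (h q x) :: ennreal) \<in> borel_measurable M"
    and S: "S \<in> sigma_sets \<Omega> E"
  shows "(\<lambda>q. \<Sum>x\<in>#m q. indicator S (h q x) :: ennreal) \<in> borel_measurable M"
  using E S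
proof (induction S rule: sigma_sets_induct_disjoint)
  case (basic A) then show ?case by (rule assms(5))
next
  case empty then show ?case by simp
next
  case (compl A)
  have *: "(\<Sum>x\<in>#m q. indicator (\<Omega> - A) (h q x)) = of_nat (size (m q)) - (\<Sum>x\<in>#m q. indicator A (h q x) :: ennreal)"
    if "q \<in> space M" for q
  proof -
    have "(\<Sum>x\<in>#\<omega>. indicator (\<Omega> - A) (h q x)) + (\<Sum>x\<in>#\<omega>. indicator A (h q x) :: ennreal) = of_nat (size \<omega>)" for \<omega>
    proof (induction \<omega>)
      case (add x \<omega>)
      then show ?case using h[OF that, of x] by (auto simp: indicator_def ac_simps split: if_splits)
    qed simp
    from this[of "m q", symmetric] show ?thesis
      by (simp add: ennreal_add_diff_cancel_right sum_mset_indicator_neq_top)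
  qed
  show ?case
    by (subst measurable_cong[OF *]) (use compl size in measurable)
next
  case (union A)
  have *: "(\<Sum>x\<in>#\<omega>. indicator (\<Union>i. A i) (h q x)) = (\<Sum>i. \<Sum>x\<in>#\<omega>. indicator (A i) (h q x) :: ennreal)" for \<omega> q
  proof (induction \<omega>)
    case (add x \<omega>)
    then show ?case using suminf_indicator[OF union(1), of "h q x"] by (simp add: suminf_add[symmetric])
  qed simp
  show ?case unfolding * using union by measurable
qed

text \<open>Makes the left sides of the Mecke formulas measurable. The indicator case grows from
  cylinders to products \<open>A \<times> C\<close>, to measurable sets of pairs, and to sets that
  include the parameter \<open>p\<close>; monotone approximation does the rest.\<close>

lemma measurable_sum_mset_remove:
  fixes G :: "'p \<times> ('a::topological_space) \<times> 'a multiset \<Rightarrow> ennreal"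
  assumes "G \<in> borel_measurable (N \<Otimes>\<^sub>M (borel \<Otimes>\<^sub>M conf_space))"
  shows "(\<lambda>(p, \<omega>). \<Sum>x\<in>#\<omega>. G (p, x, \<omega> - {#x#})) \<in> borel_measurable (N \<Otimes>\<^sub>M conf_space)"
proof -
  let ?\<Phi> = "\<lambda>(S :: ('a \<times> 'a multiset) set) (\<omega>::'a multiset). (\<Sum>x\<in>#\<omega>. indicator S (x, \<omega> - {#x#}) :: ennreal)"
  have step1: "?\<Phi> (A \<times> cylinder L) \<in> borel_measurable conf_space"
    if "A \<in> sets borel" "fst ` set L \<subseteq> sets borel" for A and L :: "('a set \<times> nat) list"
    using that
  proof (induction L arbitrary: A)
    case Nil
    have "?\<Phi> (A \<times> UNIV) \<omega> = of_nat (mcount \<omega> A)" for \<omega>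
    proof -
      have "(\<Sum>x\<in>#\<omega>. indicator (A \<times> (UNIV::'a multiset set)) (x, f x)) = (of_nat (mcount \<omega> A) :: ennreal)" for f
        by (induction \<omega>) (auto simp: indicator_def)
      then show ?thesis .
    qed
    with Nil show ?case by simp
  next
    case (Cons c L)
    obtain B n where c: "c = (B, n)" by (cases c)
    have [measurable]: "A \<in> sets borel" "B \<in> sets borel" using Cons c by auto
    have [measurable]: "?\<Phi> ((A \<inter> B) \<times> cylinder L) \<in> borel_measurable conf_space"
      "?\<Phi> ((A - B) \<times> cylinder L) \<in> borel_measurable conf_space"
      using Cons by auto
    \<comment> \<open>Removing \<open>x\<close> lowers the count of \<open>B\<close> exactly if
      \<open>x \<in> B\<close>. The constraint on the reduced configuration thus becomes one on
      \<open>\<omega>\<close> itself, with \<open>n\<close> shifted by one on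
      \<open>A \<inter> B\<close>, and leaves the sum.\<close>
    have *: "?\<Phi> (A \<times> cylinder (c # L)) \<omega> =
       (if mcount \<omega> B = Suc n then ?\<Phi> ((A \<inter> B) \<times> cylinder L) \<omega> else 0)
     + (if mcount \<omega> B = n then ?\<Phi> ((A - B) \<times> cylinder L) \<omega> else 0)" (is "_ = ?r \<omega>") for \<omega>
    proof -
      have "(indicator (A \<times> cylinder (c # L)) (x, \<omega> - {#x#}) :: ennreal) =
          (if mcount \<omega> B = Suc n then indicator ((A \<inter> B) \<times> cylinder L) (x, \<omega> - {#x#}) else 0)
        + (if mcount \<omega> B = n then indicator ((A - B) \<times> cylinder L) (x, \<omega> - {#x#}) else 0)" if "x \<in># \<omega>" for x
      proof -
        from that obtain \<eta> where "\<omega> = add_mset x \<eta>" by (metis insert_DiffM)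
        then show ?thesis by (auto simp: c cylinder_Cons indicator_def)
      qed
      then have "?\<Phi> (A \<times> cylinder (c # L)) \<omega> = (\<Sum>x\<in>#\<omega>. (if mcount \<omega> B = Suc n then indicator ((A \<inter> B) \<times> cylinder L) (x, \<omega> - {#x#}) else 0)
        + (if mcount \<omega> B = n then indicator ((A - B) \<times> cylinder L) (x, \<omega> - {#x#}) else 0))"
        by (intro arg_cong[where f = sum_mset] image_mset_cong)
      then show ?thesis by (simp add: sum_mset.distrib)
    qed
    have "?r \<in> borel_measurable conf_space" by measurable
    then show ?case unfolding * .
  qed
  have step2: "?\<Phi> (A \<times> C) \<in> borel_measurable conf_space"
    if A: "A \<in> sets borel" and C: "C \<in> sets conf_space" for A C
  proof -
    \<comment> \<open>Filtering by \<open>A\<close> absorbs the first factor into the multiset, so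
      the Dynkin argument runs in the second coordinate alone.\<close>
    let ?m = "\<lambda>\<omega>::'a multiset. filter_mset (\<lambda>x. x \<in> A) \<omega>"
    have *: "(\<Sum>x\<in>#filter_mset (\<lambda>x. x \<in> A) \<eta>. indicator C (\<omega> - {#x#})) = (\<Sum>x\<in>#\<eta>. indicator (A \<times> C) (x, \<omega> - {#x#}) :: ennreal)" for \<omega> \<eta> C
      by (induction \<eta>) (auto simp: indicator_def)
    have "(\<lambda>\<omega>. \<Sum>x\<in>#?m \<omega>. indicator C (\<omega> - {#x#}) :: ennreal) \<in> borel_measurable conf_space"
    proof (rule measurable_sum_mset_indicator[OF Int_stable_cylinders, where \<Omega> = UNIV])
      show "(\<lambda>q. of_nat (size (?m q)) :: ennreal) \<in> borel_measurable conf_space"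
        using A unfolding mcount_def[symmetric] by measurable
    next
      fix S :: "'a multiset set" assume "S \<in> cylinders"
      with A show "(\<lambda>\<omega>. \<Sum>x\<in>#?m \<omega>. indicator S (\<omega> - {#x#}) :: ennreal) \<in> borel_measurable conf_space"
        unfolding * using step1 by (auto simp: cylinders_def)
    qed (use C in \<open>auto simp: sets_conf_space_cylinders\<close>)
    then show ?thesis unfolding * .
  qed
  have step3: "?\<Phi> T \<in> borel_measurable conf_space" if T: "T \<in> sets (borel \<Otimes>\<^sub>M conf_space)" for T :: "('a \<times> 'a multiset) set"
  proof (rule measurable_sum_mset_indicator[OF Int_stable_pair_measure_generator[of "borel :: 'a measure" conf_space], where \<Omega> = "space borel \<times> space conf_space"])
    show "T \<in> sigma_sets (space borel \<times> space conf_space) {a \<times> b |a b. a \<in> sets (borel::'a measure) \<and> b \<in> sets conf_space}"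
      using T by (simp add: sets_pair_measure)
  qed (use step2 in auto)
  have step4: "(\<lambda>(p, \<omega>). \<Sum>x\<in>#\<omega>. indicator S (p, x, \<omega> - {#x#}) :: ennreal) \<in> borel_measurable (N \<Otimes>\<^sub>M (conf_space :: 'a multiset measure))"
    if S: "S \<in> sets (N \<Otimes>\<^sub>M ((borel :: 'a measure) \<Otimes>\<^sub>M (conf_space :: 'a multiset measure)))" for S
    unfolding case_prod_beta
  proof (rule measurable_sum_mset_indicator[OF Int_stable_pair_measure_generator[of N "(borel :: 'a measure) \<Otimes>\<^sub>M (conf_space :: 'a multiset measure)"], where \<Omega> = "space N \<times> space ((borel :: 'a measure) \<Otimes>\<^sub>M (conf_space :: 'a multiset measure))"])
    show "S \<in> sigma_sets (space N \<times> space ((borel :: 'a measure) \<Otimes>\<^sub>M (conf_space :: 'a multiset measure))) {a \<times> b |a b. a \<in> sets N \<and> b \<in> sets ((borel :: 'a measure) \<Otimes>\<^sub>M (conf_space :: 'a multiset measure))}"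
      using S by (simp add: sets_pair_measure)
  next
    fix S' assume "S' \<in> {a \<times> b |a b. a \<in> sets N \<and> b \<in> sets ((borel :: 'a measure) \<Otimes>\<^sub>M (conf_space :: 'a multiset measure))}"
    then obtain A and T :: "('a \<times> 'a multiset) set" where S': "S' = A \<times> T" and [measurable]: "A \<in> sets N" "T \<in> sets ((borel :: 'a measure) \<Otimes>\<^sub>M (conf_space :: 'a multiset measure))" by auto
    note step3[of T, measurable]
    have *: "(\<Sum>x\<in>#snd q. indicator S' (fst q, x, snd q - {#x#})) = (indicator A (fst q) * ?\<Phi> T (snd q) :: ennreal)" for q
      by (simp add: S' sum_mset_distrib_left indicator_times)
    show "(\<lambda>q. \<Sum>x\<in>#snd q. indicator S' (fst q, x, snd q - {#x#}) :: ennreal) \<in> borel_measurable (N \<Otimes>\<^sub>M (conf_space :: 'a multiset measure))"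
      unfolding * by measurable
  next
    show "(\<lambda>q. of_nat (size (snd q)) :: ennreal) \<in> borel_measurable (N \<Otimes>\<^sub>M (conf_space :: 'a multiset measure))"
      by measurable
  qed (auto simp: space_pair_measure dest: sets.sets_into_space)
  from assms show ?thesis
  proof (induction G rule: borel_measurable_induct)
    case (cong f g)
    have "(\<Sum>x\<in>#\<omega>. g (p, x, \<omega> - {#x#})) = (\<Sum>x\<in>#\<omega>. f (p, x, \<omega> - {#x#}))" if "p \<in> space N" for p \<omega>
      using cong(3) that by (simp add: space_pair_measure)
    then have "(\<lambda>(p, \<omega>). \<Sum>x\<in>#\<omega>. f (p, x, \<omega> - {#x#})) \<in> borel_measurable (N \<Otimes>\<^sub>M conf_space) \<longleftrightarrow>
       (\<lambda>(p, \<omega>). \<Sum>x\<in>#\<omega>. g (p, x, \<omega> - {#x#})) \<in> borel_measurable (N \<Otimes>\<^sub>M conf_space)"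
      by (intro measurable_cong) (auto simp: space_pair_measure)
    then show ?case using cong by simp
  next
    case (set A) then show ?case by (rule step4)
  next
    case (mult u c)
    have "(\<lambda>(p, \<omega>). \<Sum>x\<in>#\<omega>. c * u (p, x, \<omega> - {#x#})) = (\<lambda>q. c * (case q of (p, \<omega>) \<Rightarrow> \<Sum>x\<in>#\<omega>. u (p, x, \<omega> - {#x#})))"
      by (auto simp: sum_mset_distrib_left)
    then show ?case using mult by simp
  next
    case (add u v)
    have "(\<lambda>(p, \<omega>). \<Sum>x\<in>#\<omega>. v (p, x, \<omega> - {#x#}) + u (p, x, \<omega> - {#x#})) =
      (\<lambda>q. (case q of (p, \<omega>) \<Rightarrow> \<Sum>x\<in>#\<omega>. v (p, x, \<omega> - {#x#})) + (case q of (p, \<omega>) \<Rightarrow> \<Sum>x\<in>#\<omega>. u (p, x, \<omega> - {#x#})))"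
      by (auto simp: sum_mset.distrib)
    then show ?case using add by simp
  next
    case (seq U)
    have "(\<lambda>(p, \<omega>). \<Sum>x\<in>#\<omega>. (SUP i. U i) (p, x, \<omega> - {#x#})) =
      (\<lambda>q. SUP i. (case q of (p, \<omega>) \<Rightarrow> \<Sum>x\<in>#\<omega>. U i (p, x, \<omega> - {#x#})))"
    proof (rule ext, clarsimp simp: image_comp)
      fix p \<omega>
      have "incseq (\<lambda>i x. U i (p, x, \<omega> - {#x#}))" using seq(3) by (auto simp: incseq_def le_fun_def)
      from sum_mset_SUP_ennreal[OF this, of \<omega>]
      show "(\<Sum>x\<in>#\<omega>. SUP i. U i (p, x, \<omega> - {#x#})) = (SUP i. \<Sum>x\<in>#\<omega>. U i (p, x, \<omega> - {#x#}))" .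
    qed
    then show ?case using seq by simp
  qed
qed

section \<open>Midpoints of short edges\<close>

lemma pairs_neq_add_mset:
  "pairs_neq (add_mset x \<omega>) = pairs_neq \<omega> + image_mset (Pair x) \<omega> + image_mset (\<lambda>y. (y, x)) \<omega>"
proof -
  have "image_mset (Pair y) (add_mset x \<omega> - {#y#}) = add_mset (y, x) (image_mset (Pair y) (\<omega> - {#y#}))"
    if "y \<in># \<omega>" for y
  proof -
    from that obtain \<eta> where "\<omega> = add_mset y \<eta>" by (metis insert_DiffM)
    then show ?thesis by (simp add: add_mset_commute)
  qed
  then have "(\<Sum>y\<in>#\<omega>. image_mset (Pair y) (add_mset x \<omega> - {#y#})) = (\<Sum>y\<in>#\<omega>. add_mset (y, x) (image_mset (Pair y) (\<omega> - {#y#})))"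
    by (intro arg_cong[where f = sum_mset] image_mset_cong)
  also have "\<dots> = (\<Sum>y\<in>#\<omega>. {#(y, x)#} + image_mset (Pair y) (\<omega> - {#y#}))"
    by simp
  also have "\<dots> = (\<Sum>y\<in>#\<omega>. {#(y, x)#}) + pairs_neq \<omega>"
    unfolding pairs_neq_def by (subst sum_mset.distrib) simp
  also have "(\<Sum>y\<in>#\<omega>. {#(y, x)#}) = image_mset (\<lambda>y. (y, x)) \<omega>"
    by (induction \<omega>) auto
  finally have *: "(\<Sum>y\<in>#\<omega>. image_mset (Pair y) (add_mset x \<omega> - {#y#})) = image_mset (\<lambda>y. (y, x)) \<omega> + pairs_neq \<omega>" .
  have "pairs_neq (add_mset x \<omega>) = image_mset (Pair x) \<omega> + (\<Sum>y\<in>#\<omega>. image_mset (Pair y) (add_mset x \<omega> - {#y#}))"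
    unfolding pairs_neq_def by simp
  then show ?thesis
    unfolding * by (simp only: ac_simps)
qed

text \<open>The support of the halved count lies in that of the original multiset, so
  \<open>Abs_multiset\<close> is applied to a finitely supported function.\<close>

lemma count_xi_map:
  "count (xi_map r \<omega>) z = count (image_mset (\<lambda>(x,y). (1/2) *\<^sub>R (x + y))
        (filter_mset (\<lambda>(x,y). norm (x - y) \<le> r) (pairs_neq \<omega>))) z div 2"
proof -
  have "finite {z. 0 < count N z div 2}" for N :: "'b multiset"
    by (rule finite_subset[of _ "set_mset N"]) (auto intro: count_inI)
  then show ?thesis
    unfolding xi_map_def by (subst count_Abs_multiset) auto
qed

lemma xi_map_empty [simp]: "xi_map r {#} = {#}"
  by (rule multiset_eqI) (simp add: count_xi_map pairs_neq_def)

definition edges_from :: "real \<Rightarrow> 'a::real_normed_vector \<Rightarrow> 'a multiset \<Rightarrow> 'a multiset" where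
  "edges_from r x \<omega> = {#(1/2) *\<^sub>R (x + y). y \<in># filter_mset (\<lambda>y. norm (x - y) \<le> r) \<omega>#}"

text \<open>Both orientations of a new pair have the same midpoint, so exactly twice
  \<open>edges_from r x \<omega>\<close> is added before halving and \<open>div 2\<close> loses
  nothing. From here on this recursion replaces the definition by pairs.\<close>

lemma xi_map_add_mset: "xi_map r (add_mset x \<omega>) = xi_map r \<omega> + edges_from r x \<omega>"
proof (rule multiset_eqI)
  fix z
  let ?m = "\<lambda>(x, y). (1/2) *\<^sub>R (x + y)" and ?P = "\<lambda>(x, y). norm (x - y) \<le> r"
  have 1: "image_mset ?m (filter_mset ?P (image_mset (Pair x) \<omega>)) = edges_from r x \<omega>"
    by (simp add: edges_from_def filter_mset_image_mset image_mset.compositionality comp_def)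
  have 2: "image_mset ?m (filter_mset ?P (image_mset (\<lambda>y. (y, x)) \<omega>)) = edges_from r x \<omega>"
    by (simp add: edges_from_def filter_mset_image_mset image_mset.compositionality comp_def norm_minus_commute add.commute)
  show "count (xi_map r (add_mset x \<omega>)) z = count (xi_map r \<omega> + edges_from r x \<omega>) z"
    by (simp add: count_xi_map pairs_neq_add_mset 1 2)
qed

text \<open>Brings \<open>xi_map\<close> into the shape of a double sum over removed points, to
  which the measurability lemma and the Mecke formula apply; the factor 2 stays because ordered
  pairs are summed.\<close>

lemma double_mcount_xi_map:
  "(of_nat (2 * mcount (xi_map r \<omega>) A) :: ennreal) =
    (\<Sum>x\<in>#\<omega>. \<Sum>y\<in>#\<omega> - {#x#}. of_bool (norm (x - y) \<le> r \<and> (1/2) *\<^sub>R (x + y) \<in> A))"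
proof (induction \<omega>)
  case (add z \<omega>)
  let ?s = "\<lambda>x y. of_bool (norm (x - y) \<le> r \<and> (1/2) *\<^sub>R (x + y) \<in> A) :: ennreal"
  have "(\<Sum>y\<in>#add_mset z \<omega> - {#x#}. ?s x y) = ?s z x + (\<Sum>y\<in>#\<omega> - {#x#}. ?s x y)" if "x \<in># \<omega>" for x
  proof -
    from that obtain \<eta> where "\<omega> = add_mset x \<eta>" by (metis insert_DiffM)
    then show ?thesis by (simp add: norm_minus_commute add.commute)
  qed
  then have "(\<Sum>x\<in>#\<omega>. \<Sum>y\<in>#add_mset z \<omega> - {#x#}. ?s x y) = (\<Sum>x\<in>#\<omega>. ?s z x + (\<Sum>y\<in>#\<omega> - {#x#}. ?s x y))"
    by (intro arg_cong[where f = sum_mset] image_mset_cong)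
  also have "\<dots> = (\<Sum>x\<in>#\<omega>. ?s z x) + of_nat (2 * mcount (xi_map r \<omega>) A)"
    unfolding add by (rule sum_mset.distrib)
  finally have *: "(\<Sum>x\<in>#add_mset z \<omega>. \<Sum>y\<in>#add_mset z \<omega> - {#x#}. ?s x y) =
     (\<Sum>y\<in>#\<omega>. ?s z y) + ((\<Sum>x\<in>#\<omega>. ?s z x) + of_nat (2 * mcount (xi_map r \<omega>) A))"
    by simp
  have "(\<Sum>y\<in>#\<omega>. ?s z y) = of_nat (mcount (edges_from r z \<omega>) A)"
    by (induction \<omega>) (auto simp: edges_from_def)
  then show ?case
    unfolding * by (simp add: xi_map_add_mset algebra_simps mult_2)
qed simp

lemma measurable_sum_mset_remove':
  fixes m :: "'q \<Rightarrow> ('a::topological_space) multiset"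
  assumes [measurable]: "m \<in> M \<rightarrow>\<^sub>M conf_space"
    and G: "(\<lambda>q. G (fst q) (fst (snd q)) (snd (snd q))) \<in> borel_measurable (M \<Otimes>\<^sub>M (borel \<Otimes>\<^sub>M conf_space))"
  shows "(\<lambda>q. \<Sum>x\<in>#m q. G q x (m q - {#x#}) :: ennreal) \<in> borel_measurable M"
proof -
  have "(\<lambda>q. (q, m q)) \<in> M \<rightarrow>\<^sub>M M \<Otimes>\<^sub>M conf_space"
    by measurable
  from measurable_compose[OF this measurable_sum_mset_remove[OF G]] show ?thesis
    by simp
qed

lemma measurable_xi_map:
  "xi_map r \<in> (conf_space :: ('a::{real_normed_vector, second_countable_topology}) multiset measure) \<rightarrow>\<^sub>M conf_space"
proof (rule measurable_conf_spaceI)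
  fix A :: "'a set" assume [measurable]: "A \<in> sets borel"
  define S where "S = {p. norm (fst p - snd p) \<le> r \<and> (1/2) *\<^sub>R (fst p + snd p) \<in> A}"
  have "S \<in> sets (borel \<Otimes>\<^sub>M borel)"
  proof -
    have "S = {p. norm (fst p - snd p) \<le> r} \<inter> (\<lambda>p. (1/2) *\<^sub>R (fst p + snd p)) -` A"
      by (auto simp: S_def)
    moreover have "closed {p :: 'a \<times> 'a. norm (fst p - snd p) \<le> r}"
      by (intro closed_Collect_le continuous_intros)
    moreover have "(\<lambda>p :: 'a \<times> 'a. (1/2) *\<^sub>R (fst p + snd p)) \<in> borel_measurable borel"
      by (intro borel_measurable_continuous_onI continuous_intros)
    ultimately show ?thesis
      unfolding borel_prod using measurable_sets[of "\<lambda>p :: 'a \<times> 'a. (1/2) *\<^sub>R (fst p + snd p)" borel borel A]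
      by (auto intro!: sets.Int borel_closed)
  qed
  let ?s = "\<lambda>x y. indicator S (x, y) :: ennreal"
  have *: "(of_bool (norm (x - y) \<le> r \<and> (1/2) *\<^sub>R (x + y) \<in> A) :: ennreal) = ?s x y" for x y
    by (simp add: S_def indicator_def)
  have 1: "(\<lambda>q. \<Sum>y\<in>#snd q. ?s (fst q) y) \<in> borel_measurable (borel \<Otimes>\<^sub>M conf_space)"
    by (rule measurable_sum_mset_remove'[where G = "\<lambda>q y \<eta>. ?s (fst q) y"])
      (use \<open>S \<in> _\<close> in measurable)
  have "(\<lambda>\<omega>. \<Sum>x\<in>#\<omega>. \<Sum>y\<in>#\<omega> - {#x#}. ?s x y) \<in> borel_measurable conf_space"
    by (rule measurable_sum_mset_remove'[where G = "\<lambda>q x \<eta>. \<Sum>y\<in>#\<eta>. ?s x y"])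
      (auto intro: measurable_compose[OF measurable_snd 1])
  then have m: "(\<lambda>\<omega>. of_nat (2 * mcount (xi_map r \<omega>) A) :: ennreal) \<in> borel_measurable conf_space"
    unfolding double_mcount_xi_map * .
  show "(\<lambda>\<omega>. mcount (xi_map r \<omega>) A) \<in> conf_space \<rightarrow>\<^sub>M count_space UNIV"
  proof (subst measurable_count_space_eq2_countable, safe)
    fix n
    have "(\<lambda>\<omega>. mcount (xi_map r \<omega>) A) -` {n} \<inter> space conf_space =
      (\<lambda>\<omega>. of_nat (2 * mcount (xi_map r \<omega>) A) :: ennreal) -` {of_nat (2 * n)} \<inter> space conf_space"
      by (auto simp del: of_nat_mult)
    also have "\<dots> \<in> sets conf_space"
      by (rule measurable_sets[OF m]) simp
    finally show "(\<lambda>\<omega>. mcount (xi_map r \<omega>) A) -` {n} \<inter> space conf_space \<in> sets conf_space" .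
  qed simp
qed

lemma measurable_xi_map' [measurable (raw)]:
  fixes f :: "'b \<Rightarrow> ('a::{real_normed_vector, second_countable_topology}) multiset"
  shows "f \<in> M \<rightarrow>\<^sub>M conf_space \<Longrightarrow> (\<lambda>x. xi_map r (f x)) \<in> M \<rightarrow>\<^sub>M conf_space"
  by (rule measurable_compose[OF _ measurable_xi_map])

lemma measurable_empty_conf [measurable (raw)]:
  assumes "f \<in> M \<rightarrow>\<^sub>M conf_space"
  shows "Measurable.pred M (\<lambda>x. f x = {#})"
proof -
  have "Measurable.pred M (\<lambda>x. size (f x) = 0)"
    using assms by measurable
  then show ?thesis by simp
qed

section \<open>Binomial processes\<close>

locale unit_volume =
  fixes K :: "'a::euclidean_space set"
  assumes K_borel [measurable]: "K \<in> sets borel"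
    and emeasure_K: "emeasure lborel K = 1"
begin

abbreviation U :: "'a measure" where "U \<equiv> uniform_measure lborel K"
abbreviation B :: "nat \<Rightarrow> 'a multiset measure" where "B n \<equiv> binomial_process_law K n"

lemma prob_space_U: "prob_space U"
  by (rule prob_space_uniform_measure) (auto simp: emeasure_K)

lemma nn_integral_U:
  assumes "f \<in> borel_measurable borel"
  shows "(\<integral>\<^sup>+x. f x \<partial>U) = (\<integral>\<^sup>+x. f x * indicator K x \<partial>lborel)"
  using assms by (subst nn_integral_uniform_measure) (auto simp: emeasure_K divide_ennreal_def)

lemma emeasure_U: "A \<in> sets borel \<Longrightarrow> emeasure U A = emeasure lborel (A \<inter> K)"
  by (simp add: emeasure_K Int_commute divide_ennreal_def)

text \<open>Stated for prefixes of a fixed product, so that the induction on \<open>m\<close> never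
  changes the underlying space.\<close>

lemma measurable_mset_map:
  assumes "m \<le> n"
  shows "(\<lambda>x. mset (map x [0..<m])) \<in> PiM {..<n} (\<lambda>_. U) \<rightarrow>\<^sub>M conf_space"
  using assms
proof (induction m)
  case (Suc m)
  then have [measurable]: "(\<lambda>x. mset (map x [0..<m])) \<in> PiM {..<n} (\<lambda>_. U) \<rightarrow>\<^sub>M conf_space" by simp
  have "(\<lambda>x. x m) \<in> PiM {..<n} (\<lambda>_. U) \<rightarrow>\<^sub>M U"
    using Suc by (intro measurable_component_singleton) auto
  then have [measurable]: "(\<lambda>x. x m) \<in> PiM {..<n} (\<lambda>_. U) \<rightarrow>\<^sub>M borel"
    by (simp cong: measurable_cong_sets)
  have "(\<lambda>x. add_mset (x m) (mset (map x [0..<m]))) \<in> PiM {..<n} (\<lambda>_. U) \<rightarrow>\<^sub>M conf_space"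
    by measurable
  then show ?case by simp
qed simp

lemma sets_B [simp, measurable_cong]: "sets (B n) = sets conf_space"
  by (simp add: binomial_process_law_def)

lemma space_B [simp]: "space (B n) = UNIV"
  by (simp add: binomial_process_law_def)

lemma prob_space_B: "prob_space (B n)"
  unfolding binomial_process_law_def
  by (intro prob_space.prob_space_distr prob_space_PiM prob_space_U measurable_mset_map) simp

sublocale U: prob_space U by (rule prob_space_U)
sublocale B: prob_space "B n" for n by (rule prob_space_B)

lemma nn_integral_B:
  assumes "F \<in> borel_measurable conf_space"
  shows "(\<integral>\<^sup>+\<omega>. F \<omega> \<partial>B n) = (\<integral>\<^sup>+x. F (mset (map x [0..<n])) \<partial>PiM {..<n} (\<lambda>_. U))"
  unfolding binomial_process_law_def
  using assms measurable_mset_map[OF order_refl, of n] by (intro nn_integral_distr) auto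

lemma nn_integral_B_0: "F \<in> borel_measurable conf_space \<Longrightarrow> (\<integral>\<^sup>+\<omega>. F \<omega> \<partial>B 0) = F {#}"
  by (subst nn_integral_B) (auto simp: PiM_empty nn_integral_count_space_finite)

text \<open>Fubini in the last coordinate. This recursion, rather than the product space, carries
  the inductions over the number of points.\<close>

lemma nn_integral_B_Suc:
  assumes F: "F \<in> borel_measurable conf_space"
  shows "(\<integral>\<^sup>+\<omega>. F \<omega> \<partial>B (Suc n)) = (\<integral>\<^sup>+x. \<integral>\<^sup>+\<omega>. F (add_mset x \<omega>) \<partial>B n \<partial>U)"
proof -
  interpret product_sigma_finite "\<lambda>_::nat. U" ..
  have m: "(\<lambda>x. F (mset (map x [0..<Suc n]))) \<in> borel_measurable (PiM {..<Suc n} (\<lambda>_. U))"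
    by (rule measurable_compose[OF measurable_mset_map[OF order_refl] F])
  have "(\<integral>\<^sup>+\<omega>. F \<omega> \<partial>B (Suc n)) =
      (\<integral>\<^sup>+y. \<integral>\<^sup>+x. F (mset (map (x(n := y)) [0..<Suc n])) \<partial>PiM {..<n} (\<lambda>_. U) \<partial>U)"
    unfolding nn_integral_B[OF F] lessThan_Suc
    by (rule product_nn_integral_insert_rev) (use m in \<open>auto simp: lessThan_Suc\<close>)
  also have "\<dots> = (\<integral>\<^sup>+y. \<integral>\<^sup>+x. F (add_mset y (mset (map x [0..<n]))) \<partial>PiM {..<n} (\<lambda>_. U) \<partial>U)"
  proof -
    have "map (x(n := y)) [0..<n] = map x [0..<n]" for x :: "nat \<Rightarrow> 'a" and y by simp
    then show ?thesis by (simp del: map_fun_upd map_eq_conv)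
  qed
  also have "\<dots> = (\<integral>\<^sup>+x. \<integral>\<^sup>+\<omega>. F (add_mset x \<omega>) \<partial>B n \<partial>U)"
    by (intro nn_integral_cong nn_integral_B[symmetric]) (use F in measurable)
  finally show ?thesis .
qed

lemma measurable_nn_integral_B [measurable (raw)]:
  assumes [measurable]: "(\<lambda>(x, \<omega>). F x \<omega>) \<in> borel_measurable (M \<Otimes>\<^sub>M conf_space)"
  shows "(\<lambda>x. \<integral>\<^sup>+\<omega>. F x \<omega> \<partial>B n) \<in> borel_measurable M"
  by (rule B.borel_measurable_nn_integral) measurable

lemma AE_B_size: "AE \<omega> in B n. size \<omega> = n"
  unfolding binomial_process_law_def
  using sets_mcount_eq[of UNIV n]
  by (subst AE_distr_iff[OF measurable_mset_map[OF order_refl]]) simp_all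

text \<open>The analogue of the Mecke equation for binomial processes.\<close>
lemma nn_integral_B_remove:
  assumes "(\<lambda>q. G (fst q) (snd q)) \<in> borel_measurable (borel \<Otimes>\<^sub>M conf_space)"
  shows "(\<integral>\<^sup>+\<omega>. (\<Sum>x\<in>#\<omega>. G x (\<omega> - {#x#})) \<partial>B (Suc n)) = of_nat (Suc n) * (\<integral>\<^sup>+x. \<integral>\<^sup>+\<omega>. G x \<omega> \<partial>B n \<partial>U)"
  using assms
proof (induction n arbitrary: G)
  case 0
  note [measurable] = 0
  have m: "(\<lambda>\<omega>. \<Sum>x\<in>#\<omega>. G x (\<omega> - {#x#})) \<in> borel_measurable conf_space"
    by (rule measurable_sum_mset_remove'[where G = "\<lambda>q x \<eta>. G x \<eta>"]) measurable
  have "(\<integral>\<^sup>+\<omega>. (\<Sum>y\<in>#add_mset x \<omega>. G y (add_mset x \<omega> - {#y#})) \<partial>B 0) = (\<integral>\<^sup>+\<omega>. G x \<omega> \<partial>B 0)" for x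
  proof -
    have "G x \<in> borel_measurable conf_space"
      by (rule measurable_compose[OF _ 0, of "\<lambda>\<omega>. (x, \<omega>)", simplified]) measurable
    moreover have "(\<lambda>\<omega>. \<Sum>y\<in>#add_mset x \<omega>. G y (add_mset x \<omega> - {#y#})) \<in> borel_measurable conf_space"
      by (rule measurable_compose[OF _ m]) measurable
    ultimately show ?thesis by (simp add: nn_integral_B_0)
  qed
  then show ?case
    using m by (subst nn_integral_B_Suc) simp_all
next
  case (Suc n)
  note [measurable] = Suc.prems
  have [measurable]: "(\<lambda>\<omega>. \<Sum>x\<in>#\<omega>. G x (\<omega> - {#x#})) \<in> borel_measurable conf_space"
    by (rule measurable_sum_mset_remove'[where G = "\<lambda>q x \<eta>. G x \<eta>"]) measurable
  have m [measurable]: "(\<lambda>q. \<Sum>x\<in>#snd q. G x (add_mset (fst q) (snd q - {#x#}))) \<in> borel_measurable (borel \<Otimes>\<^sub>M conf_space)"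
    by (rule measurable_sum_mset_remove'[where G = "\<lambda>q x \<eta>. G x (add_mset (fst q) \<eta>)"])
      (measurable, rule measurable_compose[OF _ Suc.prems, of "\<lambda>q. (fst (snd q), add_mset (fst (fst q)) (snd (snd q)))", simplified], measurable)
  have *: "(\<Sum>x\<in>#add_mset y \<omega>. G x (add_mset y \<omega> - {#x#})) = G y \<omega> + (\<Sum>x\<in>#\<omega>. G x (add_mset y (\<omega> - {#x#})))" for y \<omega>
  proof -
    have "G x (add_mset y \<omega> - {#x#}) = G x (add_mset y (\<omega> - {#x#}))" if "x \<in># \<omega>" for x
    proof -
      from that obtain \<eta> where "\<omega> = add_mset x \<eta>" by (metis insert_DiffM)
      then show ?thesis by (simp add: add_mset_commute)
    qed
    then have "(\<Sum>x\<in>#\<omega>. G x (add_mset y \<omega> - {#x#})) = (\<Sum>x\<in>#\<omega>. G x (add_mset y (\<omega> - {#x#})))"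
      by (intro arg_cong[where f = sum_mset] image_mset_cong)
    then show ?thesis by simp
  qed
  have "(\<lambda>q. (snd (fst q), add_mset (fst (fst q)) (snd q))) \<in> (borel \<Otimes>\<^sub>M borel) \<Otimes>\<^sub>M conf_space \<rightarrow>\<^sub>M (borel :: 'a measure) \<Otimes>\<^sub>M (conf_space :: 'a multiset measure)"
    by measurable
  from measurable_compose[OF this Suc.prems]
  have [measurable]: "(\<lambda>q. G (snd (fst q)) (add_mset (fst (fst q)) (snd q))) \<in> borel_measurable ((borel \<Otimes>\<^sub>M borel) \<Otimes>\<^sub>M conf_space)"
    by simp
  have "(\<lambda>q. (fst (fst q), add_mset (snd (fst q)) (snd q))) \<in> (borel \<Otimes>\<^sub>M borel) \<Otimes>\<^sub>M conf_space \<rightarrow>\<^sub>M (borel :: 'a measure) \<Otimes>\<^sub>M (conf_space :: 'a multiset measure)"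
    by measurable
  from measurable_compose[OF this Suc.prems]
  have [measurable]: "(\<lambda>q. G (fst (fst q)) (add_mset (snd (fst q)) (snd q))) \<in> borel_measurable ((borel \<Otimes>\<^sub>M borel) \<Otimes>\<^sub>M conf_space)"
    by simp
  have "(\<integral>\<^sup>+\<omega>. (\<Sum>x\<in>#\<omega>. G x (\<omega> - {#x#})) \<partial>B (Suc (Suc n))) =
     (\<integral>\<^sup>+y. \<integral>\<^sup>+\<omega>. G y \<omega> + (\<Sum>x\<in>#\<omega>. G x (add_mset y (\<omega> - {#x#}))) \<partial>B (Suc n) \<partial>U)"
    by (subst nn_integral_B_Suc) (measurable, simp only: *)
  also have "\<dots> = (\<integral>\<^sup>+y. \<integral>\<^sup>+\<omega>. G y \<omega> \<partial>B (Suc n) \<partial>U) + (\<integral>\<^sup>+y. \<integral>\<^sup>+\<omega>. (\<Sum>x\<in>#\<omega>. G x (add_mset y (\<omega> - {#x#}))) \<partial>B (Suc n) \<partial>U)"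
  proof -
    have "G y \<in> borel_measurable conf_space" for y
      by (rule measurable_compose[OF _ Suc.prems, of "\<lambda>\<omega>. (y, \<omega>)", simplified]) measurable
    moreover have "(\<lambda>\<omega>. \<Sum>x\<in>#\<omega>. G x (add_mset y (\<omega> - {#x#}))) \<in> borel_measurable conf_space" for y
      by (rule measurable_compose[OF _ m, of "\<lambda>\<omega>. (y, \<omega>)", simplified]) measurable
    ultimately have "(\<integral>\<^sup>+\<omega>. G y \<omega> + (\<Sum>x\<in>#\<omega>. G x (add_mset y (\<omega> - {#x#}))) \<partial>B (Suc n)) =
        (\<integral>\<^sup>+\<omega>. G y \<omega> \<partial>B (Suc n)) + (\<integral>\<^sup>+\<omega>. (\<Sum>x\<in>#\<omega>. G x (add_mset y (\<omega> - {#x#}))) \<partial>B (Suc n))" for y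
      by (intro nn_integral_add) simp_all
    then show ?thesis
      by (subst nn_integral_add[symmetric]) (auto simp: case_prod_beta)
  qed
  also have "(\<integral>\<^sup>+y. \<integral>\<^sup>+\<omega>. (\<Sum>x\<in>#\<omega>. G x (add_mset y (\<omega> - {#x#}))) \<partial>B (Suc n) \<partial>U) =
      (\<integral>\<^sup>+y. of_nat (Suc n) * (\<integral>\<^sup>+x. \<integral>\<^sup>+\<omega>. G x (add_mset y \<omega>) \<partial>B n \<partial>U) \<partial>U)"
  proof (intro nn_integral_cong Suc.IH)
    fix y :: 'a
    have "(\<lambda>q. (fst q, add_mset y (snd q))) \<in> (borel :: 'a measure) \<Otimes>\<^sub>M (conf_space :: 'a multiset measure) \<rightarrow>\<^sub>M (borel :: 'a measure) \<Otimes>\<^sub>M conf_space"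
      by measurable
    from measurable_compose[OF this Suc.prems]
    show "(\<lambda>q. G (fst q) (add_mset y (snd q))) \<in> borel_measurable (borel \<Otimes>\<^sub>M conf_space)"
      by simp
  qed
  also have "\<dots> = of_nat (Suc n) * (\<integral>\<^sup>+y. \<integral>\<^sup>+x. \<integral>\<^sup>+\<omega>. G x (add_mset y \<omega>) \<partial>B n \<partial>U \<partial>U)"
    by (rule nn_integral_cmult) measurable
  \<comment> \<open>After exchanging \<open>x\<close> and \<open>y\<close> the added point is
    integrated next to \<open>B n\<close> and merges with it into \<open>B (Suc n)\<close>. The new
    point contributes one term, the old ones \<open>Suc n\<close>, together
    \<open>Suc (Suc n)\<close>.\<close>
  also have "(\<integral>\<^sup>+y. \<integral>\<^sup>+x. \<integral>\<^sup>+\<omega>. G x (add_mset y \<omega>) \<partial>B n \<partial>U \<partial>U) = (\<integral>\<^sup>+x. \<integral>\<^sup>+y. \<integral>\<^sup>+\<omega>. G x (add_mset y \<omega>) \<partial>B n \<partial>U \<partial>U)"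
  proof -
    interpret pair_sigma_finite U U ..
    show ?thesis by (rule Fubini') measurable
  qed
  also have "\<dots> = (\<integral>\<^sup>+x. \<integral>\<^sup>+\<omega>. G x \<omega> \<partial>B (Suc n) \<partial>U)"
    by (intro nn_integral_cong nn_integral_B_Suc[symmetric],
        rule measurable_compose[OF _ Suc.prems, of "\<lambda>\<omega>. (x, \<omega>)" for x, simplified]) measurable
  finally show ?case by (simp add: algebra_simps)
qed

text \<open>The one-point formula twice. For \<open>n < 2\<close> the truncated \<open>n - 1\<close>
  and \<open>n - 2\<close> do no harm: the factor \<open>n * (n - 1)\<close> is 0 and there is no
  pair to sum over.\<close>

lemma nn_integral_B_remove2:
  assumes [measurable]: "(\<lambda>q. G (fst q) (fst (snd q)) (snd (snd q))) \<in> borel_measurable (borel \<Otimes>\<^sub>M (borel \<Otimes>\<^sub>M conf_space))"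
  shows "(\<integral>\<^sup>+\<omega>. (\<Sum>x\<in>#\<omega>. \<Sum>y\<in>#\<omega> - {#x#}. G x y (\<omega> - {#x#} - {#y#})) \<partial>B n) =
    of_nat (n * (n - 1)) * (\<integral>\<^sup>+x. \<integral>\<^sup>+y. \<integral>\<^sup>+\<omega>. G x y \<omega> \<partial>B (n - 2) \<partial>U \<partial>U)"
proof -
  have m1 [measurable]: "(\<lambda>q. \<Sum>y\<in>#snd q. G (fst q) y (snd q - {#y#})) \<in> borel_measurable (borel \<Otimes>\<^sub>M conf_space)"
    by (rule measurable_sum_mset_remove'[where G = "\<lambda>q y \<eta>. G (fst q) y \<eta>"])
      (measurable, rule measurable_compose[OF _ assms, of "\<lambda>q. (fst (fst q), snd q)", simplified], measurable)
  have m: "(\<lambda>\<omega>. \<Sum>x\<in>#\<omega>. \<Sum>y\<in>#\<omega> - {#x#}. G x y (\<omega> - {#x#} - {#y#})) \<in> borel_measurable conf_space"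
    by (rule measurable_sum_mset_remove'[where G = "\<lambda>q x \<eta>. \<Sum>y\<in>#\<eta>. G x y (\<eta> - {#y#})"]) measurable
  show ?thesis
  proof (cases n)
    case 0
    show ?thesis unfolding 0 by (subst nn_integral_B_0) (rule m, simp)
  next
    case (Suc m)
    have 1: "(\<integral>\<^sup>+\<omega>. (\<Sum>x\<in>#\<omega>. \<Sum>y\<in>#\<omega> - {#x#}. G x y (\<omega> - {#x#} - {#y#})) \<partial>B n) =
      of_nat n * (\<integral>\<^sup>+x. \<integral>\<^sup>+\<eta>. (\<Sum>y\<in>#\<eta>. G x y (\<eta> - {#y#})) \<partial>B m \<partial>U)"
      unfolding Suc by (rule nn_integral_B_remove) measurable
    show ?thesis
    proof (cases m)
      case 0
      have "(\<integral>\<^sup>+\<eta>. (\<Sum>y\<in>#\<eta>. G x y (\<eta> - {#y#})) \<partial>B 0) = 0" for x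
      proof -
        have "(\<lambda>\<eta>. \<Sum>y\<in>#\<eta>. G x y (\<eta> - {#y#})) \<in> borel_measurable conf_space"
          by (rule measurable_compose[OF _ m1, of "\<lambda>\<eta>. (x, \<eta>)", simplified]) measurable
        then show ?thesis by (simp add: nn_integral_B_0)
      qed
      then show ?thesis using 1 0 Suc by simp
    next
      case (Suc l)
      have "(\<integral>\<^sup>+\<eta>. (\<Sum>y\<in>#\<eta>. G x y (\<eta> - {#y#})) \<partial>B m) = of_nat m * (\<integral>\<^sup>+y. \<integral>\<^sup>+\<omega>. G x y \<omega> \<partial>B l \<partial>U)" for x
        unfolding Suc
        by (rule nn_integral_B_remove, rule measurable_compose[OF _ assms, of "\<lambda>q. (x, fst q, snd q)", simplified]) measurable
      then have "(\<integral>\<^sup>+x. \<integral>\<^sup>+\<eta>. (\<Sum>y\<in>#\<eta>. G x y (\<eta> - {#y#})) \<partial>B m \<partial>U) = of_nat m * (\<integral>\<^sup>+x. \<integral>\<^sup>+y. \<integral>\<^sup>+\<omega>. G x y \<omega> \<partial>B l \<partial>U \<partial>U)"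
      proof (simp only:, intro nn_integral_cmult)
        have "(\<lambda>q. (fst (fst q), snd (fst q), snd q)) \<in> (borel \<Otimes>\<^sub>M borel) \<Otimes>\<^sub>M conf_space \<rightarrow>\<^sub>M (borel :: 'a measure) \<Otimes>\<^sub>M (borel :: 'a measure) \<Otimes>\<^sub>M (conf_space :: 'a multiset measure)"
          by measurable
        from measurable_compose[OF this assms]
        have [measurable]: "(\<lambda>q. G (fst (fst q)) (snd (fst q)) (snd q)) \<in> borel_measurable ((borel \<Otimes>\<^sub>M borel) \<Otimes>\<^sub>M conf_space)"
          by simp
        show "(\<lambda>x. \<integral>\<^sup>+y. \<integral>\<^sup>+\<omega>. G x y \<omega> \<partial>B l \<partial>U) \<in> borel_measurable U"
          by measurable
      qed
      then show ?thesis using 1 \<open>n = Suc m\<close> Suc by (simp add: mult.assoc del: of_nat_Suc mult_Suc mult_Suc_right)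
    qed
  qed
qed

end

section \<open>Lower bound for the law of the midpoints\<close>

lemma nn_integral_lborel_translate:
  fixes c :: "'a::euclidean_space"
  assumes [measurable]: "f \<in> borel_measurable borel"
  shows "(\<integral>\<^sup>+x. f (c + x) \<partial>lborel) = (\<integral>\<^sup>+x. f x \<partial>lborel)"
  by (subst (2) lborel_distr_plus[symmetric, of c]) (simp add: nn_integral_distr)

lemma emeasure_cball_translate:
  fixes x :: "'a::euclidean_space"
  shows "emeasure lborel (cball x s) = ennreal (measure lborel (cball (0::'a) s))"
proof (cases "s \<ge> 0")
  case True
  then show ?thesis
    using emeasure_cball[OF True, of x] content_cball[OF True, of "0 :: 'a"] by simp
qed simp

lemma cball_borel_measurable [measurable]: "cball x r \<in> sets borel"
  by simp

text \<open>Put \<open>y = x + h\<close>: the midpoint is \<open>x + h / 2\<close>, which for fixed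
  \<open>h\<close> is a translate of \<open>x\<close>. After Fubini the two integrals separate and
  no Jacobian appears; symmetry of the ball turns \<open>x - y\<close> into
  \<open>h\<close>.\<close>

lemma nn_integral_midpoint:
  fixes g :: "'a::euclidean_space \<Rightarrow> ennreal"
  assumes [measurable]: "g \<in> borel_measurable borel"
  shows "(\<integral>\<^sup>+x. \<integral>\<^sup>+y. indicator (cball 0 r) (x - y) * g ((1/2) *\<^sub>R (x + y)) \<partial>lborel \<partial>lborel) =
    ennreal (measure lborel (cball (0::'a) r)) * (\<integral>\<^sup>+z. g z \<partial>lborel)"
proof -
  have "(\<integral>\<^sup>+y. indicator (cball 0 r) (x - y) * g ((1/2) *\<^sub>R (x + y)) \<partial>lborel) =
     (\<integral>\<^sup>+h. indicator (cball 0 r) h * g ((1/2) *\<^sub>R h + x) \<partial>lborel)" for x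
  proof -
    have "(1/2) *\<^sub>R (x + (x + h)) = (1/2) *\<^sub>R h + x" for h
    proof -
      have "(1/2) *\<^sub>R (x + (x + h)) = (1/2) *\<^sub>R h + ((1/2) *\<^sub>R x + (1/2) *\<^sub>R x)"
        by (simp add: scaleR_add_right)
      then show ?thesis by (simp flip: scaleR_add_left)
    qed
    then show ?thesis
      by (subst nn_integral_lborel_translate[symmetric, of _ x]) (auto simp: indicator_def)
  qed
  then have "(\<integral>\<^sup>+x. \<integral>\<^sup>+y. indicator (cball 0 r) (x - y) * g ((1/2) *\<^sub>R (x + y)) \<partial>lborel \<partial>lborel) =
     (\<integral>\<^sup>+x. \<integral>\<^sup>+h. indicator (cball 0 r) h * g ((1/2) *\<^sub>R h + x) \<partial>lborel \<partial>lborel)"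
    by simp
  also have "\<dots> = (\<integral>\<^sup>+h. \<integral>\<^sup>+x. indicator (cball 0 r) h * g ((1/2) *\<^sub>R h + x) \<partial>lborel \<partial>lborel)"
    by (rule lborel_pair.Fubini') measurable
  also have "\<dots> = (\<integral>\<^sup>+h. indicator (cball (0::'a) r) h * (\<integral>\<^sup>+x. g x \<partial>lborel) \<partial>lborel)"
    by (simp add: nn_integral_cmult nn_integral_lborel_translate)
  also have "\<dots> = ennreal (measure lborel (cball (0::'a) r)) * (\<integral>\<^sup>+z. g z \<partial>lborel)"
    by (simp add: nn_integral_multc emeasure_cball_translate)
  finally show ?thesis .
qed

text \<open>For \<open>s \<ge> 0\<close> these are hard-core configurations: the points, counted
  with multiplicity, have pairwise distances above \<open>s\<close>. Expressing this through
  \<open>xi_map\<close> gives measurability at once.\<close>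

definition isolated :: "real \<Rightarrow> 'a::real_normed_vector set \<Rightarrow> 'a multiset set" where
  "isolated s W = {\<omega>. xi_map s \<omega> = {#} \<and> set_mset \<omega> \<subseteq> W}"

lemma isolated_sets [measurable]:
  fixes W :: "'a::{real_normed_vector, second_countable_topology} set"
  assumes [measurable]: "W \<in> sets borel"
  shows "isolated s W \<in> sets conf_space"
proof -
  have "Measurable.pred conf_space (\<lambda>\<omega>. xi_map s \<omega> = {#} \<and> set_mset \<omega> \<subseteq> W)"
    by measurable
  then show ?thesis by (simp add: isolated_def pred_def)
qed

lemma edges_from_empty_iff: "edges_from s x \<omega> = {#} \<longleftrightarrow> (\<forall>y\<in>#\<omega>. y \<notin> cball x s)"
  by (auto simp: edges_from_def dist_norm)

text \<open>Placing \<open>x\<close> is paid for by the region: the remaining points only see the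
  smaller set \<open>W - cball x s\<close>. This is why the inductions below run over all
  \<open>W\<close>.\<close>

lemma add_mset_isolated_iff: "add_mset x \<omega> \<in> isolated s W \<longleftrightarrow> x \<in> W \<and> \<omega> \<in> isolated s (W - cball x s)"
  by (auto simp: isolated_def xi_map_add_mset edges_from_empty_iff)

lemma empty_isolated [simp]: "{#} \<in> isolated s W"
  by (simp add: isolated_def)

lemma prod_lessThan_shift2:
  fixes f :: "nat \<Rightarrow> 'a::comm_monoid_mult"
  shows "(\<Prod>j<Suc (Suc m). f j) = f 0 * f 1 * (\<Prod>j<m. f (Suc (Suc j)))"
  by (simp only: prod.lessThan_Suc_shift) (simp add: mult.assoc)

context unit_volume
begin

text \<open>Sequential placement. The first point lands in \<open>W\<close> with probability equal
  to its volume; the others then need the hard-core event in \<open>W\<close> minus one ball, which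
  costs each factor at most one ball volume. Truncation at 0 covers exhausted regions.\<close>

lemma emeasure_isolated_ge:
  assumes "W \<in> sets borel" "W \<subseteq> K"
  shows "ennreal (\<Prod>i<n. max 0 (measure lborel W - real i * measure lborel (cball (0::'a) s))) \<le> emeasure (B n) (isolated s W)"
  using assms
proof (induction n arbitrary: W)
  case 0
  note [measurable] = 0(1)
  have "emeasure (B 0) (isolated s W) = (\<integral>\<^sup>+\<omega>. indicator (isolated s W) \<omega> \<partial>B 0)"
    by simp
  also have "\<dots> = 1"
    by (subst nn_integral_B_0) simp_all
  finally show ?case by simp
next
  case (Suc n)
  note [measurable] = Suc.prems(1)
  let ?b = "measure lborel (cball (0::'a) s)"
  let ?p = "\<Prod>i<n. max 0 (measure lborel W - real (Suc i) * ?b)"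
  have fin: "emeasure lborel W < \<infinity>"
    using emeasure_mono[OF Suc.prems(2), of lborel] emeasure_K by (auto simp: less_top[symmetric] top_unique)
  have step: "ennreal ?p \<le> (\<integral>\<^sup>+\<omega>. indicator (isolated s W) (add_mset x \<omega>) \<partial>B n)" if "x \<in> W" for x
  proof -
    have "measure lborel W \<le> measure lborel ((W - cball x s) \<union> cball x s)"
      using fin emeasure_lborel_cball_finite[of x s]
      by (intro measure_mono_fmeasurable) (auto simp: fmeasurable_def intro: order.strict_trans1[OF emeasure_subadditive])
    also have "\<dots> \<le> measure lborel (W - cball x s) + measure lborel (cball x s)"
      by (rule measure_Un_le) auto
    also have "measure lborel (cball x s) = ?b"
      using emeasure_cball_translate[of x s] by (simp add: measure_def)
    finally have "measure lborel W - ?b \<le> measure lborel (W - cball x s)" by simp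
    then have "?p \<le> (\<Prod>i<n. max 0 (measure lborel (W - cball x s) - real i * ?b))"
      by (intro prod_mono) (auto simp: algebra_simps intro!: max.mono)
    also have "ennreal \<dots> \<le> emeasure (B n) (isolated s (W - cball x s))"
      using Suc.prems by (intro Suc.IH) auto
    also have "\<dots> = (\<integral>\<^sup>+\<omega>. indicator (isolated s (W - cball x s)) \<omega> \<partial>B n)"
      by simp
    also have "\<dots> = (\<integral>\<^sup>+\<omega>. indicator (isolated s W) (add_mset x \<omega>) \<partial>B n)"
      using that by (intro nn_integral_cong) (simp add: indicator_def add_mset_isolated_iff)
    finally show ?thesis by (simp add: ennreal_leI)
  qed
  have "ennreal (\<Prod>i<Suc n. max 0 (measure lborel W - real i * ?b)) = ennreal (measure lborel W) * ennreal ?p"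
    by (simp only: prod.lessThan_Suc_shift) (simp add: ennreal_mult prod_nonneg)
  also have "\<dots> = (\<integral>\<^sup>+x. indicator W x * ennreal ?p \<partial>U)"
  proof -
    have "emeasure U W = ennreal (measure lborel W)"
      using fin Suc.prems by (simp only: emeasure_U) (simp add: Int_absorb2 emeasure_eq_ennreal_measure)
    then show ?thesis by (simp add: nn_integral_multc del: emeasure_uniform_measure)
  qed
  also have "\<dots> \<le> (\<integral>\<^sup>+x. \<integral>\<^sup>+\<omega>. indicator (isolated s W) (add_mset x \<omega>) \<partial>B n \<partial>U)"
  proof (rule nn_integral_mono)
    fix x
    show "indicator W x * ennreal ?p \<le> (\<integral>\<^sup>+\<omega>. indicator (isolated s W) (add_mset x \<omega>) \<partial>B n)"
      using step[of x] by (cases "x \<in> W") auto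
  qed
  also have "\<dots> = (\<integral>\<^sup>+\<omega>. indicator (isolated s W) \<omega> \<partial>B (Suc n))"
    by (subst nn_integral_B_Suc) simp_all
  finally show ?case by simp
qed

text \<open>With \<open>w\<close> the volume of the region available to \<open>n\<close> points: number of matchings with \<open>k\<close>
  edges, times \<open>b ^ k\<close> for the edge vectors, times the probability bound for the other points to
  create no further edge. The truncated difference \<open>n - j\<close> makes the weight vanish for \<open>n < 2 k\<close>.\<close>
definition matching_weight :: "real \<Rightarrow> nat \<Rightarrow> nat \<Rightarrow> real \<Rightarrow> real" where
  "matching_weight b n k w = (b / 2) ^ k / fact k * (\<Prod>j<2 * k. real (n - j)) * (\<Prod>i<n - 2 * k. max 0 (w - real (2 * k + i) * b))"

lemma matching_weight_nonneg: "0 \<le> b \<Longrightarrow> 0 \<le> matching_weight b n k w"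
  by (auto simp: matching_weight_def intro!: mult_nonneg_nonneg prod_nonneg divide_nonneg_nonneg)

lemma matching_weight_mono: "0 \<le> b \<Longrightarrow> w \<le> w' \<Longrightarrow> matching_weight b n k w \<le> matching_weight b n k w'"
  unfolding matching_weight_def
  by (intro mult_left_mono prod_mono) (auto intro!: mult_nonneg_nonneg prod_nonneg divide_nonneg_nonneg)

text \<open>Splitting off one oriented edge: \<open>2 * (k + 1)\<close> of them to choose from on
  the left, \<open>n * (n - 1)\<close> ordered pairs on the right. The pair leaves
  \<open>n - 2\<close> points and takes two balls from the available volume.\<close>

lemma matching_weight_Suc:
  "2 * real (Suc k) * matching_weight b n (Suc k) w = real (n * (n - 1)) * b * matching_weight b (n - 2) k (w - 2 * b)"
proof -
  have 1: "(\<Prod>j<2 * Suc k. real (n - j)) = real (n * (n - 1)) * (\<Prod>j<2 * k. real (n - 2 - j))"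
    using prod_lessThan_shift2[of "\<lambda>j. real (n - j)" "2 * k"] by simp
  have 2: "(\<Prod>i<n - 2 * Suc k. max 0 (w - real (2 * Suc k + i) * b)) =
     (\<Prod>i<n - 2 - 2 * k. max 0 (w - 2 * b - real (2 * k + i) * b))"
    by (rule prod.cong) (auto simp: algebra_simps)
  have 3: "2 * real (Suc k) * ((b / 2) ^ Suc k / fact (Suc k)) = b * ((b / 2) ^ k / fact k)"
  proof -
    have "2 * u * ((b / 2 * p) / (u * f)) = b * (p / f)" if "u \<noteq> 0" for u p f :: real
      using that by simp
    from this[of "real (Suc k)"] show ?thesis
      unfolding power_Suc fact_Suc of_nat_mult by simp
  qed
  show ?thesis
    unfolding matching_weight_def 1 2 using 3 by (simp only: mult.assoc[symmetric]) (simp only: ac_simps)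
qed

text \<open>The factor \<open>2 * size (xi_map r \<omega>)\<close> counts oriented edges, so it
  marks one of them, and the two-point formula moves the marked endpoints outside.\<close>

lemma two_nn_integral_size_xi_map:
  assumes [measurable]: "\<Phi> \<in> borel_measurable conf_space"
  shows "(\<integral>\<^sup>+\<omega>. of_nat (2 * size (xi_map r \<omega>)) * \<Phi> \<omega> \<partial>B n) =
    of_nat (n * (n - 1)) * (\<integral>\<^sup>+x. \<integral>\<^sup>+y. \<integral>\<^sup>+\<omega>. indicator (cball 0 r) (x - y) * \<Phi> (add_mset x (add_mset y \<omega>)) \<partial>B (n - 2) \<partial>U \<partial>U)"
proof -
  have "of_nat (2 * size (xi_map r \<omega>)) * \<Phi> \<omega> =
     (\<Sum>x\<in>#\<omega>. \<Sum>y\<in>#\<omega> - {#x#}. indicator (cball 0 r) (x - y) * \<Phi> (add_mset x (add_mset y (\<omega> - {#x#} - {#y#}))))" for \<omega>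
  proof -
    have "of_nat (2 * size (xi_map r \<omega>)) * \<Phi> \<omega> = (\<Sum>x\<in>#\<omega>. \<Sum>y\<in>#\<omega> - {#x#}. indicator (cball 0 r) (x - y) * \<Phi> \<omega>)"
      using double_mcount_xi_map[of r \<omega> UNIV]
      by (simp add: sum_mset_distrib_right indicator_def)
    also have "\<dots> = (\<Sum>x\<in>#\<omega>. \<Sum>y\<in>#\<omega> - {#x#}. indicator (cball 0 r) (x - y) * \<Phi> (add_mset x (add_mset y (\<omega> - {#x#} - {#y#}))))"
    proof (intro arg_cong[where f = sum_mset] image_mset_cong)
      fix x y assume "x \<in># \<omega>" "y \<in># \<omega> - {#x#}"
      then have "add_mset x (add_mset y (\<omega> - {#x#} - {#y#})) = \<omega>"
        by (metis insert_DiffM)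
      then show "indicator (cball 0 r) (x - y) * \<Phi> \<omega> = indicator (cball 0 r) (x - y) * \<Phi> (add_mset x (add_mset y (\<omega> - {#x#} - {#y#})))"
        by simp
    qed
    finally show ?thesis .
  qed
  moreover have "(\<integral>\<^sup>+\<omega>. (\<Sum>x\<in>#\<omega>. \<Sum>y\<in>#\<omega> - {#x#}. indicator (cball 0 r) (x - y) * \<Phi> (add_mset x (add_mset y (\<omega> - {#x#} - {#y#})))) \<partial>B n) =
    of_nat (n * (n - 1)) * (\<integral>\<^sup>+x. \<integral>\<^sup>+y. \<integral>\<^sup>+\<omega>. indicator (cball 0 r) (x - y) * \<Phi> (add_mset x (add_mset y \<omega>)) \<partial>B (n - 2) \<partial>U \<partial>U)"
  proof (rule nn_integral_B_remove2)
    have [measurable]: "(\<lambda>q. fst q - fst (snd q)) \<in> borel \<Otimes>\<^sub>M borel \<Otimes>\<^sub>M (conf_space :: 'a multiset measure) \<rightarrow>\<^sub>M (borel :: 'a measure)"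
      by measurable
    have [measurable]: "(\<lambda>q. add_mset (fst q) (add_mset (fst (snd q)) (snd (snd q)))) \<in> borel \<Otimes>\<^sub>M borel \<Otimes>\<^sub>M (conf_space :: 'a multiset measure) \<rightarrow>\<^sub>M conf_space"
      by measurable
    show "(\<lambda>q. indicator (cball 0 r) (fst q - fst (snd q)) * \<Phi> (add_mset (fst q) (add_mset (fst (snd q)) (snd (snd q))))) \<in> borel_measurable (borel \<Otimes>\<^sub>M borel \<Otimes>\<^sub>M conf_space)"
      by measurable
  qed
  ultimately show ?thesis by simp
qed

text \<open>Given \<open>x\<close>, the second endpoint has to fall into a ball around
  \<open>x\<close>. The part of the ball outside \<open>K\<close> only lowers the probability, so
  the upper bound for the mean has no boundary term.\<close>

lemma nn_integral_size_xi_map_le: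
  "(\<integral>\<^sup>+\<omega>. of_nat (size (xi_map r \<omega>)) \<partial>B n) \<le> of_nat (n * (n - 1)) * ennreal (measure lborel (cball (0::'a) r) / 2)"
proof -
  let ?b = "measure lborel (cball (0::'a) r)"
  have "(\<integral>\<^sup>+y. \<integral>\<^sup>+\<omega>. indicator (cball 0 r) (x - y) * 1 \<partial>B (n - 2) \<partial>U) \<le> ennreal ?b" for x
  proof -
    have "(\<integral>\<^sup>+y. \<integral>\<^sup>+\<omega>. indicator (cball 0 r) (x - y) * 1 \<partial>B (n - 2) \<partial>U) = (\<integral>\<^sup>+y. indicator (cball x r) y \<partial>U)"
      by (intro nn_integral_cong) (simp add: B.emeasure_space_1[simplified] indicator_def dist_norm norm_minus_commute)
    also have "\<dots> = emeasure U (cball x r)"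
      by simp
    also have "\<dots> \<le> ennreal ?b"
      unfolding emeasure_cball_translate[of x, symmetric] by (subst emeasure_U) (auto intro!: emeasure_mono)
    finally show ?thesis .
  qed
  then have "(\<integral>\<^sup>+x. \<integral>\<^sup>+y. \<integral>\<^sup>+\<omega>. indicator (cball 0 r) (x - y) * 1 \<partial>B (n - 2) \<partial>U \<partial>U) \<le> (\<integral>\<^sup>+x. ennreal ?b \<partial>U)"
    by (intro nn_integral_mono)
  also have "\<dots> = ennreal ?b"
    by (simp add: U.emeasure_space_1[simplified])
  finally have "(\<integral>\<^sup>+\<omega>. of_nat (2 * size (xi_map r \<omega>)) * 1 \<partial>B n) \<le> of_nat (n * (n - 1)) * ennreal ?b"
    by (subst two_nn_integral_size_xi_map) (auto intro!: mult_left_mono)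
  moreover have "(\<integral>\<^sup>+\<omega>. of_nat (2 * size (xi_map r \<omega>)) * 1 \<partial>B n) = 2 * (\<integral>\<^sup>+\<omega>. of_nat (size (xi_map r \<omega>)) \<partial>B n)"
    by (simp add: nn_integral_cmult)
  moreover have "ennreal ?b = 2 * ennreal (?b / 2)"
    by (simp add: ennreal_mult'[symmetric] flip: ennreal_numeral)
  ultimately have "2 * (\<integral>\<^sup>+\<omega>. of_nat (size (xi_map r \<omega>)) \<partial>B n) \<le> 2 * (of_nat (n * (n - 1)) * ennreal (?b / 2))"
    by (simp add: ac_simps)
  then show ?thesis
    by (subst (asm) ennreal_mult_le_mult_iff) auto
qed

text \<open>Induction on \<open>k\<close>: the Mecke equation splits off one edge, whose endpoints are then required
  to be far from all other points, i.e. two balls are removed from \<open>W\<close>. Shrinking \<open>V\<close> by a ball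
  of radius \<open>2 r\<close> keeps the remaining edges inside the smaller region.\<close>
lemma nn_integral_matching_le:
  assumes F: "F \<in> borel_measurable conf_space" and r: "0 \<le> r"
    and W: "W \<in> sets borel" "W \<subseteq> K" and V: "V \<in> sets borel" "\<And>z. z \<in> V \<Longrightarrow> cball z (r / 2) \<subseteq> W"
  shows "ennreal (matching_weight (measure lborel (cball (0::'a) r)) n k (measure lborel W)) *
      (\<integral>\<^sup>+\<omega>. indicator (isolated (2 * r) V) \<omega> * F \<omega> \<partial>B k)
    \<le> (\<integral>\<^sup>+\<omega>. indicator {\<omega>. size (xi_map r \<omega>) = k \<and> set_mset \<omega> \<subseteq> W} \<omega> * F (xi_map r \<omega>) \<partial>B n)"
  using F W V
proof (induction k arbitrary: n W V F)
  case 0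
  note [measurable] = 0
  have "{\<omega>. size (xi_map r \<omega>) = 0 \<and> set_mset \<omega> \<subseteq> W} = isolated r W"
    by (simp add: isolated_def)
  moreover have "indicator (isolated r W) \<omega> * F (xi_map r \<omega>) = F {#} * indicator (isolated r W) \<omega>" for \<omega>
    by (auto simp: indicator_def isolated_def)
  moreover have "(\<integral>\<^sup>+\<omega>. indicator (isolated (2 * r) V) \<omega> * F \<omega> \<partial>B 0) = F {#}"
    by (subst nn_integral_B_0) simp_all
  moreover have "ennreal (matching_weight (measure lborel (cball (0::'a) r)) n 0 (measure lborel W)) \<le> emeasure (B n) (isolated r W)"
    using emeasure_isolated_ge[OF 0(2,3), where n = n and s = r] by (simp add: matching_weight_def)
  ultimately show ?case
    by (simp add: nn_integral_cmult) (metis mult.commute mult_left_mono zero_le)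
next
  case (Suc k)
  note [measurable] = Suc.prems(1,2,4)
  let ?b = "measure lborel (cball (0::'a) r)"
  define \<Phi> where "\<Phi> \<omega> = indicator {\<omega>. size (xi_map r \<omega>) = Suc k \<and> set_mset \<omega> \<subseteq> W} \<omega> * F (xi_map r \<omega>)" for \<omega>
  have [measurable]: "\<Phi> \<in> borel_measurable conf_space"
  proof -
    have "Measurable.pred conf_space (\<lambda>\<omega>. size (xi_map r \<omega>) = Suc k \<and> set_mset \<omega> \<subseteq> W)"
      by measurable
    then have [measurable]: "{\<omega>. size (xi_map r \<omega>) = Suc k \<and> set_mset \<omega> \<subseteq> W} \<in> sets conf_space"
      by (simp add: pred_def)
    show ?thesis unfolding \<Phi>_def by measurable
  qed
  \<comment> \<open>The weight of \<open>k + 1\<close> midpoints, one of them at \<open>z\<close>.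
    Integrating it over \<open>z\<close> with respect to \<open>U\<close> gives the integral on the
    left side for \<open>Suc k\<close>.\<close>
  define \<Psi> where "\<Psi> z = (\<integral>\<^sup>+\<omega>. indicator (isolated (2 * r) V) (add_mset z \<omega>) * F (add_mset z \<omega>) \<partial>B k)" for z
  have [measurable]: "\<Psi> \<in> borel_measurable borel"
    unfolding \<Psi>_def by measurable
  let ?c = "ennreal (matching_weight ?b (n - 2) k (measure lborel W - 2 * ?b))"
  let ?m = "\<lambda>x y. (1/2) *\<^sub>R (x + y)"
  have \<Psi>_out: "\<Psi> z = 0" if "z \<notin> V" for z
    using that by (simp add: \<Psi>_def indicator_def add_mset_isolated_iff)
  have mid: "x \<in> W" "y \<in> W" if "norm (x - y) \<le> r" "?m x y \<in> V" for x y
  proof -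
    have "?m x y - x = (1/2) *\<^sub>R (y - x)" "?m x y - y = (1/2) *\<^sub>R (x - y)"
      by (simp_all add: algebra_simps flip: scaleR_add_left)
    with that have "x \<in> cball (?m x y) (r / 2)" "y \<in> cball (?m x y) (r / 2)"
      by (simp_all add: dist_norm norm_minus_commute)
    with Suc.prems(5)[OF that(2)] show "x \<in> W" "y \<in> W" by auto
  qed
  have fin: "emeasure lborel W < \<infinity>"
    using emeasure_mono[OF Suc.prems(3), of lborel] emeasure_K by (auto simp: less_top[symmetric] top_unique)
  have inner: "?c * \<Psi> (?m x y) \<le> (\<integral>\<^sup>+\<omega>. \<Phi> (add_mset x (add_mset y \<omega>)) \<partial>B (n - 2))"
    if xy: "norm (x - y) \<le> r" for x y
  proof (cases "?m x y \<in> V")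
    case False
    then show ?thesis by (simp add: \<Psi>_out)
  next
    case True
    define z where "z = ?m x y"
    define W' where "W' = W - (cball x r \<union> cball y r)"
    define V' where "V' = V - cball z (2 * r)"
    have [measurable]: "W' \<in> sets borel" "V' \<in> sets borel"
      by (simp_all add: W'_def V'_def)
    have zx: "dist z x \<le> r / 2" "dist z y \<le> r / 2"
    proof -
      have "z - x = (1/2) *\<^sub>R (y - x)" "z - y = (1/2) *\<^sub>R (x - y)"
        by (simp_all add: z_def algebra_simps flip: scaleR_add_left)
      with xy show "dist z x \<le> r / 2" "dist z y \<le> r / 2"
        by (simp_all add: dist_norm norm_minus_commute)
    qed
    \<comment> \<open>The reason for the separation \<open>2 r\<close>: a point within
      \<open>r / 2\<close> of another midpoint is farther than
      \<open>2 r - r / 2 - r / 2 = r\<close> from both endpoints, so \<open>V'\<close> fits into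
      \<open>W'\<close> as the induction hypothesis demands.\<close>
    have sub: "cball z' (r / 2) \<subseteq> W'" if "z' \<in> V'" for z'
    proof
      fix u assume u: "u \<in> cball z' (r / 2)"
      have "2 * r < dist z z'" using that by (simp add: V'_def)
      also have "dist z z' \<le> dist z x + dist x u + dist u z'"
        by (metis add_le_cancel_right dist_triangle dist_triangle_le order_trans)
      finally have 1: "r < dist x u" using u zx by (simp add: dist_commute)
      have "2 * r < dist z z'" using that by (simp add: V'_def)
      also have "dist z z' \<le> dist z y + dist y u + dist u z'"
        by (metis add_le_cancel_right dist_triangle dist_triangle_le order_trans)
      finally have 2: "r < dist y u" using u zx by (simp add: dist_commute)
      have "u \<in> W" using Suc.prems(5)[of z'] u that by (auto simp: V'_def)
      with 1 2 show "u \<in> W'" by (simp add: W'_def)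
    qed
    have "measure lborel W \<le> measure lborel (W' \<union> (cball x r \<union> cball y r))"
      using fin emeasure_lborel_cball_finite[of x r] emeasure_lborel_cball_finite[of y r]
      by (intro measure_mono_fmeasurable)
        (auto simp: fmeasurable_def W'_def intro!: order.strict_trans1[OF emeasure_subadditive])
    also have "\<dots> \<le> measure lborel W' + (measure lborel (cball x r) + measure lborel (cball y r))"
      by (intro order_trans[OF measure_Un_le] add_left_mono measure_Un_le) auto
    finally have "measure lborel W \<le> measure lborel W' + (measure lborel (cball x r) + measure lborel (cball y r))" .
    moreover have "measure lborel (cball x r) = ?b" "measure lborel (cball y r) = ?b"
      using emeasure_cball_translate[of x r] emeasure_cball_translate[of y r] by (simp_all add: measure_def)
    ultimately have vol: "measure lborel W - 2 * ?b \<le> measure lborel W'" by simp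
    have "?c * \<Psi> z = ?c * (\<integral>\<^sup>+\<omega>. indicator (isolated (2 * r) V') \<omega> * F (add_mset z \<omega>) \<partial>B k)"
      using True by (simp add: \<Psi>_def indicator_def add_mset_isolated_iff V'_def z_def)
    also have "\<dots> \<le> ennreal (matching_weight ?b (n - 2) k (measure lborel W')) * (\<integral>\<^sup>+\<omega>. indicator (isolated (2 * r) V') \<omega> * F (add_mset z \<omega>) \<partial>B k)"
      by (intro mult_right_mono ennreal_leI matching_weight_mono vol) simp_all
    also have "\<dots> \<le> (\<integral>\<^sup>+\<omega>. indicator {\<omega>. size (xi_map r \<omega>) = k \<and> set_mset \<omega> \<subseteq> W'} \<omega> * F (add_mset z (xi_map r \<omega>)) \<partial>B (n - 2))"
      by (rule Suc.IH) (use Suc.prems(3) sub in \<open>auto simp: W'_def\<close>)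
    also have "\<dots> \<le> (\<integral>\<^sup>+\<omega>. \<Phi> (add_mset x (add_mset y \<omega>)) \<partial>B (n - 2))"
    proof (intro nn_integral_mono)
      fix \<omega>
      show "indicator {\<omega>. size (xi_map r \<omega>) = k \<and> set_mset \<omega> \<subseteq> W'} \<omega> * F (add_mset z (xi_map r \<omega>)) \<le> \<Phi> (add_mset x (add_mset y \<omega>))"
      proof (cases "size (xi_map r \<omega>) = k \<and> set_mset \<omega> \<subseteq> W'")
        case t: True
        \<comment> \<open>All other points avoid both balls, so the only new edge joins
          \<open>x\<close> and \<open>y\<close>, and the midpoints are \<open>z\<close> together
          with those of \<open>\<omega>\<close>.\<close>
        then have "edges_from r x \<omega> = {#}" "edges_from r y \<omega> = {#}"
          by (auto simp: edges_from_empty_iff W'_def)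
        then have "xi_map r (add_mset x (add_mset y \<omega>)) = add_mset z (xi_map r \<omega>)"
          using xy by (simp add: xi_map_add_mset) (simp add: edges_from_def z_def)
        then show ?thesis
          using t mid[OF xy True] by (auto simp: \<Phi>_def W'_def indicator_def)
      qed (auto simp: indicator_def)
    qed
    finally show ?thesis by (simp add: z_def)
  qed
  have "of_nat (2 * Suc k) * (\<integral>\<^sup>+\<omega>. \<Phi> \<omega> \<partial>B n) = (\<integral>\<^sup>+\<omega>. of_nat (2 * Suc k) * \<Phi> \<omega> \<partial>B n)"
    by (rule nn_integral_cmult[symmetric]) measurable
  \<comment> \<open>On the support of \<open>\<Phi>\<close> the number of edges is
    \<open>Suc k\<close>, so the constant can be traded for the edge count that the marking formula
    requires.\<close>
  also have "\<dots> = (\<integral>\<^sup>+\<omega>. of_nat (2 * size (xi_map r \<omega>)) * \<Phi> \<omega> \<partial>B n)"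
    by (intro nn_integral_cong) (auto simp: \<Phi>_def indicator_def simp del: of_nat_mult of_nat_Suc mult_Suc_right)
  also have "\<dots> = of_nat (n * (n - 1)) * (\<integral>\<^sup>+x. \<integral>\<^sup>+y. \<integral>\<^sup>+\<omega>. indicator (cball 0 r) (x - y) * \<Phi> (add_mset x (add_mset y \<omega>)) \<partial>B (n - 2) \<partial>U \<partial>U)"
    by (rule two_nn_integral_size_xi_map) measurable
  finally have lhs: "of_nat (2 * Suc k) * (\<integral>\<^sup>+\<omega>. \<Phi> \<omega> \<partial>B n) = \<dots>" .
  \<comment> \<open>Passing from \<open>U\<close> to Lebesgue measure only enlarges the integral,
    and the midpoint substitution needs the whole space. Afterwards \<open>U\<close> returns with
    equality: \<open>\<Psi>\<close> vanishes outside \<open>V\<close>, and an edge of length at most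
    \<open>r\<close> with midpoint in \<open>V\<close> has both endpoints in
    \<open>K\<close>.\<close>
  have "?c * (ennreal ?b * (\<integral>\<^sup>+z. \<Psi> z \<partial>U)) \<le> ?c * (ennreal ?b * (\<integral>\<^sup>+z. \<Psi> z \<partial>lborel))"
    by (intro mult_left_mono) (auto simp: nn_integral_U indicator_def intro!: nn_integral_mono)
  also have "\<dots> = ?c * (\<integral>\<^sup>+x. \<integral>\<^sup>+y. indicator (cball 0 r) (x - y) * \<Psi> (?m x y) \<partial>lborel \<partial>lborel)"
    by (simp only: nn_integral_midpoint[OF \<open>\<Psi> \<in> _\<close>])
  also have "\<dots> = (\<integral>\<^sup>+x. \<integral>\<^sup>+y. ?c * (indicator (cball 0 r) (x - y) * \<Psi> (?m x y)) \<partial>lborel \<partial>lborel)"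
    by (simp add: nn_integral_cmult)
  also have "\<dots> = (\<integral>\<^sup>+x. \<integral>\<^sup>+y. ?c * (indicator (cball 0 r) (x - y) * \<Psi> (?m x y)) \<partial>U \<partial>U)"
  proof -
    define h where "h x y = ?c * (indicator (cball 0 r) (x - y) * \<Psi> (?m x y))" for x y
    have [measurable]: "(\<lambda>(x, y). h x y) \<in> borel_measurable (borel \<Otimes>\<^sub>M borel)"
      unfolding h_def by measurable
    have h: "h x y * indicator K y * indicator K x = h x y" for x y
    proof (cases "norm (x - y) \<le> r \<and> ?m x y \<in> V")
      case True
      then have "x \<in> K" "y \<in> K" using mid[of x y] Suc.prems(3) by auto
      then show ?thesis by simp
    qed (auto simp: h_def indicator_def \<Psi>_out)
    have "(\<integral>\<^sup>+x. \<integral>\<^sup>+y. h x y \<partial>U \<partial>U) = (\<integral>\<^sup>+x. (\<integral>\<^sup>+y. h x y * indicator K y \<partial>lborel) * indicator K x \<partial>lborel)"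
      by (simp add: nn_integral_U)
    also have "\<dots> = (\<integral>\<^sup>+x. \<integral>\<^sup>+y. h x y * indicator K y * indicator K x \<partial>lborel \<partial>lborel)"
      by (intro nn_integral_cong nn_integral_multc[symmetric]) measurable
    finally show ?thesis by (simp only: h) (simp only: h_def)
  qed
  also have "\<dots> \<le> (\<integral>\<^sup>+x. \<integral>\<^sup>+y. \<integral>\<^sup>+\<omega>. indicator (cball 0 r) (x - y) * \<Phi> (add_mset x (add_mset y \<omega>)) \<partial>B (n - 2) \<partial>U \<partial>U)"
    by (intro nn_integral_mono) (use inner in \<open>auto simp: indicator_def\<close>)
  finally have "of_nat (n * (n - 1)) * (?c * (ennreal ?b * (\<integral>\<^sup>+z. \<Psi> z \<partial>U))) \<le> of_nat (2 * Suc k) * (\<integral>\<^sup>+\<omega>. \<Phi> \<omega> \<partial>B n)"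
    unfolding lhs by (rule mult_left_mono) simp
  moreover have "(\<integral>\<^sup>+z. \<Psi> z \<partial>U) = (\<integral>\<^sup>+\<omega>. indicator (isolated (2 * r) V) \<omega> * F \<omega> \<partial>B (Suc k))"
    unfolding \<Psi>_def by (subst nn_integral_B_Suc) simp_all
  moreover have "of_nat (n * (n - 1)) * (?c * ennreal ?b) = of_nat (2 * Suc k) * ennreal (matching_weight ?b n (Suc k) (measure lborel W))"
  proof -
    have "of_nat (2 * Suc k) * ennreal (matching_weight ?b n (Suc k) (measure lborel W)) =
        ennreal (real (2 * Suc k) * matching_weight ?b n (Suc k) (measure lborel W))"
      by (simp only: ennreal_of_nat_eq_real_of_nat) (simp add: ennreal_mult matching_weight_nonneg)
    also have "real (2 * Suc k) * matching_weight ?b n (Suc k) (measure lborel W) =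
        real (n * (n - 1)) * (matching_weight ?b (n - 2) k (measure lborel W - 2 * ?b) * ?b)"
      using matching_weight_Suc[of k ?b n "measure lborel W"] by (simp add: ac_simps)
    also have "ennreal \<dots> = of_nat (n * (n - 1)) * (?c * ennreal ?b)"
      by (simp only: ennreal_of_nat_eq_real_of_nat) (simp add: ennreal_mult matching_weight_nonneg)
    finally show ?thesis by simp
  qed
  ultimately have "of_nat (2 * Suc k) * (ennreal (matching_weight ?b n (Suc k) (measure lborel W)) * (\<integral>\<^sup>+\<omega>. indicator (isolated (2 * r) V) \<omega> * F \<omega> \<partial>B (Suc k)))
     \<le> of_nat (2 * Suc k) * (\<integral>\<^sup>+\<omega>. \<Phi> \<omega> \<partial>B n)"
    by (simp only: mult.assoc[symmetric])
  then show ?case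
    unfolding \<Phi>_def
    by (subst (asm) ennreal_mult_le_mult_iff) (auto simp: ennreal_of_nat_eq_real_of_nat simp del: of_nat_Suc of_nat_mult)
qed

end

section \<open>Coupling through a common part\<close>

definition sum_measure :: "'a measure \<Rightarrow> 'a measure \<Rightarrow> 'a measure" where
  "sum_measure M N = measure_of (space M) (sets M) (\<lambda>A. emeasure M A + emeasure N A)"

lemma sets_sum_measure [simp, measurable_cong]: "sets (sum_measure M N) = sets M"
  by (simp add: sum_measure_def)

lemma space_sum_measure [simp]: "space (sum_measure M N) = space M"
  by (simp add: sum_measure_def)

lemma emeasure_sum_measure:
  assumes sets: "sets N = sets M" and A: "A \<in> sets M"
  shows "emeasure (sum_measure M N) A = emeasure M A + emeasure N A"
  unfolding sum_measure_def
proof (rule emeasure_measure_of_sigma[OF sets.sigma_algebra_axioms _ _ A])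
  show "positive (sets M) (\<lambda>A. emeasure M A + emeasure N A)"
    by (simp add: positive_def)
  show "countably_additive (sets M) (\<lambda>A. emeasure M A + emeasure N A)"
    using sets by (intro countably_additiveI) (simp add: suminf_add[symmetric] suminf_emeasure)
qed

text \<open>Valid for every \<open>f\<close>, measurable or not: the integral is a supremum over
  simple functions below \<open>f\<close>, and each of these splits exactly.\<close>

lemma nn_integral_sum_measure_le:
  assumes sets: "sets N = sets M"
  shows "(\<integral>\<^sup>+x. f x \<partial>sum_measure M N) \<le> (\<integral>\<^sup>+x. f x \<partial>M) + (\<integral>\<^sup>+x. f x \<partial>N)"
  unfolding nn_integral_def[of "sum_measure M N"]
proof (rule SUP_least)
  fix g assume "g \<in> {g. simple_function (sum_measure M N) g \<and> g \<le> f}"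
  then have g: "simple_function (sum_measure M N) g" "g \<le> f" by auto
  have sp: "space N = space M" using sets by (rule sets_eq_imp_space_eq)
  have gM: "simple_function M g" and gN: "simple_function N g"
    using g(1) sets sp by (simp_all add: simple_function_def)
  have "integral\<^sup>S (sum_measure M N) g = integral\<^sup>S M g + integral\<^sup>S N g"
    using gM unfolding simple_integral_def
    by (simp add: sp emeasure_sum_measure[OF sets] simple_functionD distrib_left sum.distrib)
  also have "integral\<^sup>S M g = integral\<^sup>N M g"
    using gM by (rule nn_integral_eq_simple_integral[symmetric])
  also have "integral\<^sup>S N g = integral\<^sup>N N g"
    using gN by (rule nn_integral_eq_simple_integral[symmetric])
  also have "integral\<^sup>N M g + integral\<^sup>N N g \<le> integral\<^sup>N M f + integral\<^sup>N N f"
    using g(2) by (intro add_mono nn_integral_mono) (auto simp: le_fun_def)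
  finally show "integral\<^sup>S (sum_measure M N) g \<le> integral\<^sup>N M f + integral\<^sup>N N f" .
qed

text \<open>An inequality for arbitrary integrands, because \<^term>\<open>dTV\<close> is a supremum over uncountably
  many sets and its measurability is not clear.\<close>
lemma nn_integral_distr_le:
  assumes T: "T \<in> M \<rightarrow>\<^sub>M N"
  shows "(\<integral>\<^sup>+x. f x \<partial>distr M N T) \<le> (\<integral>\<^sup>+x. f (T x) \<partial>M)"
  unfolding nn_integral_def[of "distr M N T"]
proof (rule SUP_least)
  fix g assume "g \<in> {g. simple_function (distr M N T) g \<and> g \<le> f}"
  then have g: "simple_function (distr M N T) g" "g \<le> f" by auto
  have gm: "g \<in> borel_measurable N"
    using borel_measurable_simple_function[OF g(1)] by simp
  have "integral\<^sup>S (distr M N T) g = (\<integral>\<^sup>+x. g x \<partial>distr M N T)"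
    using g(1) by (rule nn_integral_eq_simple_integral[symmetric])
  also have "\<dots> = (\<integral>\<^sup>+x. g (T x) \<partial>M)"
    using T gm by (intro nn_integral_distr) auto
  also have "\<dots> \<le> (\<integral>\<^sup>+x. f (T x) \<partial>M)"
    using g(2) by (intro nn_integral_mono) (auto simp: le_fun_def)
  finally show "integral\<^sup>S (distr M N T) g \<le> (\<integral>\<^sup>+x. f (T x) \<partial>M)" .
qed

lemma dTV_le_sizes: "dTV \<omega> \<eta> \<le> real (size \<omega>) + real (size \<eta>)"
  unfolding dTV_def
proof (rule cSUP_least)
  show "sets borel \<noteq> ({} :: 'a set set)" using sets.empty_sets by blast
next
  fix A
  show "\<bar>real (mcount \<omega> A) - real (mcount \<eta> A)\<bar> \<le> real (size \<omega>) + real (size \<eta>)"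
    using mcount_le_size[of \<omega> A] mcount_le_size[of \<eta> A] by linarith
qed

lemma dTV_self [simp]: "dTV \<omega> \<omega> = 0"
proof -
  have "sets borel \<noteq> ({} :: 'a set set)" using sets.empty_sets by blast
  then show ?thesis by (simp add: dTV_def)
qed

text \<open>The common part \<open>R\<close> is put on the diagonal, the two remainders are coupled independently.\<close>
lemma dKR_le_diff_measure:
  fixes P Q R :: "('a::topological_space) multiset measure"
  assumes P: "prob_space P" "sets P = sets conf_space" and Q: "prob_space Q" "sets Q = sets conf_space"
    and R: "sets R = sets conf_space"
    and RP: "\<And>A. A \<in> sets conf_space \<Longrightarrow> emeasure R A \<le> emeasure P A"
    and RQ: "\<And>A. A \<in> sets conf_space \<Longrightarrow> emeasure R A \<le> emeasure Q A"
  shows "dKR P Q \<le> (\<integral>\<^sup>+\<omega>. of_nat (size \<omega>) \<partial>diff_measure P R) + (\<integral>\<^sup>+\<omega>. of_nat (size \<omega>) \<partial>diff_measure Q R)"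
proof -
  interpret P: prob_space P by fact
  interpret Q: prob_space Q by fact
  have sp: "space P = UNIV" "space Q = UNIV" "space R = UNIV"
    using P(2) Q(2) R by (auto dest!: sets_eq_imp_space_eq)
  have UN: "UNIV \<in> sets (conf_space :: 'a multiset measure)" using sets.top[of conf_space] by simp
  interpret R: finite_measure R
    using RP[OF UN] P.emeasure_space_1 sp by (intro finite_measureI) (auto simp: top_unique)
  define P' where "P' = diff_measure P R"
  define Q' where "Q' = diff_measure Q R"
  have sets' [measurable_cong, simp]: "sets P' = sets conf_space" "sets Q' = sets conf_space"
    by (simp_all add: P'_def Q'_def P Q)
  have sp' [simp]: "space P' = UNIV" "space Q' = UNIV"
    by (simp_all add: P'_def Q'_def sp)
  have P': "emeasure P' A = emeasure P A - emeasure R A" if "A \<in> sets conf_space" for A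
    unfolding P'_def using that P R RP
    by (intro emeasure_diff_measure) (auto intro: P.finite_measure_axioms R.finite_measure_axioms)
  have Q': "emeasure Q' A = emeasure Q A - emeasure R A" if "A \<in> sets conf_space" for A
    unfolding Q'_def using that Q R RQ
    by (intro emeasure_diff_measure) (auto intro: Q.finite_measure_axioms R.finite_measure_axioms)
  have sumP: "emeasure R A + emeasure P' A = emeasure P A" if "A \<in> sets conf_space" for A
    using RP[OF that] by (simp add: P'[OF that] add_diff_inverse_ennreal)
  have sumQ: "emeasure R A + emeasure Q' A = emeasure Q A" if "A \<in> sets conf_space" for A
    using RQ[OF that] by (simp add: Q'[OF that] add_diff_inverse_ennreal)
  \<comment> \<open>The common mass of the two remainders. The product of \<open>P'\<close> and
    \<open>Q'\<close> has marginals scaled by \<open>\<delta>\<close>, which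
    \<open>inverse \<delta>\<close> corrects.\<close>
  define \<delta> where "\<delta> = 1 - emeasure R UNIV"
  have \<delta>P: "emeasure P' UNIV = \<delta>" and \<delta>Q: "emeasure Q' UNIV = \<delta>"
    using P.emeasure_space_1 Q.emeasure_space_1 by (simp_all add: P'[OF UN] Q'[OF UN] \<delta>_def sp)
  have \<delta>_fin: "\<delta> \<noteq> top" by (simp add: \<delta>_def)
  interpret P': finite_measure P' by (rule finite_measureI) (simp add: \<delta>P \<delta>_fin)
  interpret Q': finite_measure Q' by (rule finite_measureI) (simp add: \<delta>Q \<delta>_fin)
  have zero: "emeasure P' A = 0" "emeasure Q' A = 0" if "\<delta> = 0" for A
    using that \<delta>P \<delta>Q emeasure_space[of P' A] emeasure_space[of Q' A] by auto
  \<comment> \<open>For \<open>\<delta> = 0\<close> the inverse is infinite, but then both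
    remainders vanish, and \<open>top * 0 = 0\<close> in \<open>ennreal\<close>.\<close>
  have inv: "inverse \<delta> * (\<delta> * x) = x" if "\<delta> = 0 \<Longrightarrow> x = 0" for x
  proof (cases "\<delta> = 0")
    case False
    then have "inverse \<delta> * \<delta> = 1"
      using \<delta>_fin ennreal_divide_self[of \<delta>] by (simp add: divide_ennreal_def mult.commute less_top zero_less_iff_neq_zero)
    then show ?thesis by (simp add: mult.assoc[symmetric])
  qed (use that in simp)
  have sets_PQ: "sets (P' \<Otimes>\<^sub>M Q') = sets (conf_space \<Otimes>\<^sub>M conf_space)"
    by (intro sets_pair_measure_cong) simp_all
  let ?D = "distr R (conf_space \<Otimes>\<^sub>M conf_space) (\<lambda>\<omega>. (\<omega>, \<omega>))"
  let ?I = "scale_measure (inverse \<delta>) (P' \<Otimes>\<^sub>M Q')"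
  define C where "C = sum_measure ?D ?I"
  have diag: "(\<lambda>\<omega>. (\<omega>, \<omega>)) \<in> R \<rightarrow>\<^sub>M conf_space \<Otimes>\<^sub>M conf_space"
    by (simp add: measurable_cong_sets[OF R refl])
  have setsI: "sets ?I = sets ?D"
    by (simp add: sets_scale_measure cong: sets_pair_measure_cong)
  have setsC: "sets C = sets (conf_space \<Otimes>\<^sub>M conf_space)"
    by (simp add: C_def)
  have spC: "space C = UNIV"
    by (simp add: C_def space_pair_measure)
  have fst_C: "emeasure C (A \<times> UNIV) = emeasure P A" if A: "A \<in> sets conf_space" for A
  proof -
    have "emeasure C (A \<times> UNIV) = emeasure R A + inverse \<delta> * (emeasure P' A * \<delta>)"
      unfolding C_def using A UN R
      by (subst emeasure_sum_measure[OF setsI])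
        (auto simp: emeasure_distr[OF diag] sp Q'.emeasure_pair_measure_Times \<delta>Q intro!: arg_cong2[where f = "(+)"] arg_cong[where f = "emeasure R"])
    also have "inverse \<delta> * (emeasure P' A * \<delta>) = emeasure P' A"
      using inv[of "emeasure P' A"] zero by (simp add: mult.commute)
    finally show ?thesis using sumP[OF A] by simp
  qed
  have snd_C: "emeasure C (UNIV \<times> A) = emeasure Q A" if A: "A \<in> sets conf_space" for A
  proof -
    have "emeasure C (UNIV \<times> A) = emeasure R A + inverse \<delta> * (\<delta> * emeasure Q' A)"
      unfolding C_def using A UN R
      by (subst emeasure_sum_measure[OF setsI])
        (auto simp: emeasure_distr[OF diag] sp Q'.emeasure_pair_measure_Times \<delta>P intro!: arg_cong2[where f = "(+)"] arg_cong[where f = "emeasure R"])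
    also have "inverse \<delta> * (\<delta> * emeasure Q' A) = emeasure Q' A"
      using inv[of "emeasure Q' A"] zero by simp
    finally show ?thesis using sumQ[OF A] by simp
  qed
  have "C \<in> couplings P Q"
    unfolding couplings_def
  proof (safe intro!: measure_eqI)
    show "prob_space C"
      using fst_C[OF UN] P.emeasure_space_1 by (intro prob_spaceI) (simp add: spC sp)
    have [measurable]: "fst \<in> C \<rightarrow>\<^sub>M conf_space" "snd \<in> C \<rightarrow>\<^sub>M conf_space"
      by (simp_all add: measurable_cong_sets[OF setsC refl])
    show "emeasure (distr C conf_space fst) A = emeasure P A" if "A \<in> sets (distr C conf_space fst)" for A
    proof -
      have "fst -` A \<inter> space C = A \<times> UNIV" by (auto simp: spC)
      then show ?thesis using that fst_C by (simp add: emeasure_distr)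
    qed
    show "emeasure (distr C conf_space snd) A = emeasure Q A" if "A \<in> sets (distr C conf_space snd)" for A
    proof -
      have "snd -` A \<inter> space C = UNIV \<times> A" by (auto simp: spC)
      then show ?thesis using that snd_C by (simp add: emeasure_distr)
    qed
  qed (simp_all add: setsC P Q)
  then have "dKR P Q \<le> (\<integral>\<^sup>+p. ennreal (dTV (fst p) (snd p)) \<partial>C)"
    unfolding dKR_def by (rule INF_lower)
  also have "\<dots> \<le> (\<integral>\<^sup>+p. ennreal (dTV (fst p) (snd p)) \<partial>?D) + (\<integral>\<^sup>+p. ennreal (dTV (fst p) (snd p)) \<partial>?I)"
    unfolding C_def by (rule nn_integral_sum_measure_le[OF setsI])
  also have "(\<integral>\<^sup>+p. ennreal (dTV (fst p) (snd p)) \<partial>?D) = 0"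
    using nn_integral_distr_le[OF diag, of "\<lambda>p. ennreal (dTV (fst p) (snd p))"] by simp
  also have "0 + (\<integral>\<^sup>+p. ennreal (dTV (fst p) (snd p)) \<partial>?I) \<le> (\<integral>\<^sup>+p. of_nat (size (fst p)) + of_nat (size (snd p)) \<partial>?I)"
    using dTV_le_sizes by (auto intro!: nn_integral_mono simp: ennreal_of_nat_eq_real_of_nat simp flip: ennreal_plus)
  also have "\<dots> = inverse \<delta> * (\<integral>\<^sup>+p. of_nat (size (fst p)) + of_nat (size (snd p)) \<partial>(P' \<Otimes>\<^sub>M Q'))"
    by (intro nn_integral_scale_measure) (simp add: measurable_cong_sets[OF sets_PQ refl])
  also have "(\<integral>\<^sup>+p. of_nat (size (fst p)) + of_nat (size (snd p)) \<partial>(P' \<Otimes>\<^sub>M Q')) =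
      (\<integral>\<^sup>+\<omega>. \<integral>\<^sup>+\<eta>. of_nat (size \<omega>) + of_nat (size \<eta>) \<partial>Q' \<partial>P')"
    by (subst Q'.nn_integral_fst[symmetric]) (simp_all add: measurable_cong_sets[OF sets_PQ refl])
  also have "\<dots> = (\<integral>\<^sup>+\<omega>. of_nat (size \<omega>) * \<delta> + (\<integral>\<^sup>+\<eta>. of_nat (size \<eta>) \<partial>Q') \<partial>P')"
    by (simp add: nn_integral_add \<delta>Q)
  also have "\<dots> = (\<integral>\<^sup>+\<omega>. of_nat (size \<omega>) \<partial>P') * \<delta> + (\<integral>\<^sup>+\<eta>. of_nat (size \<eta>) \<partial>Q') * \<delta>"
    by (simp add: nn_integral_add nn_integral_multc \<delta>P)
  also have "inverse \<delta> * \<dots> = inverse \<delta> * (\<delta> * ((\<integral>\<^sup>+\<omega>. of_nat (size \<omega>) \<partial>P') + (\<integral>\<^sup>+\<eta>. of_nat (size \<eta>) \<partial>Q')))"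
    by (simp add: algebra_simps)
  also have "\<dots> \<le> (\<integral>\<^sup>+\<omega>. of_nat (size \<omega>) \<partial>P') + (\<integral>\<^sup>+\<eta>. of_nat (size \<eta>) \<partial>Q')"
    by (cases "\<delta> = 0") (simp_all add: inv)
  finally show ?thesis by (simp add: P'_def Q'_def)
qed

text \<open>The mean size is the sum of the tail measures. Each tail is finite, so subtraction is
  exact tail by tail even if the means are infinite.\<close>

lemma nn_integral_size_diff_measure:
  fixes M R :: "('a::topological_space) multiset measure"
  assumes M: "finite_measure M" "sets M = sets conf_space" and R: "finite_measure R" "sets R = sets conf_space"
    and RM: "\<And>A. A \<in> sets conf_space \<Longrightarrow> emeasure R A \<le> emeasure M A"
  shows "(\<integral>\<^sup>+\<omega>. of_nat (size \<omega>) \<partial>R) + (\<integral>\<^sup>+\<omega>. of_nat (size \<omega>) \<partial>diff_measure M R) = (\<integral>\<^sup>+\<omega>. of_nat (size \<omega>) \<partial>M)"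
proof -
  have nn: "(\<integral>\<^sup>+\<omega>. of_nat (size \<omega>) \<partial>N) = (\<Sum>t. emeasure N {\<omega>. t < size \<omega>})"
    if "sets N = sets conf_space" for N :: "'a multiset measure"
  proof -
    have "size \<in> N \<rightarrow>\<^sub>M count_space UNIV"
      unfolding measurable_cong_sets[OF that refl] by (rule measurable_size) simp
    from nn_integral_nat_function[OF this] show ?thesis
      using sets_eq_imp_space_eq[OF that] by simp
  qed
  have S: "{\<omega>. t < size \<omega>} \<in> sets (conf_space :: 'a multiset measure)" for t
  proof -
    have "size \<in> (conf_space :: 'a multiset measure) \<rightarrow>\<^sub>M count_space UNIV"
      by (rule measurable_size) simp
    from measurable_sets[OF this, of "{t<..}"] show ?thesis by (simp add: vimage_def)
  qed
  have "emeasure R {\<omega>. t < size \<omega>} + emeasure (diff_measure M R) {\<omega>. t < size \<omega>} = emeasure M {\<omega>. t < size \<omega>}" for t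
  proof -
    have "emeasure (diff_measure M R) {\<omega>. t < size \<omega>} = emeasure M {\<omega>. t < size \<omega>} - emeasure R {\<omega>. t < size \<omega>}"
      using M R RM S[of t] by (intro emeasure_diff_measure) simp_all
    then show ?thesis using RM[OF S[of t]] by (simp add: add_diff_inverse_ennreal)
  qed
  then show ?thesis
    by (simp add: nn M(2) R(2) suminf_add)
qed

text \<open>\<open>e\<close> bounds the excess of the mean of \<open>P\<close> and \<open>e'\<close>
  the deficit of \<open>R\<close>, both relative to \<open>l\<close>. The deficit enters both
  remainders, hence the factor 2; the finite mean of \<open>R\<close> permits cancellation.\<close>

lemma dKR_le_common_part:
  fixes P Q R :: "('a::topological_space) multiset measure"
  assumes P: "prob_space P" "sets P = sets conf_space" and Q: "prob_space Q" "sets Q = sets conf_space"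
    and R: "sets R = sets conf_space"
    and RP: "\<And>A. A \<in> sets conf_space \<Longrightarrow> emeasure R A \<le> emeasure P A"
    and RQ: "\<And>A. A \<in> sets conf_space \<Longrightarrow> emeasure R A \<le> emeasure Q A"
    and mP: "(\<integral>\<^sup>+\<omega>. of_nat (size \<omega>) \<partial>P) \<le> ennreal l + ennreal e"
    and mQ: "(\<integral>\<^sup>+\<omega>. of_nat (size \<omega>) \<partial>Q) \<le> ennreal l"
    and mR: "ennreal l \<le> (\<integral>\<^sup>+\<omega>. of_nat (size \<omega>) \<partial>R) + ennreal e'"
    and nonneg: "0 \<le> e" "0 \<le> e'"
  shows "dKR P Q \<le> ennreal (e + 2 * e')"
proof -
  interpret P: prob_space P by fact
  interpret Q: prob_space Q by fact
  have sp: "space P = UNIV" "space Q = UNIV" "space R = UNIV"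
    using P(2) Q(2) R by (auto dest!: sets_eq_imp_space_eq)
  have UN: "UNIV \<in> sets (conf_space :: 'a multiset measure)" using sets.top[of conf_space] by simp
  interpret R: finite_measure R
  proof (rule finite_measureI)
    have "emeasure R UNIV \<le> emeasure P UNIV" by (rule RP[OF UN])
    then show "emeasure R (space R) \<noteq> \<infinity>"
      using P.emeasure_space_1 by (auto simp: sp top_unique)
  qed
  note split = nn_integral_size_diff_measure[OF _ _ R.finite_measure_axioms R]
  have sP: "(\<integral>\<^sup>+\<omega>. of_nat (size \<omega>) \<partial>R) + (\<integral>\<^sup>+\<omega>. of_nat (size \<omega>) \<partial>diff_measure P R) = (\<integral>\<^sup>+\<omega>. of_nat (size \<omega>) \<partial>P)"
    by (rule split[OF P.finite_measure_axioms P(2) RP])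
  have sQ: "(\<integral>\<^sup>+\<omega>. of_nat (size \<omega>) \<partial>R) + (\<integral>\<^sup>+\<omega>. of_nat (size \<omega>) \<partial>diff_measure Q R) = (\<integral>\<^sup>+\<omega>. of_nat (size \<omega>) \<partial>Q)"
    by (rule split[OF Q.finite_measure_axioms Q(2) RQ])
  have fin: "(\<integral>\<^sup>+\<omega>. of_nat (size \<omega>) \<partial>R) \<noteq> top"
  proof -
    have "(\<integral>\<^sup>+\<omega>. of_nat (size \<omega>) \<partial>R) \<le> (\<integral>\<^sup>+\<omega>. of_nat (size \<omega>) \<partial>Q)"
      unfolding sQ[symmetric] by simp
    also have "\<dots> \<le> ennreal l" by fact
    also have "\<dots> < top" by simp
    finally show ?thesis by simp
  qed
  have "(\<integral>\<^sup>+\<omega>. of_nat (size \<omega>) \<partial>R) + (\<integral>\<^sup>+\<omega>. of_nat (size \<omega>) \<partial>diff_measure P R) \<le> ennreal l + ennreal e"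
    unfolding sP by fact
  also have "\<dots> \<le> ((\<integral>\<^sup>+\<omega>. of_nat (size \<omega>) \<partial>R) + ennreal e') + ennreal e"
    by (intro add_right_mono mR)
  finally have 1: "(\<integral>\<^sup>+\<omega>. of_nat (size \<omega>) \<partial>diff_measure P R) \<le> ennreal e' + ennreal e"
    using fin by (simp add: add.assoc ennreal_add_left_cancel_le)
  have "(\<integral>\<^sup>+\<omega>. of_nat (size \<omega>) \<partial>R) + (\<integral>\<^sup>+\<omega>. of_nat (size \<omega>) \<partial>diff_measure Q R) \<le> (\<integral>\<^sup>+\<omega>. of_nat (size \<omega>) \<partial>R) + ennreal e'"
    unfolding sQ using mQ mR by (rule order_trans)
  then have 2: "(\<integral>\<^sup>+\<omega>. of_nat (size \<omega>) \<partial>diff_measure Q R) \<le> ennreal e'"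
    using fin by (simp add: ennreal_add_left_cancel_le)
  have "dKR P Q \<le> (\<integral>\<^sup>+\<omega>. of_nat (size \<omega>) \<partial>diff_measure P R) + (\<integral>\<^sup>+\<omega>. of_nat (size \<omega>) \<partial>diff_measure Q R)"
    using P Q R RP RQ by (rule dKR_le_diff_measure)
  also have "\<dots> \<le> (ennreal e' + ennreal e) + ennreal e'"
    by (intro add_mono 1 2)
  also have "\<dots> = ennreal (e + 2 * e')"
    using nonneg by (simp flip: ennreal_plus)
  finally show ?thesis .
qed

section \<open>Poisson processes as mixed binomial processes\<close>

lemma mcount_UN:
  assumes "finite J" "disjoint_family_on As J"
  shows "mcount \<omega> (\<Union>i\<in>J. As i) = (\<Sum>i\<in>J. mcount \<omega> (As i))"
proof (induction \<omega>)
  case (add x \<omega>)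
  show ?case
  proof (cases "x \<in> (\<Union>i\<in>J. As i)")
    case True
    then obtain i where i: "i \<in> J" "x \<in> As i" by blast
    then have "x \<in> As j \<longleftrightarrow> j = i" if "j \<in> J" for j
      using assms(2) that unfolding disjoint_family_on_def by blast
    then have "(\<Sum>j\<in>J. mcount (add_mset x \<omega>) (As j)) = (\<Sum>j\<in>J. mcount \<omega> (As j) + (if j = i then 1 else 0))"
      by (intro sum.cong) auto
    also have "\<dots> = (\<Sum>j\<in>J. mcount \<omega> (As j)) + 1"
      using i assms(1) sum.delta[of J i "\<lambda>_. 1 :: nat"] by (simp only: sum.distrib) simp
    finally show ?thesis using add i by auto
  next
    case False
    then show ?thesis using add by (auto intro!: sum.cong)
  qed
qed simp

lemma size_eq_sum_mcount:
  fixes k :: nat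
  assumes "disjoint_family_on As {..<k}" "(\<Union>i<k. As i) = UNIV"
  shows "size \<omega> = (\<Sum>i<k. mcount \<omega> (As i))"
  using mcount_UN[of "{..<k}" As \<omega>] assms by simp

text \<open>The cells are the atoms of the algebra generated by \<open>\<A>\<close>, indexed by the
  subsets of \<open>\<A>\<close>: an atom collects the points lying in exactly the chosen sets, and
  may be empty.\<close>

lemma finite_borel_partition:
  fixes \<A> :: "'a::topological_space set set"
  assumes "finite \<A>" "\<A> \<subseteq> sets borel"
  obtains k and As :: "nat \<Rightarrow> 'a set" and J :: "'a set \<Rightarrow> nat set" where
    "\<And>i. As i \<in> sets borel" "disjoint_family_on As {..<k}" "(\<Union>i<k. As i) = UNIV"
    "\<And>A. A \<in> \<A> \<Longrightarrow> J A \<subseteq> {..<k} \<and> A = (\<Union>i\<in>J A. As i)"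
proof -
  have "finite (Pow \<A>)" using assms by simp
  from ex_bij_betw_nat_finite[OF this] obtain h where h: "bij_betw h {0..<card (Pow \<A>)} (Pow \<A>)" by blast
  define k where "k = card (Pow \<A>)"
  have h: "bij_betw h {..<k} (Pow \<A>)" using h by (simp add: k_def atLeast0LessThan)
  define atom where "atom S = {y. \<forall>A\<in>\<A>. y \<in> A \<longleftrightarrow> A \<in> S}" for S
  have atom: "y \<in> atom {A\<in>\<A>. y \<in> A}" for y by (simp add: atom_def)
  show ?thesis
  proof
    show "atom (h i) \<in> sets borel" for i
    proof -
      have "atom (h i) = (\<Inter>A\<in>\<A>. if A \<in> h i then A else - A) \<inter> UNIV"
        by (auto simp: atom_def split: if_splits)
      also have "\<dots> \<in> sets borel"
        using assms
      proof (induction \<A>)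
        case (insert A \<A>)
        then show ?case by (simp only: INT_insert Int_assoc) (intro sets.Int, auto)
      qed simp
      finally show ?thesis .
    qed
    show "disjoint_family_on (\<lambda>i. atom (h i)) {..<k}"
    proof (unfold disjoint_family_on_def, safe)
      fix i j y assume ij: "i < k" "j < k" "i \<noteq> j" and "y \<in> atom (h i)" "y \<in> atom (h j)"
      moreover have "h i \<subseteq> \<A>" "h j \<subseteq> \<A>" using h ij by (auto simp: bij_betw_def)
      ultimately have "h i = h j" unfolding atom_def by blast
      with ij h show "y \<in> {}" by (auto simp: bij_betw_def inj_on_def)
    qed
    have "y \<in> (\<Union>i<k. atom (h i))" for y
    proof -
      have "{A\<in>\<A>. y \<in> A} \<in> h ` {..<k}" using h by (auto simp: bij_betw_def)
      then show ?thesis using atom[of y] by auto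
    qed
    then show "(\<Union>i<k. atom (h i)) = UNIV" by blast
    show "{i. i < k \<and> A \<in> h i} \<subseteq> {..<k} \<and> A = (\<Union>i\<in>{i. i < k \<and> A \<in> h i}. atom (h i))" if A: "A \<in> \<A>" for A
    proof safe
      fix y assume y: "y \<in> A"
      have "{A\<in>\<A>. y \<in> A} \<in> h ` {..<k}" using h by (auto simp: bij_betw_def)
      then obtain i where "i < k" "h i = {A\<in>\<A>. y \<in> A}" by auto
      then show "y \<in> (\<Union>i\<in>{i. i < k \<and> A \<in> h i}. atom (h i))"
        using atom[of y] y A by auto
    next
      fix y i assume "A \<in> h i" "y \<in> atom (h i)"
      then show "y \<in> A" using A by (auto simp: atom_def)
    qed
  qed
qed

text \<open>Cylinders may involve overlapping sets, while Poisson counts are specified jointly on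
  disjoint ones. Refining to a partition turns a cylinder into a countable disjoint union of events
  that fix all counts.\<close>

lemma conf_measure_eqI:
  fixes P Q :: "('a::topological_space) multiset measure"
  assumes P: "finite_measure P" "sets P = sets conf_space" and Q: "sets Q = sets conf_space"
    and eq: "\<And>k As \<nu>. (\<And>i. As i \<in> sets borel) \<Longrightarrow> disjoint_family_on As {..<k} \<Longrightarrow> (\<Union>i<k. As i) = UNIV \<Longrightarrow>
      emeasure P {\<omega>. \<forall>i<k. mcount \<omega> (As i) = \<nu> i} = emeasure Q {\<omega>. \<forall>i<k. mcount \<omega> (As i) = (\<nu> :: nat \<Rightarrow> nat) i}"
  shows "P = Q"
proof (rule measure_eqI_generator_eq[where E = cylinders and \<Omega> = UNIV and A = "\<lambda>_. UNIV", OF Int_stable_cylinders])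
  fix X :: "'a multiset set" assume "X \<in> cylinders"
  then obtain L where L: "X = cylinder L" "fst ` set L \<subseteq> sets borel" by (auto simp: cylinders_def)
  obtain k and As :: "nat \<Rightarrow> 'a set" and J where As: "\<And>i. As i \<in> sets borel" "disjoint_family_on As {..<k}" "(\<Union>i<k. As i) = UNIV"
    and J: "\<And>A. A \<in> fst ` set L \<Longrightarrow> J A \<subseteq> {..<k} \<and> A = (\<Union>i\<in>J A. As i)"
    using finite_borel_partition[of "fst ` set L"] L(2) by (metis finite_imageI finite_set)
  define E where "E \<nu> = {\<omega>. \<forall>i<k. mcount \<omega> (As i) = \<nu> i}" for \<nu> :: "nat \<Rightarrow> nat"
  \<comment> \<open>Extensional functions only: count vectors that agree below \<open>k\<close> are
    then equal, which makes the events \<open>E \<nu>\<close> disjoint over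
    \<open>N\<close>.\<close>
  define N where "N = {\<nu> \<in> PiE {..<k} (\<lambda>_. UNIV). \<forall>(A, n) \<in> set L. (\<Sum>i\<in>J A. \<nu> i) = n}"
  have N: "countable N"
    unfolding N_def by (rule countable_subset[OF _ countable_PiE[of "{..<k}" "\<lambda>_. UNIV"]]) (blast, simp_all)
  have disj: "disjoint_family_on E N"
  proof (unfold disjoint_family_on_def, safe)
    fix \<nu> \<nu>' \<omega> assume "\<nu> \<in> N" "\<nu>' \<in> N" "\<nu> \<noteq> \<nu>'" "\<omega> \<in> E \<nu>" "\<omega> \<in> E \<nu>'"
    moreover from this have "\<nu> \<in> PiE {..<k} (\<lambda>_. UNIV)" "\<nu>' \<in> PiE {..<k} (\<lambda>_. UNIV)"
      by (simp_all add: N_def)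
    then have "\<nu> = \<nu>'"
      by (rule PiE_ext) (use \<open>\<omega> \<in> E \<nu>\<close> \<open>\<omega> \<in> E \<nu>'\<close> in \<open>auto simp: E_def\<close>)
    ultimately show "\<omega> \<in> {}" by simp
  qed
  have mc: "mcount \<omega> A = (\<Sum>i\<in>J A. mcount \<omega> (As i))" if "A \<in> fst ` set L" for A \<omega>
  proof -
    have "finite (J A)" using J[OF that] by (auto intro: finite_subset)
    moreover have "disjoint_family_on As (J A)"
      using J[OF that] As(2) by (meson disjoint_family_on_mono)
    ultimately have "mcount \<omega> (\<Union>i\<in>J A. As i) = (\<Sum>i\<in>J A. mcount \<omega> (As i))" by (rule mcount_UN)
    then show ?thesis using J[OF that] by simp
  qed
  have X: "X = (\<Union>\<nu>\<in>N. E \<nu>)"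
  proof (intro equalityI subsetI)
    fix \<omega> assume "\<omega> \<in> X"
    then have w: "\<And>A n. (A, n) \<in> set L \<Longrightarrow> mcount \<omega> A = n" by (auto simp: L cylinder_def)
    have "(\<Sum>i\<in>J A. restrict (\<lambda>i. mcount \<omega> (As i)) {..<k} i) = n" if "(A, n) \<in> set L" for A n
    proof -
      have A: "A \<in> fst ` set L" using that by force
      then have "(\<Sum>i\<in>J A. restrict (\<lambda>i. mcount \<omega> (As i)) {..<k} i) = (\<Sum>i\<in>J A. mcount \<omega> (As i))"
        using J[OF A] by (intro sum.cong) auto
      then show ?thesis using mc[OF A] w[OF that] by simp
    qed
    then have "restrict (\<lambda>i. mcount \<omega> (As i)) {..<k} \<in> N" by (auto simp: N_def)
    moreover have "\<omega> \<in> E (restrict (\<lambda>i. mcount \<omega> (As i)) {..<k})" by (simp add: E_def)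
    ultimately show "\<omega> \<in> (\<Union>\<nu>\<in>N. E \<nu>)" by blast
  next
    fix \<omega> assume "\<omega> \<in> (\<Union>\<nu>\<in>N. E \<nu>)"
    then obtain \<nu> where \<nu>: "\<nu> \<in> N" "\<omega> \<in> E \<nu>" by blast
    have "mcount \<omega> A = n" if "(A, n) \<in> set L" for A n
    proof -
      have A: "A \<in> fst ` set L" using that by force
      have "(\<Sum>i\<in>J A. mcount \<omega> (As i)) = (\<Sum>i\<in>J A. \<nu> i)"
        using J[OF A] \<nu> by (intro sum.cong) (auto simp: E_def)
      also have "\<dots> = n" using \<nu> that by (auto simp: N_def)
      finally show ?thesis using mc[OF A] by simp
    qed
    then show "\<omega> \<in> X" by (auto simp: L cylinder_def)
  qed
  have E: "E \<nu> \<in> sets conf_space" for \<nu>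
  proof -
    have "E \<nu> = cylinder (map (\<lambda>i. (As i, \<nu> i)) [0..<k])"
      by (auto simp: E_def cylinder_def)
    then show ?thesis using As by (auto intro!: cylinder_measurable)
  qed
  show "emeasure P X = emeasure Q X"
    unfolding X using N disj E P Q eq[OF As]
    by (subst (1 2) emeasure_UN_countable) (auto simp: E_def)
qed (use P Q finite_measure.emeasure_finite[OF P(1)] cylinder_Nil in \<open>auto simp: sets_conf_space_cylinders cylinders_def intro!: exI[of _ "[]"]\<close>)

context unit_volume
begin

text \<open>One family for both input processes: \<open>return_pmf n\<close> gives the binomial
  process, a Poisson distribution the Poisson process.\<close>

definition mixed :: "nat pmf \<Rightarrow> 'a multiset measure" where
  "mixed p = measure_pmf p \<bind> B"

lemma B_in_subprob_algebra: "B n \<in> space (subprob_algebra conf_space)"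
  by (simp add: space_subprob_algebra prob_space_imp_subprob_space prob_space_B)

lemma measurable_B: "B \<in> measure_pmf p \<rightarrow>\<^sub>M subprob_algebra conf_space"
  by (simp add: B_in_subprob_algebra)

lemma sets_mixed [simp, measurable_cong]: "sets (mixed p) = sets conf_space"
  unfolding mixed_def by (rule sets_bind[OF sets_B]) simp

lemma space_mixed [simp]: "space (mixed p) = UNIV"
  using sets_eq_imp_space_eq[OF sets_mixed] by simp

lemma prob_space_mixed: "prob_space (mixed p)"
  unfolding mixed_def
  by (rule prob_space.prob_space_bind[where S = conf_space])
    (auto intro: prob_space_measure_pmf B_in_subprob_algebra B.prob_space_axioms)

lemma emeasure_mixed: "A \<in> sets conf_space \<Longrightarrow> emeasure (mixed p) A = (\<integral>\<^sup>+n. emeasure (B n) A \<partial>measure_pmf p)"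
  unfolding mixed_def by (rule emeasure_bind[OF _ measurable_B]) auto

lemma nn_integral_mixed:
  "F \<in> borel_measurable conf_space \<Longrightarrow> (\<integral>\<^sup>+\<omega>. F \<omega> \<partial>mixed p) = (\<integral>\<^sup>+n. \<integral>\<^sup>+\<omega>. F \<omega> \<partial>B n \<partial>measure_pmf p)"
  unfolding mixed_def by (rule nn_integral_bind[OF _ measurable_B])

lemma mixed_return: "mixed (return_pmf n) = B n"
  by (rule measure_eqI) (simp_all add: emeasure_mixed nn_integral_return_pmf)

text \<open>The multinomial formula. In the induction the Mecke formula removes one point from a
  cell \<open>As i\<close> with positive count, which lowers \<open>\<nu> i\<close> by one.\<close>

lemma measure_B_counts:
  fixes k :: nat
  assumes As: "\<And>i. As i \<in> sets borel" and \<nu>: "(\<Sum>i<k. \<nu> i) = n"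
    and disj: "disjoint_family_on As {..<k}"
  shows "measure (B n) {\<omega>. \<forall>i<k. mcount \<omega> (As i) = \<nu> i} = fact n * (\<Prod>i<k. measure lborel (As i \<inter> K) ^ \<nu> i / fact (\<nu> i))"
  using \<nu>
proof (induction n arbitrary: \<nu>)
  case 0
  have "{\<omega>. \<forall>i<k. mcount \<omega> (As i) = \<nu> i} = cylinder (map (\<lambda>i. (As i, \<nu> i)) [0..<k])"
    by (auto simp: cylinder_def)
  then have E: "{\<omega>. \<forall>i<k. mcount \<omega> (As i) = \<nu> i} \<in> sets conf_space"
    using As by (auto intro!: cylinder_measurable)
  have \<nu>: "\<nu> i = 0" if "i < k" for i using 0 that by simp
  have "AE \<omega> in B 0. \<omega> \<in> {\<omega>. \<forall>i<k. mcount \<omega> (As i) = \<nu> i}"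
    using AE_B_size[of 0] by eventually_elim (simp add: \<nu>)
  then have "measure (B 0) {\<omega>. \<forall>i<k. mcount \<omega> (As i) = \<nu> i} = 1"
    using E by (subst B.prob_eq_1) simp_all
  then show ?case by (simp add: \<nu>)
next
  case (Suc n)
  define E where "E \<nu> = {\<omega>. \<forall>i<k. mcount \<omega> (As i) = \<nu> i}" for \<nu> :: "nat \<Rightarrow> nat"
  have E [measurable]: "E \<nu> \<in> sets conf_space" for \<nu>
  proof -
    have "E \<nu> = cylinder (map (\<lambda>i. (As i, \<nu> i)) [0..<k])"
      by (auto simp: E_def cylinder_def)
    then show ?thesis using As by (auto intro!: cylinder_measurable)
  qed
  note [measurable] = As
  obtain i m where i: "i < k" "\<nu> i = Suc m"
    using Suc.prems by (metis Suc_neq_Zero lessThan_iff not0_implies_Suc sum.neutral)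
  define \<mu> where "\<mu> = \<nu>(i := m)"
  have \<mu>: "(\<Sum>j<k. \<mu> j) = n"
  proof -
    have "(\<Sum>j<k. \<nu> j) = \<nu> i + (\<Sum>j\<in>{..<k} - {i}. \<nu> j)" using i by (simp add: sum.remove)
    moreover have "(\<Sum>j<k. \<mu> j) = \<mu> i + (\<Sum>j\<in>{..<k} - {i}. \<mu> j)" using i by (simp add: sum.remove)
    moreover have "(\<Sum>j\<in>{..<k} - {i}. \<mu> j) = (\<Sum>j\<in>{..<k} - {i}. \<nu> j)" by (simp add: \<mu>_def)
    ultimately show ?thesis using Suc.prems i by (simp add: \<mu>_def)
  qed
  have add: "add_mset x \<eta> \<in> E \<nu> \<longleftrightarrow> \<eta> \<in> E \<mu>" if "x \<in> As i" for x \<eta>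
  proof -
    have "x \<in> As j \<longleftrightarrow> j = i" if "j < k" for j
      using disj \<open>x \<in> As i\<close> that i unfolding disjoint_family_on_def by blast
    then show ?thesis using i by (auto simp: E_def \<mu>_def)
  qed
  \<comment> \<open>On \<open>E \<nu>\<close> exactly \<open>Suc m\<close> points lie in
    \<open>As i\<close>, and removing any of them leads to \<open>E \<mu>\<close>.\<close>
  have sum_eq: "of_nat (Suc m) * indicator (E \<nu>) \<omega> = (\<Sum>x\<in>#\<omega>. indicator (As i) x * indicator (E \<mu>) (\<omega> - {#x#}) :: ennreal)" for \<omega>
  proof -
    have "(\<Sum>x\<in>#\<omega>. indicator (As i) x * indicator (E \<mu>) (\<omega> - {#x#}) :: ennreal) = (\<Sum>x\<in>#\<omega>. indicator (As i) x * indicator (E \<nu>) \<omega>)"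
    proof (intro arg_cong[where f = sum_mset] image_mset_cong)
      fix x assume "x \<in># \<omega>"
      then obtain \<eta> where "\<omega> = add_mset x \<eta>" by (metis insert_DiffM)
      then show "(indicator (As i) x * indicator (E \<mu>) (\<omega> - {#x#}) :: ennreal) = indicator (As i) x * indicator (E \<nu>) \<omega>"
        using add[of x \<eta>] by (auto simp: indicator_def)
    qed
    also have "\<dots> = (\<Sum>x\<in>#\<omega>. indicator (As i) x) * indicator (E \<nu>) \<omega>"
      by (simp add: sum_mset_distrib_right)
    also have "(\<Sum>x\<in>#\<omega>. indicator (As i) x :: ennreal) = of_nat (mcount \<omega> (As i))"
      by (induction \<omega>) auto
    also have "\<dots> * indicator (E \<nu>) \<omega> = of_nat (Suc m) * indicator (E \<nu>) \<omega>"
      using i by (auto simp: E_def indicator_def)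
    finally show ?thesis by simp
  qed
  have "of_nat (Suc m) * emeasure (B (Suc n)) (E \<nu>) = (\<integral>\<^sup>+\<omega>. of_nat (Suc m) * indicator (E \<nu>) \<omega> \<partial>B (Suc n))"
    by (simp add: nn_integral_cmult)
  also have "\<dots> = (\<integral>\<^sup>+\<omega>. (\<Sum>x\<in>#\<omega>. indicator (As i) x * indicator (E \<mu>) (\<omega> - {#x#})) \<partial>B (Suc n))"
    by (simp only: sum_eq)
  also have "\<dots> = of_nat (Suc n) * (\<integral>\<^sup>+x. \<integral>\<^sup>+\<omega>. indicator (As i) x * indicator (E \<mu>) \<omega> \<partial>B n \<partial>U)"
    by (rule nn_integral_B_remove) measurable
  also have "(\<integral>\<^sup>+x. \<integral>\<^sup>+\<omega>. indicator (As i) x * indicator (E \<mu>) \<omega> \<partial>B n \<partial>U) = emeasure U (As i) * emeasure (B n) (E \<mu>)"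
    by (simp add: nn_integral_cmult nn_integral_multc del: emeasure_uniform_measure)
  finally have "ennreal (real (Suc m) * measure (B (Suc n)) (E \<nu>)) = ennreal (real (Suc n) * (measure U (As i) * measure (B n) (E \<mu>)))"
    by (simp only: B.emeasure_eq_measure U.emeasure_eq_measure ennreal_of_nat_eq_real_of_nat) (simp add: ennreal_mult)
  then have "real (Suc m) * measure (B (Suc n)) (E \<nu>) = real (Suc n) * (measure U (As i) * measure (B n) (E \<mu>))"
    by (subst (asm) ennreal_inj) simp_all
  also have "measure U (As i) = measure lborel (As i \<inter> K)"
    using emeasure_U[OF As[of i]] by (simp only: measure_def)
  also have "measure (B n) (E \<mu>) = fact n * (\<Prod>i<k. measure lborel (As i \<inter> K) ^ \<mu> i / fact (\<mu> i))"
    using Suc.IH[OF \<mu>] by (simp add: E_def)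
  also have "real (Suc n) * (measure lborel (As i \<inter> K) * (fact n * (\<Prod>j<k. measure lborel (As j \<inter> K) ^ \<mu> j / fact (\<mu> j)))) =
      real (Suc n) * fact n * (measure lborel (As i \<inter> K) * (\<Prod>j<k. measure lborel (As j \<inter> K) ^ \<mu> j / fact (\<mu> j)))"
    by (simp only: ac_simps)
  also have "measure lborel (As i \<inter> K) * (\<Prod>j<k. measure lborel (As j \<inter> K) ^ \<mu> j / fact (\<mu> j)) = (\<Prod>j<k. measure lborel (As j \<inter> K) ^ \<nu> j / fact (\<nu> j)) * real (Suc m)"
  proof -
    let ?q = "\<lambda>\<nu> j. measure lborel (As j \<inter> K) ^ \<nu> j / fact (\<nu> j)"
    have "prod (?q \<nu>) {..<k} = ?q \<nu> i * prod (?q \<nu>) ({..<k} - {i})" using i by (simp add: prod.remove)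
    moreover have "prod (?q \<mu>) {..<k} = ?q \<mu> i * prod (?q \<mu>) ({..<k} - {i})" using i by (simp add: prod.remove)
    moreover have "prod (?q \<mu>) ({..<k} - {i}) = prod (?q \<nu>) ({..<k} - {i})" by (intro prod.cong) (auto simp: \<mu>_def)
    moreover have "?q \<nu> i * real (Suc m) = measure lborel (As i \<inter> K) * ?q \<mu> i"
      using i by (simp add: \<mu>_def field_simps del: of_nat_Suc)
    ultimately have q: "prod (?q \<nu>) {..<k} = ?q \<nu> i * prod (?q \<nu>) ({..<k} - {i})"
      "prod (?q \<mu>) {..<k} = ?q \<mu> i * prod (?q \<nu>) ({..<k} - {i})"
      "?q \<nu> i * real (Suc m) = measure lborel (As i \<inter> K) * ?q \<mu> i" by simp_all
    have "prod (?q \<nu>) {..<k} * real (Suc m) = (?q \<nu> i * real (Suc m)) * prod (?q \<nu>) ({..<k} - {i})"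
      unfolding q(1) by (simp only: ac_simps)
    then show ?thesis unfolding q(2,3) by (simp only: ac_simps)
  qed
  finally have "real (Suc m) * measure (B (Suc n)) (E \<nu>) = real (Suc m) * (fact (Suc n) * (\<Prod>j<k. measure lborel (As j \<inter> K) ^ \<nu> j / fact (\<nu> j)))"
    by (simp only: fact_Suc of_nat_mult of_nat_fact ac_simps)
  then show ?case unfolding E_def by (simp del: of_nat_Suc fact_Suc)
qed

text \<open>Independent Poisson counts on a partition with total \<open>N\<close> factor into the
  Poisson weight of \<open>N\<close> and a multinomial probability, which is what the mixture gives.
  Used for the input process and for the limit alike.\<close>

lemma poisson_process_law_unique:
  assumes P: "poisson_process_law (scaled_vol c K) P" and c: "0 < c"
  shows "P = mixed (poisson_pmf c)"
proof (rule conf_measure_eqI)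
  interpret P: prob_space P using P by (simp add: poisson_process_law_def)
  show "finite_measure P" by (rule P.finite_measure_axioms)
  show sets_P: "sets P = sets conf_space" using P by (simp add: poisson_process_law_def)
  have sp: "space P = UNIV" using sets_P by (auto dest: sets_eq_imp_space_eq)
  fix k and As :: "nat \<Rightarrow> 'a set" and \<nu> :: "nat \<Rightarrow> nat"
  assume As: "\<And>i. As i \<in> sets borel" and disj: "disjoint_family_on As {..<k}" and cover: "(\<Union>i<k. As i) = UNIV"
  define E where "E = {\<omega>. \<forall>i<k. mcount \<omega> (As i) = \<nu> i}"
  have E [measurable]: "E \<in> sets conf_space"
  proof -
    have "E = cylinder (map (\<lambda>i. (As i, \<nu> i)) [0..<k])"
      by (auto simp: E_def cylinder_def)
    then show ?thesis using As by (auto intro!: cylinder_measurable)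
  qed
  define N where "N = (\<Sum>i<k. \<nu> i)"
  let ?v = "\<lambda>i. measure lborel (As i \<inter> K)"
  have fin: "emeasure lborel (A \<inter> K) < \<infinity>" for A
  proof -
    have "emeasure lborel (A \<inter> K) \<le> 1"
      unfolding emeasure_K[symmetric] by (intro emeasure_mono) auto
    then show ?thesis by (simp add: order.strict_trans1)
  qed
  have v: "(\<Sum>i<k. ?v i) = 1"
  proof -
    have "(\<Sum>i<k. ?v i) = measure lborel (\<Union>i<k. As i \<inter> K)"
    proof (rule measure_finite_Union[symmetric])
      show "disjoint_family_on (\<lambda>i. As i \<inter> K) {..<k}"
        using disj unfolding disjoint_family_on_def by blast
    qed (use As fin in \<open>auto simp: less_top[symmetric]\<close>)
    also have "(\<Union>i<k. As i \<inter> K) = K" using cover by auto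
    finally show ?thesis using emeasure_K by (simp add: measure_def)
  qed
  have "k > 0" using cover by (cases k) auto
  have scaled: "measure (scaled_vol c K) A = c * measure lborel (A \<inter> K)" "emeasure (scaled_vol c K) A < \<infinity>"
    if [measurable]: "A \<in> sets borel" for A
  proof -
    have "emeasure (scaled_vol c K) A = (\<integral>\<^sup>+x. ennreal c * indicator (A \<inter> K) x \<partial>lborel)"
      unfolding scaled_vol_def by (subst emeasure_density) (auto intro!: nn_integral_cong simp: indicator_def)
    also have "\<dots> = ennreal c * emeasure lborel (A \<inter> K)"
      by (simp add: nn_integral_cmult)
    finally have *: "emeasure (scaled_vol c K) A = ennreal c * emeasure lborel (A \<inter> K)" .
    show "measure (scaled_vol c K) A = c * measure lborel (A \<inter> K)"
      using c by (simp add: measure_def * enn2real_mult)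
    show "emeasure (scaled_vol c K) A < \<infinity>"
      using fin[of A] by (simp add: * ennreal_mult_less_top)
  qed
  have "P.indep_vars (\<lambda>_. count_space UNIV) (\<lambda>i \<omega>. mcount \<omega> (As i)) {..<k}"
    using P As disj by (simp add: poisson_process_law_def)
  then have "measure P (\<Inter>i\<in>{..<k}. (\<lambda>\<omega>. mcount \<omega> (As i)) -` {\<nu> i} \<inter> space P) =
     (\<Prod>i<k. measure P ((\<lambda>\<omega>. mcount \<omega> (As i)) -` {\<nu> i} \<inter> space P))"
    using \<open>k > 0\<close> by (intro P.indep_varsD) auto
  moreover have "(\<Inter>i\<in>{..<k}. (\<lambda>\<omega>. mcount \<omega> (As i)) -` {\<nu> i} \<inter> space P) = E"
    using \<open>k > 0\<close> by (auto simp: E_def sp)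
  moreover have "measure P ((\<lambda>\<omega>. mcount \<omega> (As i)) -` {\<nu> i} \<inter> space P) = (c * ?v i) ^ \<nu> i / fact (\<nu> i) * exp (- (c * ?v i))" for i
  proof -
    have "(\<lambda>\<omega>. mcount \<omega> (As i)) -` {\<nu> i} \<inter> space P = {\<omega> \<in> space P. mcount \<omega> (As i) = \<nu> i}" by auto
    then show ?thesis using P As[of i] scaled[OF As[of i]] by (simp add: poisson_process_law_def)
  qed
  ultimately have "measure P E = (\<Prod>i<k. (c * ?v i) ^ \<nu> i / fact (\<nu> i) * exp (- (c * ?v i)))"
    by simp
  also have "\<dots> = (\<Prod>i<k. c ^ \<nu> i) * (\<Prod>i<k. ?v i ^ \<nu> i / fact (\<nu> i)) * (\<Prod>i<k. exp (- (c * ?v i)))"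
    by (simp add: prod.distrib[symmetric] power_mult_distrib)
  also have "(\<Prod>i<k. exp (- (c * ?v i))) = exp (- c)"
    using v by (simp add: exp_sum[symmetric] sum_negf sum_distrib_left[symmetric])
  also have "(\<Prod>i<k. c ^ \<nu> i) = c ^ N"
    by (simp add: N_def power_sum)
  finally have 1: "emeasure P E = ennreal (c ^ N * (\<Prod>i<k. ?v i ^ \<nu> i / fact (\<nu> i)) * exp (- c))"
    by (simp add: P.emeasure_eq_measure)
  \<comment> \<open>The cells cover the space, so on \<open>E\<close> the number of points is
    \<open>N\<close>; only one term of the mixture survives.\<close>
  have zero: "emeasure (B n) E = 0" if "n \<noteq> N" for n
  proof -
    have "AE \<omega> in B n. \<omega> \<notin> E"
      using AE_B_size[of n]
    proof eventually_elim
      case (elim \<omega>)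
      have "size \<omega> = N" if "\<omega> \<in> E"
        using size_eq_sum_mcount[OF disj cover, of \<omega>] that by (simp add: E_def N_def)
      with elim \<open>n \<noteq> N\<close> show ?case by auto
    qed
    then show ?thesis by (subst (asm) AE_iff_measurable[OF _ refl]) (auto simp: E_def[symmetric])
  qed
  have "emeasure (mixed (poisson_pmf c)) E = (\<integral>\<^sup>+n. emeasure (B n) E \<partial>measure_pmf (poisson_pmf c))"
    by (rule emeasure_mixed[OF E])
  also have "\<dots> = (\<Sum>n\<in>{N}. emeasure (B n) E * pmf (poisson_pmf c) n)"
    using zero by (intro nn_integral_measure_pmf_support) auto
  also have "\<dots> = ennreal (measure (B N) E * (c ^ N / fact N * exp (- c)))"
    using c by (simp add: B.emeasure_eq_measure ennreal_mult[symmetric])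
  also have "measure (B N) E * (c ^ N / fact N * exp (- c)) = c ^ N * (\<Prod>i<k. ?v i ^ \<nu> i / fact (\<nu> i)) * exp (- c)"
    unfolding E_def by (subst measure_B_counts[OF As _ disj]) (simp_all add: N_def)
  finally show "emeasure P {\<omega>. \<forall>i<k. mcount \<omega> (As i) = \<nu> i} = emeasure (mixed (poisson_pmf c)) {\<omega>. \<forall>i<k. mcount \<omega> (As i) = \<nu> i}"
    using 1 by (simp add: E_def)
qed simp

end

section \<open>Averaged matching weights\<close>

text \<open>The Weierstrass product inequality; truncation at 0 admits \<open>y i > 1\<close>, in
  which case the left side is negative.\<close>

lemma prod_max_one_minus_ge:
  fixes y :: "'i \<Rightarrow> real"
  assumes "finite I" "\<And>i. i \<in> I \<Longrightarrow> 0 \<le> y i"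
  shows "1 - (\<Sum>i\<in>I. y i) \<le> (\<Prod>i\<in>I. max 0 (1 - y i))"
  using assms
proof (induction I)
  case (insert i I)
  let ?P = "\<Prod>i\<in>I. max 0 (1 - y i)"
  have P: "0 \<le> ?P" "?P \<le> 1" "1 - (\<Sum>i\<in>I. y i) \<le> ?P" "0 \<le> y i" "0 \<le> (\<Sum>i\<in>I. y i)"
    using insert by (auto intro!: prod_nonneg prod_le_1 sum_nonneg)
  have "1 - (y i + (\<Sum>i\<in>I. y i)) \<le> max 0 (1 - y i) * ?P"
  proof (cases "y i \<le> 1")
    case True
    have "y i * ?P \<le> y i" using P by (simp add: mult_left_le)
    then show ?thesis using True P by (simp add: algebra_simps)
  next
    case False
    then show ?thesis using P by simp
  qed
  then show ?case using insert by simp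
qed simp

text \<open>Multiply \<open>exp (- x) * (1 + x) \<le> 1\<close> by \<open>1 - x\<close>.\<close>

lemma exp_minus_le_max_one_minus:
  fixes x :: real
  assumes "0 \<le> x"
  shows "exp (- x) * max 0 (1 - x\<^sup>2) \<le> max 0 (1 - x)"
proof (cases "x \<le> 1")
  case True
  have "exp (- x) * (1 + x) \<le> exp (- x) * exp x"
    by (intro mult_left_mono exp_ge_add_one_self) simp
  then have "exp (- x) * (1 + x) * (1 - x) \<le> 1 * (1 - x)"
    using True by (intro mult_right_mono) (simp_all flip: exp_add)
  moreover have "1 - x\<^sup>2 = (1 + x) * (1 - x)" by (simp add: power2_eq_square algebra_simps)
  moreover have "0 \<le> (1 + x) * (1 - x)" using True assms by simp
  ultimately show ?thesis using True by (simp add: mult.assoc max_def)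
next
  case False
  then have "1 - x\<^sup>2 \<le> 0" by (simp add: abs_square_le_1 power2_eq_square mult_le_one not_le) (smt (verit) mult_le_cancel_left1)
  then show ?thesis by simp
qed

text \<open>First order terms stay in the exponential, only the squares go through the product
  inequality. The plain bound by \<open>1 - sum\<close> would be too weak later, where the sum is of
  order one and the squares are small.\<close>

lemma prod_max_one_minus_ge_exp:
  fixes x :: "'i \<Rightarrow> real"
  assumes "finite I" "\<And>i. i \<in> I \<Longrightarrow> 0 \<le> x i"
  shows "exp (- (\<Sum>i\<in>I. x i)) - (\<Sum>i\<in>I. (x i)\<^sup>2) \<le> (\<Prod>i\<in>I. max 0 (1 - x i))"
proof -
  let ?e = "exp (- (\<Sum>i\<in>I. x i))"
  have "?e - (\<Sum>i\<in>I. (x i)\<^sup>2) \<le> ?e - ?e * (\<Sum>i\<in>I. (x i)\<^sup>2)"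
    using assms by (simp add: mult_left_le_one_le sum_nonneg)
  also have "\<dots> = ?e * (1 - (\<Sum>i\<in>I. (x i)\<^sup>2))"
    by (simp add: algebra_simps)
  also have "\<dots> \<le> ?e * (\<Prod>i\<in>I. max 0 (1 - (x i)\<^sup>2))"
    using assms by (intro mult_left_mono prod_max_one_minus_ge) auto
  also have "\<dots> = (\<Prod>i\<in>I. exp (- x i) * max 0 (1 - (x i)\<^sup>2))"
    using assms by (simp add: prod.distrib exp_sum sum_negf[symmetric])
  also have "\<dots> \<le> (\<Prod>i\<in>I. max 0 (1 - x i))"
    using assms by (intro prod_mono) (auto intro: exp_minus_le_max_one_minus)
  finally show ?thesis .
qed

section \<open>Factorial moments of the Poisson distribution\<close>

lemma nn_integral_nat_pmf: "(\<integral>\<^sup>+n. f n \<partial>measure_pmf p) = (\<Sum>n. ennreal (pmf p n) * f (n :: nat))"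
  by (simp add: nn_integral_measure_pmf nn_integral_count_space_nat)

text \<open>Size biasing: Poisson weights satisfy \<open>n * p(n) = c * p(n - 1)\<close>.\<close>

lemma nn_integral_poisson_shift:
  fixes h :: "nat \<Rightarrow> ennreal"
  assumes c: "0 < c"
  shows "(\<integral>\<^sup>+n. ennreal (real n) * h (n - 1) \<partial>measure_pmf (poisson_pmf c)) = ennreal c * (\<integral>\<^sup>+n. h n \<partial>measure_pmf (poisson_pmf c))"
proof -
  let ?p = "pmf (poisson_pmf c)"
  let ?f = "\<lambda>n. ennreal (?p n) * (ennreal (real n) * h (n - 1))"
  have "ennreal (?p (Suc n)) * (ennreal (real (Suc n)) * h n) = ennreal c * (ennreal (?p n) * h n)" for n
  proof -
    have "?p (Suc n) * real (Suc n) = c * ?p n"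
      using c by (simp add: field_simps del: of_nat_Suc)
    then have "ennreal (?p (Suc n)) * ennreal (real (Suc n)) = ennreal c * ennreal (?p n)"
      using c by (simp add: ennreal_mult[symmetric] del: of_nat_Suc)
    then show ?thesis by (simp only: mult.assoc[symmetric])
  qed
  moreover have "(\<Sum>n. ?f n) = ?f 0 + (\<Sum>n. ?f (Suc n))"
    using suminf_offset[of ?f 1] by simp
  ultimately show ?thesis
    unfolding nn_integral_nat_pmf by (simp add: ennreal_suminf_cmult del: of_nat_Suc)
qed

text \<open>Repeated size biasing. It takes the \<open>2 k\<close> points of a matching out of a
  Poisson number, and the number of remaining points is again Poisson with the same mean.\<close>

lemma nn_integral_poisson_falling:
  fixes h :: "nat \<Rightarrow> ennreal"
  assumes c: "0 < c"
  shows "(\<integral>\<^sup>+n. ennreal (\<Prod>j<m. real (n - j)) * h (n - m) \<partial>measure_pmf (poisson_pmf c)) =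
    ennreal (c ^ m) * (\<integral>\<^sup>+n. h n \<partial>measure_pmf (poisson_pmf c))"
proof (induction m)
  case (Suc m)
  let ?H = "\<lambda>n. ennreal (\<Prod>j<m. real (n - j)) * h (n - m)"
  have "ennreal (\<Prod>j<Suc m. real (n - j)) * h (n - Suc m) = ennreal (real n) * ?H (n - 1)" for n
    by (simp only: prod.lessThan_Suc_shift) (simp add: ennreal_mult prod_nonneg mult.assoc)
  then have "(\<integral>\<^sup>+n. ennreal (\<Prod>j<Suc m. real (n - j)) * h (n - Suc m) \<partial>measure_pmf (poisson_pmf c)) =
      ennreal c * (\<integral>\<^sup>+n. ?H n \<partial>measure_pmf (poisson_pmf c))"
    using nn_integral_poisson_shift[OF c, of ?H] by simp
  then show ?case
    unfolding Suc using c by (simp add: ennreal_mult mult.assoc)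
qed simp

lemma nn_integral_poisson_factorial_moment:
  assumes c: "0 < c"
  shows "(\<integral>\<^sup>+n. ennreal (\<Prod>j<m. real (n - j)) \<partial>measure_pmf (poisson_pmf c)) = ennreal (c ^ m)"
  using nn_integral_poisson_falling[OF c, of m "\<lambda>_. 1"] by simp

lemma falling_2: "(\<Prod>j<2. real (n - j)) = real n * (real n - 1)"
  by (cases n) (simp_all add: numeral_2_eq_2)

lemma falling_3: "(\<Prod>j<3. real (n - j)) = real n * (real n - 1) * (real n - 2)"
proof -
  consider "n = 0" | "n = 1" | m where "n = Suc (Suc m)" by (metis One_nat_def not0_implies_Suc)
  then show ?thesis by cases (simp_all add: numeral_3_eq_3 algebra_simps)
qed

text \<open>\<open>n + n^3\<close> has coefficients 1, 3, 2 in falling factorials. This moment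
  integrates the relative error \<open>1 + k^2\<close>; the extra factor is the size of the
  configuration.\<close>

lemma nn_integral_poisson_cubic:
  assumes c: "0 < c"
  shows "(\<integral>\<^sup>+n. ennreal (real n * (1 + (real n)\<^sup>2)) \<partial>measure_pmf (poisson_pmf c)) = ennreal (c ^ 3 + 3 * c ^ 2 + 2 * c)"
proof -
  let ?f = "\<lambda>m n. ennreal (\<Prod>j<m. real (n - j))"
  have *: "ennreal (real n * (1 + (real n)\<^sup>2)) = ?f 3 n + 3 * ?f 2 n + 2 * ?f 1 n" for n
  proof -
    have 0: "0 \<le> (\<Prod>j<m. real (n - j))" for m by (auto intro: prod_nonneg)
    have "?f 3 n + 3 * ?f 2 n + 2 * ?f 1 n = ennreal ((\<Prod>j<3. real (n - j)) + 3 * (\<Prod>j<2. real (n - j)) + 2 * real n)"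
      using 0[of 3] 0[of 2] by (simp add: ennreal_mult)
    also have "(\<Prod>j<3. real (n - j)) + 3 * (\<Prod>j<2. real (n - j)) + 2 * real n = real n * (1 + (real n)\<^sup>2)"
      unfolding falling_2 falling_3 by (simp add: algebra_simps power2_eq_square)
    finally show ?thesis by simp
  qed
  have "(\<integral>\<^sup>+n. ennreal (real n * (1 + (real n)\<^sup>2)) \<partial>measure_pmf (poisson_pmf c)) =
     ennreal (c ^ 3) + 3 * ennreal (c ^ 2) + 2 * ennreal (c ^ 1)"
    by (simp only: * nn_integral_add nn_integral_cmult nn_integral_poisson_factorial_moment[OF c] measurable_pmf_measure1 UNIV_I Pi_UNIV space_borel)
  then show ?thesis using c by (simp add: ennreal_mult)
qed

lemma sum_arith: "(\<Sum>i<n. real (m + i)) = real n * (real n - 1) / 2 + real m * real n"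
  by (induction n) (simp_all add: field_simps)

text \<open>Stated in falling factorials, whose Poisson moments are explicit; the constants are
  generous.\<close>

lemma sum_squares_le: "(\<Sum>i<n. (real i)\<^sup>2) \<le> real n * (real n - 1) * (real n - 2) + real n * (real n - 1)"
proof (induction n)
  case (Suc n)
  have "0 \<le> real n * (2 * real n - 1)" by (cases n) simp_all
  then show ?case using Suc by (simp add: algebra_simps power2_eq_square)
qed simp

lemma le_add_imp_diff_le_ennreal:
  assumes "ennreal x \<le> G + ennreal y" "0 \<le> y"
  shows "ennreal (x - y) \<le> G"
proof (cases G)
  case (real g)
  then have "x \<le> g + y"
    using assms by (simp add: ennreal_le_iff flip: ennreal_plus)
  then show ?thesis using real by (simp add: ennreal_leI)
qed simp

context unit_volume
begin

text \<open>The avoidance probability is at least \<open>exp (- S)\<close> up to second order terms, where \<open>S\<close> is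
  quadratic in the number of points. Replacing \<open>exp (- S)\<close> by its tangent at \<open>l\<close> makes the bound
  linear in the factorial moments, so that the fluctuations of the Poisson variable cancel to first
  order.\<close>
lemma matching_weight_poisson_ge:
  assumes t: "1 \<le> t" and l: "0 < l" and b: "b = 2 * l / t\<^sup>2"
  shows "ennreal (l ^ k / fact k * (exp (- l) - (4 + 4 * l + 32 * l\<^sup>2) * (1 + (real k)\<^sup>2) / t))
    \<le> (\<integral>\<^sup>+n. ennreal (matching_weight b n k 1) \<partial>measure_pmf (poisson_pmf t))"
proof -
  have t0: "0 < t" using t by simp
  have b0: "0 \<le> b" using l by (simp add: b)
  define g where "g n = (\<Prod>i<n. max 0 (1 - real (2 * k + i) * b))" for n
  have g0: "0 \<le> g n" for n by (auto simp: g_def intro!: prod_nonneg)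
  let ?p = "measure_pmf (poisson_pmf t)"
  let ?f = "\<lambda>m n. \<Prod>j<m. real (n - j)"
  have f0: "0 \<le> ?f m n" for m n by (auto intro: prod_nonneg)
  have "(\<integral>\<^sup>+n. ennreal (matching_weight b n k 1) \<partial>?p) = (\<integral>\<^sup>+n. ennreal ((b / 2) ^ k / fact k) * (ennreal (?f (2 * k) n) * ennreal (g (n - 2 * k))) \<partial>?p)"
    by (intro nn_integral_cong)
      (simp only: matching_weight_def g_def[symmetric] ennreal_mult[symmetric] f0 g0 mult_nonneg_nonneg mult.assoc, simp add: b0 ennreal_mult[symmetric] f0 g0 mult.assoc)
  also have "\<dots> = ennreal ((b / 2) ^ k / fact k) * (ennreal (t ^ (2 * k)) * (\<integral>\<^sup>+n. ennreal (g n) \<partial>?p))"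
    using nn_integral_poisson_falling[OF t0, of "2 * k" "\<lambda>n. ennreal (g n)"] by (simp add: nn_integral_cmult)
  also have "\<dots> = ennreal ((b / 2) ^ k / fact k * t ^ (2 * k)) * (\<integral>\<^sup>+n. ennreal (g n) \<partial>?p)"
    using b0 t0 by (subst ennreal_mult[of _ "t ^ (2 * k)"]) (simp_all add: mult.assoc)
  also have "(b / 2) ^ k / fact k * t ^ (2 * k) = l ^ k / fact k"
    using t0 by (simp add: b power_divide power_mult)
  finally have mw: "(\<integral>\<^sup>+n. ennreal (matching_weight b n k 1) \<partial>?p) = ennreal (l ^ k / fact k) * (\<integral>\<^sup>+n. ennreal (g n) \<partial>?p)" .
  define c1 where "c1 = exp (- l) * b"
  \<comment> \<open>The correction to the tangent bound, sorted by falling factorials of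
    \<open>n\<close>. \<open>c1\<close> carries the slope of the tangent; the coefficients with
    \<open>b\<^sup>2\<close> come from the squares.\<close>
  define S where "S n = (c1 / 2 + 2 * b\<^sup>2) * ?f 2 n + (2 * real k * c1 + 8 * b\<^sup>2 * (real k)\<^sup>2) * ?f 1 n + 2 * b\<^sup>2 * ?f 3 n" for n
  have c10: "0 \<le> c1" using b0 by (simp add: c1_def)
  have pt: "exp (- l) * (1 + l) \<le> g n + S n" for n
  proof -
    let ?S1 = "\<Sum>i<n. real (2 * k + i) * b"
    let ?S2 = "\<Sum>i<n. (real (2 * k + i) * b)\<^sup>2"
    have "exp (- ?S1) - ?S2 \<le> g n"
      unfolding g_def using b0 by (intro prod_max_one_minus_ge_exp) auto
    moreover have "exp (- l) * (1 + (l - ?S1)) \<le> exp (- l) * exp (l - ?S1)"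
      by (intro mult_left_mono exp_ge_add_one_self) simp
    then have "exp (- l) * (1 + (l - ?S1)) \<le> exp (- ?S1)"
      by (simp flip: exp_add)
    moreover have "?S1 = (real n * (real n - 1) / 2 + 2 * real k * real n) * b"
      using sum_arith[where m = "2 * k" and n = n] by (simp add: sum_distrib_right[symmetric])
    moreover have "?S2 \<le> 2 * b\<^sup>2 * (real n * (real n - 1) * (real n - 2) + real n * (real n - 1)) + 8 * b\<^sup>2 * (real k)\<^sup>2 * real n"
    proof -
      have "(real (2 * k + i) * b)\<^sup>2 \<le> 2 * b\<^sup>2 * (real i)\<^sup>2 + 8 * b\<^sup>2 * (real k)\<^sup>2" for i
      proof -
        have "(2 * real k + real i)\<^sup>2 \<le> 2 * (real i)\<^sup>2 + 8 * (real k)\<^sup>2"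
          using sum_squares_bound[of "2 * real k" "real i"] by (simp add: power2_eq_square algebra_simps)
        then have "(2 * real k + real i)\<^sup>2 * b\<^sup>2 \<le> (2 * (real i)\<^sup>2 + 8 * (real k)\<^sup>2) * b\<^sup>2"
          by (rule mult_right_mono) simp
        also have "\<dots> = 2 * b\<^sup>2 * (real i)\<^sup>2 + 8 * b\<^sup>2 * (real k)\<^sup>2"
          by (simp add: algebra_simps)
        finally show ?thesis by (simp add: power_mult_distrib)
      qed
      then have "?S2 \<le> (\<Sum>i<n. 2 * b\<^sup>2 * (real i)\<^sup>2 + 8 * b\<^sup>2 * (real k)\<^sup>2)"
        by (intro sum_mono)
      also have "\<dots> = 2 * b\<^sup>2 * (\<Sum>i<n. (real i)\<^sup>2) + 8 * b\<^sup>2 * (real k)\<^sup>2 * real n"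
        by (simp add: sum.distrib sum_distrib_left)
      also have "\<dots> \<le> 2 * b\<^sup>2 * (real n * (real n - 1) * (real n - 2) + real n * (real n - 1)) + 8 * b\<^sup>2 * (real k)\<^sup>2 * real n"
        by (intro add_right_mono mult_left_mono sum_squares_le) simp
      finally show ?thesis .
    qed
    ultimately have "exp (- l) * (1 + l) \<le> g n + exp (- l) * ((real n * (real n - 1) / 2 + 2 * real k * real n) * b) +
        (2 * b\<^sup>2 * (real n * (real n - 1) * (real n - 2) + real n * (real n - 1)) + 8 * b\<^sup>2 * (real k)\<^sup>2 * real n)"
      by (simp add: algebra_simps)
    also have "\<dots> = g n + S n"
      unfolding S_def falling_2 falling_3 c1_def by (simp add: algebra_simps)
    finally show ?thesis .
  qed
  have "ennreal (exp (- l) * (1 + l)) = (\<integral>\<^sup>+n. ennreal (exp (- l) * (1 + l)) \<partial>?p)"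
    by simp
  also have "\<dots> \<le> (\<integral>\<^sup>+n. ennreal (g n) + (ennreal (c1 / 2 + 2 * b\<^sup>2) * ennreal (?f 2 n)
      + ennreal (2 * real k * c1 + 8 * b\<^sup>2 * (real k)\<^sup>2) * ennreal (?f 1 n) + ennreal (2 * b\<^sup>2) * ennreal (?f 3 n)) \<partial>?p)"
  proof (intro nn_integral_mono)
    fix n
    have "ennreal (exp (- l) * (1 + l)) \<le> ennreal (g n + S n)" by (intro ennreal_leI pt)
    also have "\<dots> = ennreal (g n) + (ennreal (c1 / 2 + 2 * b\<^sup>2) * ennreal (?f 2 n)
      + ennreal (2 * real k * c1 + 8 * b\<^sup>2 * (real k)\<^sup>2) * ennreal (?f 1 n) + ennreal (2 * b\<^sup>2) * ennreal (?f 3 n))"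
      using g0[of n] f0[of n 1] f0[of n 2] f0[of n 3] c10 unfolding S_def
      by (simp add: ennreal_mult[symmetric] ennreal_plus[symmetric] del: ennreal_plus)
    finally show "ennreal (exp (- l) * (1 + l)) \<le> \<dots>" .
  qed
  also have "\<dots> = (\<integral>\<^sup>+n. ennreal (g n) \<partial>?p) + (ennreal (c1 / 2 + 2 * b\<^sup>2) * ennreal (t ^ 2)
      + ennreal (2 * real k * c1 + 8 * b\<^sup>2 * (real k)\<^sup>2) * ennreal (t ^ 1) + ennreal (2 * b\<^sup>2) * ennreal (t ^ 3))"
    by (simp only: nn_integral_add nn_integral_cmult nn_integral_poisson_factorial_moment[OF t0] measurable_pmf_measure1 UNIV_I Pi_UNIV space_borel)
  also have "\<dots> = (\<integral>\<^sup>+n. ennreal (g n) \<partial>?p) + ennreal ((c1 / 2 + 2 * b\<^sup>2) * t ^ 2 + (2 * real k * c1 + 8 * b\<^sup>2 * (real k)\<^sup>2) * t + 2 * b\<^sup>2 * t ^ 3)"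
    using c10 t0 by (simp add: ennreal_mult[symmetric] ennreal_plus[symmetric] del: ennreal_plus)
  finally have "ennreal (exp (- l) * (1 + l) - ((c1 / 2 + 2 * b\<^sup>2) * t ^ 2 + (2 * real k * c1 + 8 * b\<^sup>2 * (real k)\<^sup>2) * t + 2 * b\<^sup>2 * t ^ 3)) \<le> (\<integral>\<^sup>+n. ennreal (g n) \<partial>?p)"
    by (rule le_add_imp_diff_le_ennreal) (use c10 t0 in \<open>auto intro!: add_nonneg_nonneg mult_nonneg_nonneg\<close>)
  moreover have "exp (- l) - (4 + 4 * l + 32 * l\<^sup>2) * (1 + (real k)\<^sup>2) / t \<le>
      exp (- l) * (1 + l) - ((c1 / 2 + 2 * b\<^sup>2) * t ^ 2 + (2 * real k * c1 + 8 * b\<^sup>2 * (real k)\<^sup>2) * t + 2 * b\<^sup>2 * t ^ 3)"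
  proof -
    \<comment> \<open>The first of these terms cancels the tangent term \<open>exp (- l) * l\<close>
      exactly; each of the others is at most of order \<open>(1 + k^2) / t\<close>.\<close>
    have e: "c1 / 2 * t ^ 2 = exp (- l) * l" "2 * real k * c1 * t = exp (- l) * (4 * real k * l / t)"
      "2 * b\<^sup>2 * t ^ 2 = 8 * l\<^sup>2 / t\<^sup>2" "8 * b\<^sup>2 * (real k)\<^sup>2 * t = 32 * l\<^sup>2 * (real k)\<^sup>2 / t ^ 3" "2 * b\<^sup>2 * t ^ 3 = 8 * l\<^sup>2 / t"
      using t0 by (simp_all add: c1_def b field_simps power2_eq_square power3_eq_cube)
    have k: "real k \<le> 1 + (real k)\<^sup>2"
      using sum_squares_bound[of 1 "real k"] by (simp add: power2_eq_square)
    have "exp (- l) * (4 * real k * l / t) \<le> 1 * (4 * real k * l / t)"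
      using l t0 by (intro mult_right_mono) auto
    also have "\<dots> \<le> 4 * l * (1 + (real k)\<^sup>2) / t"
      using k l t0 by (simp add: divide_right_mono mult.commute mult_left_mono)
    finally have 1: "exp (- l) * (4 * real k * l / t) \<le> 4 * l * (1 + (real k)\<^sup>2) / t" .
    have 2: "8 * l\<^sup>2 / t\<^sup>2 \<le> 8 * l\<^sup>2 / t"
      using t by (intro divide_left_mono) (auto simp: power2_eq_square)
    have 3: "32 * l\<^sup>2 * (real k)\<^sup>2 / t ^ 3 \<le> 32 * l\<^sup>2 * (real k)\<^sup>2 / t"
      using t by (intro divide_left_mono) (auto simp: power3_eq_cube mult_ge1_I)
    have 4: "8 * l\<^sup>2 / t + 8 * l\<^sup>2 / t + 32 * l\<^sup>2 * (real k)\<^sup>2 / t \<le> 32 * l\<^sup>2 * (1 + (real k)\<^sup>2) / t"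
      using t0 by (simp add: field_simps)
    have 5: "0 \<le> 4 * (1 + (real k)\<^sup>2) / t" using t0 by simp
    have "(c1 / 2 + 2 * b\<^sup>2) * t ^ 2 + (2 * real k * c1 + 8 * b\<^sup>2 * (real k)\<^sup>2) * t + 2 * b\<^sup>2 * t ^ 3 =
      exp (- l) * l + 8 * l\<^sup>2 / t\<^sup>2 + exp (- l) * (4 * real k * l / t) + 32 * l\<^sup>2 * (real k)\<^sup>2 / t ^ 3 + 8 * l\<^sup>2 / t"
      by (simp only: distrib_right e) 
    moreover have "(4 + 4 * l + 32 * l\<^sup>2) * (1 + (real k)\<^sup>2) / t = 4 * (1 + (real k)\<^sup>2) / t + 4 * l * (1 + (real k)\<^sup>2) / t + 32 * l\<^sup>2 * (1 + (real k)\<^sup>2) / t"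
      by (simp add: distrib_right add_divide_distrib)
    moreover have "exp (- l) * (1 + l) = exp (- l) + exp (- l) * l" by (simp add: distrib_left)
    ultimately show ?thesis using 1 2 3 4 5 by linarith
  qed
  ultimately have "ennreal (exp (- l) - (4 + 4 * l + 32 * l\<^sup>2) * (1 + (real k)\<^sup>2) / t) \<le> (\<integral>\<^sup>+n. ennreal (g n) \<partial>?p)"
    by (meson ennreal_leI order_trans)
  then show ?thesis
    unfolding mw using l by (subst ennreal_mult') (auto intro: mult_left_mono)
qed

text \<open>The constant is shared with the Poisson case. Its 4 pays here for the falling factorial
  of a fixed \<open>n\<close>, its \<open>4 * l\<close> pays there for the cross term between
  matched and other points, and \<open>32 * l^2\<close> covers the squares in both.\<close>

lemma matching_weight_binomial_ge:
  assumes t: "1 \<le> t" and l: "0 < l" and b: "b = 2 * l / t\<^sup>2" and n: "n = nat \<lceil>t\<rceil>"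
  shows "l ^ k / fact k * (exp (- l) - (4 + 4 * l + 32 * l\<^sup>2) * (1 + (real k)\<^sup>2) / t) \<le> matching_weight b n k 1"
proof -
  have t0: "0 < t" using t by simp
  have b0: "0 \<le> b" using l by (simp add: b)
  have nt: "t \<le> real n" "real n \<le> t + 1" "real n \<le> 2 * t"
    using t unfolding n by linarith+
  define g where "g = (\<Prod>i<n - 2 * k. max 0 (1 - real (2 * k + i) * b))"
  have g: "0 \<le> g" "g \<le> 1" using b0 by (auto simp: g_def intro!: prod_nonneg prod_le_1)
  \<comment> \<open>Powers of \<open>t\<close> turn \<open>b / 2\<close> into \<open>l\<close>;
    \<open>u\<close> is what remains of the number of ordered choices of the matched points.\<close>
  define u where "u = (\<Prod>j<2 * k. real (n - j) / t)"
  have "matching_weight b n k 1 = l ^ k / fact k * (u * g)"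
  proof -
    have "(b / 2) ^ k = l ^ k / t ^ (2 * k)" using t0 by (simp add: b power_divide power_mult)
    moreover have "(\<Prod>j<2 * k. real (n - j)) = u * t ^ (2 * k)"
      using t0 by (simp add: u_def prod_dividef)
    ultimately show ?thesis using t0 by (simp add: matching_weight_def g_def)
  qed
  moreover have "exp (- l) - (4 + 4 * l + 32 * l\<^sup>2) * (1 + (real k)\<^sup>2) / t \<le> u * g"
  proof -
    have "1 - 4 * (real k)\<^sup>2 / t \<le> 1 - (\<Sum>j<2 * k. real j / t)"
    proof -
      have "(\<Sum>j<2 * k. real j / t) \<le> (\<Sum>j<2 * k. real (2 * k) / t)"
        using t0 by (intro sum_mono divide_right_mono) auto
      also have "\<dots> = 4 * (real k)\<^sup>2 / t" by (simp add: power2_eq_square)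
      finally show ?thesis by simp
    qed
    also have "\<dots> \<le> (\<Prod>j<2 * k. max 0 (1 - real j / t))"
      using t0 by (intro prod_max_one_minus_ge) auto
    also have "\<dots> \<le> u"
      unfolding u_def
    proof (intro prod_mono conjI)
      fix j
      have "1 - real j / t = (t - real j) / t" using t0 by (simp add: field_simps)
      also have "\<dots> \<le> real (n - j) / t" using nt t0 by (intro divide_right_mono) auto
      finally show "max 0 (1 - real j / t) \<le> real (n - j) / t" using t0 by simp
    qed simp
    finally have u: "1 - 4 * (real k)\<^sup>2 / t \<le> u" .
    have u0: "0 \<le> u" using t0 by (auto simp: u_def intro!: prod_nonneg)
    \<comment> \<open>\<open>n\<close> may exceed \<open>t\<close>, so \<open>u\<close> may exceed
      1; then the bound is immediate.\<close>
    have ug: "g - 4 * (real k)\<^sup>2 / t \<le> u * g"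
    proof (cases "u \<le> 1")
      case True
      have "(1 - u) * g \<le> 1 - u" using True g by (simp add: mult_left_le)
      then show ?thesis using u by (simp add: algebra_simps)
    next
      case False
      then have "1 * g \<le> u * g" using g by (intro mult_right_mono) auto
      moreover have "0 \<le> 4 * (real k)\<^sup>2 / t" using t0 by simp
      ultimately show ?thesis by linarith
    qed
    let ?S1 = "\<Sum>i<n - 2 * k. real (2 * k + i) * b"
    let ?S2 = "\<Sum>i<n - 2 * k. (real (2 * k + i) * b)\<^sup>2"
    have 1: "exp (- ?S1) - ?S2 \<le> g"
      unfolding g_def using b0 by (intro prod_max_one_minus_ge_exp) auto
    \<comment> \<open>Shifted by \<open>2 k\<close>, this is a part of the sum over all
      \<open>j < n\<close>; with \<open>n \<le> t + 1\<close> the full sum exceeds \<open>l\<close>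
      by at most \<open>l / t\<close>.\<close>
    have "?S1 = (\<Sum>j\<in>(\<lambda>i. 2 * k + i) ` {..<n - 2 * k}. real j * b)"
      by (subst sum.reindex) (auto simp: inj_on_def)
    also have "\<dots> \<le> (\<Sum>j<n. real j * b)"
      using b0 by (intro sum_mono2) auto
    also have "\<dots> = real n * (real n - 1) / 2 * b"
      using sum_arith[where m = 0 and n = n] by (simp add: sum_distrib_right[symmetric])
    also have "\<dots> \<le> (t + 1) * t / 2 * b"
      using nt t b0 by (intro mult_right_mono divide_right_mono mult_mono) auto
    also have "\<dots> = l + l / t"
      using t0 by (simp add: b field_simps power2_eq_square)
    finally have "?S1 \<le> l + l / t" .
    then have "exp (- (l + l / t)) \<le> exp (- ?S1)" by simp
    moreover have "exp (- l) - l / t \<le> exp (- (l + l / t))"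
    proof -
      have "exp (- l) * (1 + - (l / t)) \<le> exp (- l) * exp (- (l / t))"
        by (intro mult_left_mono exp_ge_add_one_self) simp
      moreover have "exp (- l) * (l / t) \<le> 1 * (l / t)"
        using l t0 by (intro mult_right_mono) auto
      ultimately show ?thesis by (simp add: exp_add[symmetric] algebra_simps)
    qed
    ultimately have 2: "exp (- l) - l / t \<le> exp (- ?S1)" by linarith
    have "?S2 \<le> (\<Sum>i<n - 2 * k. (real n * b)\<^sup>2)"
      using b0 by (intro sum_mono power_mono mult_right_mono) auto
    also have "\<dots> \<le> real n * (real n * b)\<^sup>2"
      by (simp add: mult_right_mono)
    also have "\<dots> \<le> (2 * t) * (2 * t * b)\<^sup>2"
      using nt b0 t0 by (intro mult_mono power_mono) auto
    also have "\<dots> = 32 * l\<^sup>2 / t"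
      using t0 by (simp add: b field_simps power2_eq_square)
    finally have 3: "?S2 \<le> 32 * l\<^sup>2 / t" .
    have "exp (- l) - l / t - 32 * l\<^sup>2 / t - 4 * (real k)\<^sup>2 / t \<le> u * g"
      using ug 1 2 3 by linarith
    moreover have "l / t + 32 * l\<^sup>2 / t + 4 * (real k)\<^sup>2 / t \<le> (4 + 4 * l + 32 * l\<^sup>2) * (1 + (real k)\<^sup>2) / t"
    proof -
      have "0 \<le> l * (real k)\<^sup>2" "0 \<le> l\<^sup>2 * (real k)\<^sup>2" using l by auto
      then have "l + 32 * l\<^sup>2 + 4 * (real k)\<^sup>2 \<le> (4 + 4 * l + 32 * l\<^sup>2) * (1 + (real k)\<^sup>2)"
        using l by (simp add: algebra_simps)
      then show ?thesis using t0 by (simp add: divide_right_mono flip: add_divide_distrib)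
    qed
    ultimately show ?thesis by linarith
  qed
  ultimately show ?thesis using l by (simp only:) (intro mult_left_mono, simp_all)
qed

end

section \<open>Boundary effect and rate of convergence\<close>

text \<open>If \<open>K\<close> contains the ball of radius \<open>\<rho>\<close> around \<open>p\<close>, then by convexity the homothetic image
  of \<open>K\<close> with center \<open>p\<close> and ratio \<open>1 - s / \<rho>\<close> lies in the erosion of \<open>K\<close> by \<open>s\<close>.\<close>
lemma erosion_volume_ge:
  fixes K :: "'a::euclidean_space set"
  assumes K: "compact K" "convex K" "measure lborel K = 1"
  obtains D where "0 < D"
    "\<And>s. 0 < s \<Longrightarrow> {z. cball z s \<subseteq> K} \<in> sets borel \<and> 1 - D * s \<le> measure lborel {z. cball z s \<subseteq> K}"
proof -
  have Kb: "K \<in> sets borel" using K(1) by (simp add: borel_compact)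
  have fin: "emeasure lborel K < \<infinity>" using K(1) by (rule emeasure_compact_finite)
  have "interior K \<noteq> {}"
  proof
    assume "interior K = {}"
    then have "negligible K" using K(2) by (simp add: negligible_convex_interior)
    then have "measure lebesgue K = 0" by (simp add: negligible_imp_measure0)
    then show False using K(3) Kb by (simp add: measure_completion)
  qed
  then obtain p where "p \<in> interior K" by blast
  then obtain \<rho> where \<rho>: "0 < \<rho>" "cball p \<rho> \<subseteq> K"
    by (meson mem_interior_cball)
  let ?d = "real DIM('a)"
  have "{z. cball z s \<subseteq> K} \<in> sets borel \<and> 1 - ?d / \<rho> * s \<le> measure lborel {z. cball z s \<subseteq> K}" if s: "0 < s" for s
  proof
    let ?E = "{z. cball z s \<subseteq> K}"
    \<comment> \<open>An intersection of translates of the closed set \<open>K\<close> is closed,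
      hence Borel.\<close>
    have "?E = (\<Inter>h\<in>cball 0 s. (\<lambda>z. z + h) -` K)"
    proof (intro equalityI subsetI)
      fix z assume z: "z \<in> ?E"
      have "z + h \<in> cball z s" if "h \<in> cball 0 s" for h using that by (simp add: dist_norm)
      with z show "z \<in> (\<Inter>h\<in>cball 0 s. (\<lambda>z. z + h) -` K)" by auto
    next
      fix z assume z: "z \<in> (\<Inter>h\<in>cball 0 s. (\<lambda>z. z + h) -` K)"
      have "u \<in> K" if "u \<in> cball z s" for u
      proof -
        have "u - z \<in> cball 0 s" using that by (simp add: dist_norm norm_minus_commute)
        with z have "z + (u - z) \<in> K" by blast
        then show ?thesis by simp
      qed
      then show "z \<in> ?E" by auto
    qed
    moreover have "closed (\<Inter>h\<in>cball 0 s. (\<lambda>z. z + h) -` K)"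
      using compact_imp_closed[OF K(1)] by (intro closed_INT ballI continuous_closed_vimage continuous_intros)
    ultimately show E: "?E \<in> sets borel" by simp
    have "?E \<subseteq> K" using s by (auto simp: subset_iff)
    then have finE: "emeasure lborel ?E < \<infinity>"
      using Kb fin emeasure_mono[of ?E K lborel] by (simp add: order.strict_trans1)
    define \<epsilon> where "\<epsilon> = s / \<rho>"
    have \<epsilon>: "0 < \<epsilon>" using s \<rho> by (simp add: \<epsilon>_def)
    show "1 - ?d / \<rho> * s \<le> measure lborel ?E"
    proof (cases "\<epsilon> < 1")
      \<comment> \<open>Here \<open>s \<ge> \<rho>\<close>, and the claimed lower bound is not
        positive because the dimension is at least 1.\<close>
      case False
      have "1 \<le> ?d" using DIM_positive[where 'a = 'a] by (simp add: Suc_leI)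
      then have "1 * 1 \<le> ?d * \<epsilon>" using False by (intro mult_mono) auto
      then have "1 - ?d / \<rho> * s \<le> 0" by (simp add: \<epsilon>_def)
      then show ?thesis by (meson measure_nonneg order_trans)
    next
      case True
      define T where "T x = \<epsilon> *\<^sub>R p + (1 - \<epsilon>) *\<^sub>R x" for x
      have T [measurable]: "T \<in> borel_measurable borel" unfolding T_def by measurable
      have KT: "K \<subseteq> T -` ?E"
      proof (safe, unfold vimage_eq mem_Collect_eq, safe)
        fix x u assume x: "x \<in> K" and u: "u \<in> cball (T x) s"
        \<comment> \<open>Solves \<open>\<epsilon> q + (1 - \<epsilon>) x = u\<close>. Scaling by
          \<open>1 / \<epsilon> = \<rho> / s\<close> takes radius \<open>s\<close> to radius
          \<open>\<rho>\<close>, so \<open>q \<in> K\<close>.\<close>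
        define q where "q = p + (1 / \<epsilon>) *\<^sub>R (u - T x)"
        have "norm (u - T x) \<le> s" using u by (simp add: dist_norm norm_minus_commute)
        then have "(1 / \<epsilon>) * norm (u - T x) \<le> (1 / \<epsilon>) * s"
          using \<epsilon> by (intro mult_left_mono) simp_all
        then have "norm ((1 / \<epsilon>) *\<^sub>R (u - T x)) \<le> \<rho>"
          using \<epsilon> s \<rho> by (simp only: norm_scaleR) (simp add: \<epsilon>_def)
        then have "q \<in> K" using \<rho> by (auto simp: q_def dist_norm)
        then have "\<epsilon> *\<^sub>R q + (1 - \<epsilon>) *\<^sub>R x \<in> K"
          using K(2) x \<epsilon> True by (intro convexD) auto
        moreover have "\<epsilon> *\<^sub>R q + (1 - \<epsilon>) *\<^sub>R x = u"
          using \<epsilon> by (simp add: q_def scaleR_add_right T_def)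
        ultimately show "u \<in> K" by simp
      qed
      \<comment> \<open>Bernoulli's inequality linearizes the volume factor of the homothety; this
        is where \<open>D = d / \<rho>\<close> comes from.\<close>
      have "1 - ?d / \<rho> * s = 1 + ?d * (- \<epsilon>)" by (simp add: \<epsilon>_def)
      also have "\<dots> \<le> (1 + - \<epsilon>) ^ DIM('a)"
        using True by (intro Bernoulli_inequality) simp
      finally have Bern: "1 - ?d / \<rho> * s \<le> (1 - \<epsilon>) ^ DIM('a)" by simp
      have "emeasure lborel ?E = emeasure (density (distr lborel borel T) (\<lambda>_. \<bar>1 - \<epsilon>\<bar> ^ DIM('a))) ?E"
        using True lborel_affine[of "1 - \<epsilon>" "\<epsilon> *\<^sub>R p"] by (simp add: T_def[abs_def])
      also have "\<dots> = ennreal ((1 - \<epsilon>) ^ DIM('a)) * emeasure lborel (T -` ?E)"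
        using E True by (simp add: emeasure_density_const emeasure_distr)
      also have "\<dots> \<ge> ennreal ((1 - \<epsilon>) ^ DIM('a)) * emeasure lborel K"
        using E KT measurable_sets[OF T E] by (intro mult_left_mono emeasure_mono) simp_all
      finally have "ennreal ((1 - \<epsilon>) ^ DIM('a)) * emeasure lborel K \<le> emeasure lborel ?E" .
      moreover have "emeasure lborel K = 1" using K(3) fin by (simp add: emeasure_eq_ennreal_measure)
      ultimately have "(1 - \<epsilon>) ^ DIM('a) \<le> measure lborel ?E"
        using finE by (simp add: emeasure_eq_ennreal_measure)
      then show ?thesis using Bern by linarith
    qed
  qed
  moreover have "0 < ?d / \<rho>" using \<rho> by simp
  ultimately show ?thesis using that by blast
qed

context unit_volume
begin

lemma nn_integral_density_mixed:
  assumes "f \<in> borel_measurable conf_space" "g \<in> borel_measurable conf_space"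
  shows "(\<integral>\<^sup>+\<omega>. g \<omega> \<partial>density (mixed p) f) = (\<integral>\<^sup>+k. \<integral>\<^sup>+\<omega>. f \<omega> * g \<omega> \<partial>B k \<partial>measure_pmf p)"
  using assms by (subst nn_integral_density) (simp_all add: nn_integral_mixed)

lemma nn_integral_B_size:
  assumes "\<And>k. g k \<in> borel_measurable conf_space"
  shows "(\<integral>\<^sup>+\<omega>. g (size \<omega>) \<omega> \<partial>B k) = (\<integral>\<^sup>+\<omega>. g k \<omega> \<partial>B k)"
  by (rule nn_integral_cong_AE) (use AE_B_size[of k] in eventually_elim, simp)

text \<open>The common part is the Poisson law with density \<open>\<rho> |\<omega>|\<close>, restricted to configurations
  in \<open>V\<close> without points at distance at most \<open>2 r\<close>.\<close>
lemma dKR_xi_map_mixed_le: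
  fixes \<rho> :: "nat \<Rightarrow> real"
  assumes l: "0 < l" and r: "0 \<le> r" and e: "0 \<le> e" "0 \<le> e'"
    and \<rho>: "\<And>k. 0 \<le> \<rho> k" "\<And>k. \<rho> k \<le> 1"
    and V: "V \<in> sets borel" "\<And>z. z \<in> V \<Longrightarrow> cball z (r / 2) \<subseteq> K"
    and moment: "(\<integral>\<^sup>+n. of_nat (n * (n - 1)) \<partial>measure_pmf p) * ennreal (measure lborel (cball (0::'a) r) / 2) \<le> ennreal l + ennreal e"
    and weight: "\<And>k. ennreal (l ^ k / fact k * exp (- l) * \<rho> k) \<le>
      (\<integral>\<^sup>+n. ennreal (matching_weight (measure lborel (cball (0::'a) r)) n k 1) \<partial>measure_pmf p)"
    and good: "\<And>k. 1 - e' * (1 + (real k)\<^sup>2) \<le>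
      \<rho> k * (\<Prod>i<k. max 0 (measure lborel V - real i * measure lborel (cball (0::'a) (2 * r))))"
  shows "dKR (distr (mixed p) conf_space (xi_map r)) (mixed (poisson_pmf l)) \<le> ennreal (e + 2 * (e' * (l ^ 3 + 3 * l ^ 2 + 2 * l)))"
proof -
  let ?P = "distr (mixed p) conf_space (xi_map r)" and ?Q = "mixed (poisson_pmf l)"
  let ?mw = "matching_weight (measure lborel (cball (0::'a) r))"
  note [measurable] = V(1) measurable_xi_map
  have VK: "V \<subseteq> K" using V(2) r by force
  define G where "G = isolated (2 * r) V"
  have [measurable]: "G \<in> sets conf_space" by (simp add: G_def isolated_sets V)
  define f where "f \<omega> = ennreal (\<rho> (size \<omega>)) * indicator G \<omega>" for \<omega> :: "'a multiset"
  have [measurable]: "f \<in> borel_measurable conf_space"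
    unfolding f_def by measurable
  define R where "R = density ?Q f"
  have f1: "f \<omega> \<le> 1" for \<omega>
    using \<rho>(2)[of "size \<omega>"] by (auto simp: f_def indicator_def)
  have fg: "(\<integral>\<^sup>+\<omega>. f \<omega> * g \<omega> \<partial>B k) = ennreal (\<rho> k) * (\<integral>\<^sup>+\<omega>. indicator G \<omega> * g \<omega> \<partial>B k)"
    if [measurable]: "g \<in> borel_measurable conf_space" for g k
  proof -
    have "(\<integral>\<^sup>+\<omega>. f \<omega> * g \<omega> \<partial>B k) = (\<integral>\<^sup>+\<omega>. ennreal (\<rho> k) * (indicator G \<omega> * g \<omega>) \<partial>B k)"
      unfolding f_def mult.assoc by (rule nn_integral_B_size) measurable
    then show ?thesis by (simp add: nn_integral_cmult)
  qed
  have pois: "pmf (poisson_pmf l) k = l ^ k / fact k * exp (- l)" for k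
    using l by simp
  have emeasure_R: "emeasure R A = (\<Sum>k. ennreal (pmf (poisson_pmf l) k * \<rho> k) * (\<integral>\<^sup>+\<omega>. indicator G \<omega> * indicator A \<omega> \<partial>B k))"
    if [measurable]: "A \<in> sets conf_space" for A
  proof -
    have "emeasure R A = (\<integral>\<^sup>+\<omega>. indicator A \<omega> \<partial>R)"
      by (simp add: R_def)
    also have "\<dots> = (\<integral>\<^sup>+k. ennreal (\<rho> k) * (\<integral>\<^sup>+\<omega>. indicator G \<omega> * indicator A \<omega> \<partial>B k) \<partial>measure_pmf (poisson_pmf l))"
      unfolding R_def by (subst nn_integral_density_mixed) (simp_all add: fg)
    finally show ?thesis
      using \<rho> l by (simp add: nn_integral_nat_pmf ennreal_mult mult.assoc del: pmf_poisson)
  qed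
  show ?thesis
  proof (rule dKR_le_common_part)
    show "prob_space ?P"
      by (rule prob_space.prob_space_distr[OF prob_space_mixed]) measurable
    show "prob_space ?Q" by (rule prob_space_mixed)
    show "emeasure R A \<le> emeasure ?Q A" if A [measurable]: "A \<in> sets conf_space" for A
    proof -
      have "emeasure R A = (\<integral>\<^sup>+\<omega>. f \<omega> * indicator A \<omega> \<partial>?Q)"
        unfolding R_def by (rule emeasure_density) simp_all
      also have "\<dots> \<le> (\<integral>\<^sup>+\<omega>. 1 * indicator A \<omega> \<partial>?Q)"
        by (intro nn_integral_mono mult_right_mono f1) simp
      finally show ?thesis by simp
    qed
    show "emeasure R A \<le> emeasure ?P A" if A [measurable]: "A \<in> sets conf_space" for A
    proof -
      let ?J = "\<lambda>k. \<integral>\<^sup>+\<omega>. indicator G \<omega> * indicator A \<omega> \<partial>B k"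
      \<comment> \<open>Different numbers of edges are disjoint events, so the lower bounds for all
        \<open>k\<close> may be added.\<close>
      have "(\<Sum>k. ennreal (?mw n k 1) * ?J k) \<le> emeasure (B n) (xi_map r -` A)" for n
      proof -
        let ?S = "\<lambda>k. {\<omega>. size (xi_map r \<omega>) = k \<and> set_mset \<omega> \<subseteq> K}"
        have [measurable]: "?S k \<in> sets conf_space" for k
        proof -
          have "Measurable.pred conf_space (\<lambda>\<omega>. size (xi_map r \<omega>) = k \<and> set_mset \<omega> \<subseteq> K)"
            by measurable
          then show ?thesis by (simp add: pred_def)
        qed
        have "ennreal (?mw n k 1) * ?J k \<le> (\<integral>\<^sup>+\<omega>. indicator (?S k) \<omega> * indicator A (xi_map r \<omega>) \<partial>B n)" for k
          using nn_integral_matching_le[of "indicator A" r K V n k] r V emeasure_K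
          by (simp add: G_def measure_def)
        then have "(\<Sum>k. ennreal (?mw n k 1) * ?J k) \<le> (\<Sum>k. \<integral>\<^sup>+\<omega>. indicator (?S k) \<omega> * indicator A (xi_map r \<omega>) \<partial>B n)"
          by (intro suminf_le) simp_all
        also have "\<dots> = (\<integral>\<^sup>+\<omega>. (\<Sum>k. indicator (?S k) \<omega> * indicator A (xi_map r \<omega>)) \<partial>B n)"
          by (intro nn_integral_suminf[symmetric]) measurable
        also have "\<dots> \<le> (\<integral>\<^sup>+\<omega>. indicator (xi_map r -` A) \<omega> \<partial>B n)"
        proof (intro nn_integral_mono)
          fix \<omega>
          have "(\<Sum>k. indicator (?S k) \<omega> * indicator A (xi_map r \<omega>) :: ennreal) =
              (\<Sum>k\<in>{size (xi_map r \<omega>)}. indicator (?S k) \<omega> * indicator A (xi_map r \<omega>))"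
            by (intro suminf_finite) auto
          then show "(\<Sum>k. indicator (?S k) \<omega> * indicator A (xi_map r \<omega>)) \<le> (indicator (xi_map r -` A) \<omega> :: ennreal)"
            by (auto simp: indicator_def)
        qed
        also have "\<dots> = emeasure (B n) (xi_map r -` A)"
          using measurable_sets[OF measurable_xi_map A, of r] by simp
        finally show ?thesis .
      qed
      then have "(\<integral>\<^sup>+n. (\<Sum>k. ennreal (?mw n k 1) * ?J k) \<partial>measure_pmf p) \<le> (\<integral>\<^sup>+n. emeasure (B n) (xi_map r -` A) \<partial>measure_pmf p)"
        by (intro nn_integral_mono)
      also have "\<dots> = emeasure ?P A"
        using measurable_sets[OF measurable_xi_map A, of r] by (simp add: emeasure_distr emeasure_mixed)
      finally have "(\<Sum>k. (\<integral>\<^sup>+n. ennreal (?mw n k 1) \<partial>measure_pmf p) * ?J k) \<le> emeasure ?P A"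
        by (simp add: nn_integral_suminf nn_integral_multc)
      moreover have "emeasure R A \<le> (\<Sum>k. (\<integral>\<^sup>+n. ennreal (?mw n k 1) \<partial>measure_pmf p) * ?J k)"
        unfolding emeasure_R[OF A] pois by (intro suminf_le mult_right_mono weight) simp_all
      ultimately show ?thesis by (rule order_trans[rotated])
    qed
    show "(\<integral>\<^sup>+\<omega>. of_nat (size \<omega>) \<partial>?P) \<le> ennreal l + ennreal e"
    proof -
      have "(\<integral>\<^sup>+\<omega>. of_nat (size \<omega>) \<partial>?P) = (\<integral>\<^sup>+n. \<integral>\<^sup>+\<omega>. of_nat (size (xi_map r \<omega>)) \<partial>B n \<partial>measure_pmf p)"
        by (subst nn_integral_distr) (simp_all add: nn_integral_mixed)
      also have "\<dots> \<le> (\<integral>\<^sup>+n. of_nat (n * (n - 1)) * ennreal (measure lborel (cball (0::'a) r) / 2) \<partial>measure_pmf p)"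
        by (intro nn_integral_mono nn_integral_size_xi_map_le)
      also have "\<dots> = (\<integral>\<^sup>+n. of_nat (n * (n - 1)) \<partial>measure_pmf p) * ennreal (measure lborel (cball (0::'a) r) / 2)"
        by (rule nn_integral_multc) simp
      also note moment
      finally show ?thesis .
    qed
    have mean: "(\<integral>\<^sup>+k. of_nat k \<partial>measure_pmf (poisson_pmf l)) = ennreal l"
      using nn_integral_poisson_factorial_moment[OF l, of 1] by (simp add: ennreal_of_nat_eq_real_of_nat)
    show "(\<integral>\<^sup>+\<omega>. of_nat (size \<omega>) \<partial>?Q) \<le> ennreal l"
    proof -
      have "(\<integral>\<^sup>+\<omega>. of_nat (size \<omega>) \<partial>B k) = of_nat k" for k
        using nn_integral_B_size[of "\<lambda>k _. of_nat k" k] B.emeasure_space_1[of k] by simp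
      then show ?thesis by (simp add: nn_integral_mixed mean)
    qed
    show "ennreal l \<le> (\<integral>\<^sup>+\<omega>. of_nat (size \<omega>) \<partial>R) + ennreal (e' * (l ^ 3 + 3 * l ^ 2 + 2 * l))"
    proof -
      have R: "(\<integral>\<^sup>+\<omega>. of_nat (size \<omega>) \<partial>R) = (\<integral>\<^sup>+k. ennreal (\<rho> k) * (of_nat k * emeasure (B k) G) \<partial>measure_pmf (poisson_pmf l))"
      proof -
        have "(\<integral>\<^sup>+\<omega>. indicator G \<omega> * of_nat (size \<omega>) \<partial>B k) = of_nat k * emeasure (B k) G" for k
          using nn_integral_B_size[of "\<lambda>k \<omega>. of_nat k * indicator G \<omega>" k]
          by (simp add: nn_integral_cmult mult.commute[of "indicator G _"])
        then show ?thesis unfolding R_def by (subst nn_integral_density_mixed) (simp_all add: fg)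
      qed
      \<comment> \<open>The estimate \<open>good\<close> multiplied by \<open>k\<close>, since a
        configuration missing from \<open>R\<close> costs its size.\<close>
      have pt: "of_nat k \<le> ennreal (\<rho> k) * (of_nat k * emeasure (B k) G) + ennreal e' * ennreal (real k * (1 + (real k)\<^sup>2))" for k
      proof -
        let ?g = "\<Prod>i<k. max 0 (measure lborel V - real i * measure lborel (cball (0::'a) (2 * r)))"
        have g0: "0 \<le> ?g" by (auto intro!: prod_nonneg)
        have "real k * 1 \<le> real k * (\<rho> k * ?g + e' * (1 + (real k)\<^sup>2))"
          using good[of k] by (intro mult_left_mono) simp_all
        then have "ennreal (real k) \<le> ennreal (real k * (\<rho> k * ?g + e' * (1 + (real k)\<^sup>2)))"
          by (intro ennreal_leI) simp
        also have "\<dots> = ennreal (\<rho> k) * (ennreal (real k) * ennreal ?g) + ennreal e' * ennreal (real k * (1 + (real k)\<^sup>2))"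
          using \<rho> e g0 by (simp add: ennreal_mult[symmetric] ennreal_plus[symmetric] algebra_simps del: ennreal_plus)
        also have "\<dots> \<le> ennreal (\<rho> k) * (ennreal (real k) * emeasure (B k) G) + ennreal e' * ennreal (real k * (1 + (real k)\<^sup>2))"
          unfolding G_def by (intro add_right_mono mult_left_mono emeasure_isolated_ge V VK) simp_all
        finally show ?thesis by (simp add: ennreal_of_nat_eq_real_of_nat)
      qed
      have "ennreal l \<le> (\<integral>\<^sup>+k. ennreal (\<rho> k) * (of_nat k * emeasure (B k) G) + ennreal e' * ennreal (real k * (1 + (real k)\<^sup>2)) \<partial>measure_pmf (poisson_pmf l))"
        unfolding mean[symmetric] by (intro nn_integral_mono pt)
      also have "\<dots> = (\<integral>\<^sup>+\<omega>. of_nat (size \<omega>) \<partial>R) + ennreal e' * (\<integral>\<^sup>+k. ennreal (real k * (1 + (real k)\<^sup>2)) \<partial>measure_pmf (poisson_pmf l))"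
        unfolding R by (simp add: nn_integral_add nn_integral_cmult)
      also have "\<dots> = (\<integral>\<^sup>+\<omega>. of_nat (size \<omega>) \<partial>R) + ennreal (e' * (l ^ 3 + 3 * l ^ 2 + 2 * l))"
        using e l by (simp only: nn_integral_poisson_cubic[OF l]) (subst ennreal_mult, simp_all)
      finally show ?thesis .
    qed
  qed (use e l in \<open>simp_all add: R_def\<close>)
qed

text \<open>Parameters: \<open>V\<close> is \<open>K\<close> eroded by \<open>r / 2\<close>,
  \<open>e = l / t\<close>, and \<open>e'\<close> is a multiple of \<open>t^(-min(2/d, 1))\<close>.
  It collects the error of the weights, of order \<open>1 / t\<close>, the boundary loss, of order
  \<open>r\<close>, and the hard core of the midpoints, of order \<open>1 / t^2\<close>.\<close>

lemma dKR_xi_map_mixed_rate: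
  fixes a t D :: real and p :: "nat pmf"
  defines "d \<equiv> DIM('a)"
  defines "l \<equiv> kappa TYPE('a) / 2 * a ^ d"
  defines "r \<equiv> t powr (- 2 / real d) * a"
  assumes a: "0 < a" and t: "1 \<le> t" and D: "0 < D"
    and erosion: "\<And>s. 0 < s \<Longrightarrow> {z. cball z s \<subseteq> K} \<in> sets borel \<and> 1 - D * s \<le> measure lborel {z. cball z s \<subseteq> K}"
    and moment: "(\<integral>\<^sup>+n. of_nat (n * (n - 1)) \<partial>measure_pmf p) * ennreal (l / t\<^sup>2) \<le> ennreal l + ennreal (l / t)"
    and weight: "\<And>k. ennreal (l ^ k / fact k * (exp (- l) - (4 + 4 * l + 32 * l\<^sup>2) * (1 + (real k)\<^sup>2) / t)) \<le>
      (\<integral>\<^sup>+n. ennreal (matching_weight (2 * l / t\<^sup>2) n k 1) \<partial>measure_pmf p)"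
  shows "dKR (distr (mixed p) conf_space (xi_map r)) (mixed (poisson_pmf l)) \<le>
    ennreal ((l + 2 * (exp l * (4 + 4 * l + 32 * l\<^sup>2) + D * a / 2 + 2 ^ d * (2 * l)) * (l ^ 3 + 3 * l ^ 2 + 2 * l)) * t powr (- min (2 / real d) 1))"
proof -
  define \<epsilon> where "\<epsilon> = t powr (- min (2 / real d) 1)"
  define E where "E = exp l * (4 + 4 * l + 32 * l\<^sup>2) + D * a / 2 + 2 ^ d * (2 * l)"
  have t0: "0 < t" using t by simp
  have d0: "0 < d" by (simp add: d_def)
  have kappa: "kappa TYPE('a) = unit_ball_vol (real d)"
    using content_ball[of 1 "0 :: 'a"] by (simp add: kappa_def d_def)
  have l0: "0 < l" using a by (simp add: l_def kappa unit_ball_vol_pos)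
  have r0: "0 < r" using a t0 by (simp add: r_def)
  have rd: "r ^ d = a ^ d / t\<^sup>2"
  proof -
    have "(t powr (- 2 / real d)) ^ d = t powr (real d * (- 2 / real d))"
      using t0 by (simp add: powr_powr powr_realpow[symmetric] mult.commute)
    also have "\<dots> = 1 / t\<^sup>2" using d0 t0 by (simp add: powr_minus divide_simps)
    finally show ?thesis by (simp add: r_def power_mult_distrib)
  qed
  have ball: "measure lborel (cball (0::'a) r) = 2 * l / t\<^sup>2"
    using content_cball[of r "0::'a"] r0 rd by (simp add: d_def[symmetric] l_def kappa)
  have ball2: "measure lborel (cball (0::'a) (2 * r)) = 2 ^ d * (2 * l) / t\<^sup>2"
    using content_cball[of "2 * r" "0::'a"] r0 rd by (simp add: d_def[symmetric] l_def kappa power_mult_distrib)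
  have \<epsilon>: "0 < \<epsilon>" using t0 by (simp add: \<epsilon>_def)
  have t1: "1 / t \<le> \<epsilon>"
  proof -
    have "1 / t = t powr (- 1)" using t0 by (simp add: powr_minus_divide)
    also have "\<dots> \<le> \<epsilon>" unfolding \<epsilon>_def using t by (intro powr_mono) auto
    finally show ?thesis .
  qed
  have t2: "1 / t\<^sup>2 \<le> \<epsilon>"
  proof -
    have "1 / t\<^sup>2 \<le> 1 / t" using t by (intro divide_left_mono) (auto simp: power2_eq_square)
    with t1 show ?thesis by linarith
  qed
  have r\<epsilon>: "r \<le> a * \<epsilon>"
  proof -
    have "t powr (- 2 / real d) \<le> \<epsilon>" unfolding \<epsilon>_def using t by (intro powr_mono) auto
    then show ?thesis using a by (simp add: r_def mult.commute)
  qed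
  define V where "V = {z. cball z (r / 2) \<subseteq> K}"
  have V: "V \<in> sets borel" "1 - D * (r / 2) \<le> measure lborel V"
    using erosion[of "r / 2"] r0 by (simp_all add: V_def)
  have V1: "measure lborel V \<le> 1"
  proof -
    have "V \<subseteq> K" using r0 by (auto simp: V_def subset_iff)
    then have "emeasure lborel V \<le> 1" using emeasure_mono[of V K lborel] emeasure_K by simp
    then show ?thesis by (simp add: measure_def enn2real_leI)
  qed
  \<comment> \<open>The factor \<open>exp l\<close> turns the absolute error of the weights into one
    relative to \<open>exp (- l)\<close>.\<close>
  define y where "y k = exp l * (4 + 4 * l + 32 * l\<^sup>2) * (1 + (real k)\<^sup>2) / t" for k
  have y0: "0 \<le> y k" for k using l0 t0 by (simp add: y_def)
  define \<rho> where "\<rho> k = max 0 (1 - y k)" for k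
  have E0: "0 \<le> E" using l0 D a by (simp add: E_def)
  have m3: "0 \<le> l ^ 3 + 3 * l ^ 2 + 2 * l" using l0 by simp
  have good: "1 - E * \<epsilon> * (1 + (real k)\<^sup>2) \<le>
      \<rho> k * (\<Prod>i<k. max 0 (measure lborel V - real i * measure lborel (cball (0::'a) (2 * r))))" for k
  proof -
    define b2 where "b2 = measure lborel (cball (0::'a) (2 * r))"
    define v where "v = measure lborel V"
    \<comment> \<open>Index \<open>k\<close> is reserved for the density factor
      \<open>\<rho> k\<close>, so a single product inequality over \<open>i \<le> k\<close> bounds
      all losses by their sum.\<close>
    let ?y = "\<lambda>i. if i = k then y k else (1 - v) + real i * b2"
    have b2: "0 \<le> b2" by (simp add: b2_def)
    have k: "real k \<le> 1 + (real k)\<^sup>2"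
      using sum_squares_bound[of 1 "real k"] by (simp add: power2_eq_square)
    have "(\<Sum>i<k. ?y i) = (\<Sum>i<k. (1 - v) + real i * b2)"
      by (intro sum.cong) auto
    also have "\<dots> \<le> (\<Sum>i<k. (1 - v) + real k * b2)"
      using b2 by (intro sum_mono add_left_mono mult_right_mono) auto
    also have "\<dots> = real k * (1 - v) + (real k)\<^sup>2 * b2"
      by (simp add: algebra_simps power2_eq_square)
    also have "\<dots> \<le> (1 + (real k)\<^sup>2) * (D * a / 2 * \<epsilon>) + (1 + (real k)\<^sup>2) * (2 ^ d * (2 * l) * \<epsilon>)"
    proof (intro add_mono mult_mono k)
      have "1 - v \<le> D * (r / 2)" using V by (simp add: v_def)
      also have "\<dots> \<le> D * a / 2 * \<epsilon>" using r\<epsilon> D by simp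
      finally show "1 - v \<le> D * a / 2 * \<epsilon>" .
      have "2 ^ d * (2 * l) * (1 / t\<^sup>2) \<le> 2 ^ d * (2 * l) * \<epsilon>"
        using t2 l0 by (intro mult_left_mono) auto
      then show "b2 \<le> 2 ^ d * (2 * l) * \<epsilon>" by (simp add: b2_def ball2)
    qed (use V1 b2 in \<open>auto simp: v_def\<close>)
    finally have s: "(\<Sum>i<k. ?y i) \<le> (1 + (real k)\<^sup>2) * (D * a / 2 * \<epsilon>) + (1 + (real k)\<^sup>2) * (2 ^ d * (2 * l) * \<epsilon>)" .
    have "y k = exp l * (4 + 4 * l + 32 * l\<^sup>2) * (1 + (real k)\<^sup>2) * (1 / t)" by (simp add: y_def)
    also have "\<dots> \<le> exp l * (4 + 4 * l + 32 * l\<^sup>2) * (1 + (real k)\<^sup>2) * \<epsilon>"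
      using l0 by (intro mult_left_mono t1) auto
    finally have "(\<Sum>i<Suc k. ?y i) \<le> E * \<epsilon> * (1 + (real k)\<^sup>2)"
      using s by (simp add: E_def algebra_simps)
    then have "1 - E * \<epsilon> * (1 + (real k)\<^sup>2) \<le> 1 - (\<Sum>i<Suc k. ?y i)" by simp
    also have "\<dots> \<le> (\<Prod>i<Suc k. max 0 (1 - ?y i))"
      using y0 V1 b2 by (intro prod_max_one_minus_ge) (auto simp: v_def)
    also have "\<dots> = (\<Prod>i<k. max 0 (1 - ?y i)) * \<rho> k"
      by (simp add: \<rho>_def)
    also have "(\<Prod>i<k. max 0 (1 - ?y i)) = (\<Prod>i<k. max 0 (v - real i * b2))"
      by (intro prod.cong) auto
    finally show ?thesis by (simp add: v_def b2_def mult.commute)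
  qed
  have "dKR (distr (mixed p) conf_space (xi_map r)) (mixed (poisson_pmf l)) \<le> ennreal (l / t + 2 * (E * \<epsilon> * (l ^ 3 + 3 * l ^ 2 + 2 * l)))"
  proof (rule dKR_xi_map_mixed_le[where \<rho> = \<rho> and V = V])
    fix k
    have "exp (- l) * \<rho> k = max 0 (exp (- l) - (4 + 4 * l + 32 * l\<^sup>2) * (1 + (real k)\<^sup>2) / t)"
    proof -
      have "exp (- l) * y k = (4 + 4 * l + 32 * l\<^sup>2) * (1 + (real k)\<^sup>2) / t"
        by (simp add: y_def exp_minus)
      moreover have "exp (- l) * \<rho> k = max (exp (- l) * 0) (exp (- l) * (1 - y k))"
        using max_mult_distrib_left[of "exp (- l)" 0 "1 - y k"] by (simp add: \<rho>_def)
      ultimately show ?thesis by (simp add: right_diff_distrib)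
    qed
    \<comment> \<open>\<open>ennreal\<close> sends negative reals to 0, which makes the maximum in
      \<open>\<rho>\<close> disappear.\<close>
    then have "ennreal (l ^ k / fact k * exp (- l) * \<rho> k) = ennreal (l ^ k / fact k * (exp (- l) - (4 + 4 * l + 32 * l\<^sup>2) * (1 + (real k)\<^sup>2) / t))"
      using l0 by (simp only: mult.assoc) (subst (1 2) ennreal_mult', auto simp: max_def ennreal_neg)
    also note weight[of k]
    finally show "ennreal (l ^ k / fact k * exp (- l) * \<rho> k) \<le> (\<integral>\<^sup>+n. ennreal (matching_weight (measure lborel (cball (0::'a) r)) n k 1) \<partial>measure_pmf p)"
      by (simp add: ball)
  next
    show "(\<integral>\<^sup>+n. of_nat (n * (n - 1)) \<partial>measure_pmf p) * ennreal (measure lborel (cball (0::'a) r) / 2) \<le> ennreal l + ennreal (l / t)"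
      using moment by (simp add: ball)
  qed (use l0 r0 t0 E0 \<epsilon> V y0 good in \<open>auto simp: \<rho>_def V_def\<close>)
  also have "\<dots> \<le> ennreal ((l + 2 * E * (l ^ 3 + 3 * l ^ 2 + 2 * l)) * \<epsilon>)"
  proof (rule ennreal_leI)
    have "l * (1 / t) \<le> l * \<epsilon>" using l0 by (intro mult_left_mono t1) simp
    then show "l / t + 2 * (E * \<epsilon> * (l ^ 3 + 3 * l ^ 2 + 2 * l)) \<le> (l + 2 * E * (l ^ 3 + 3 * l ^ 2 + 2 * l)) * \<epsilon>"
      by (simp add: algebra_simps)
  qed
  finally show ?thesis by (simp add: E_def \<epsilon>_def)
qed

end

theorem theorem7p13:
  fixes K :: "'a::euclidean_space set" and a :: real
  assumes "compact K" and "convex K" and "measure lborel K = 1" and "a > 0"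
  shows "\<exists>C>0. \<forall>\<theta>::real \<Rightarrow> real.
     (\<forall>t\<ge>1. \<theta> t > 0) \<and> filterlim (\<lambda>t. t\<^sup>2 * \<theta> t ^ DIM('a)) at_top at_top \<longrightarrow>
     (let S = {t. t \<ge> 1 \<and> t\<^sup>2 * \<theta> t ^ DIM('a) < a ^ DIM('a)} \<union> {1};
          r = (\<lambda>t. min (\<theta> t) (t powr (- 2 / real DIM('a)) * a));
          bound = (\<lambda>t. ennreal (C * t powr (- min (2 / real DIM('a)) 1)))
      in bdd_above S \<and>
         (\<forall>Z. poisson_process_law (scaled_vol (kappa TYPE('a) / 2 * a ^ DIM('a)) K) Z \<longrightarrow>
           (\<forall>t > Sup S.
              (\<forall>M. poisson_process_law (scaled_vol t K) M \<longrightarrow>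
                   dKR (distr M conf_space (xi_map (r t))) Z \<le> bound t) \<and>
              dKR (distr (binomial_process_law K (nat \<lceil>t\<rceil>)) conf_space (xi_map (r t))) Z
                \<le> bound t)))"
proof -
  have fin: "emeasure lborel K < \<infinity>" using assms(1) by (rule emeasure_compact_finite)
  interpret unit_volume K
    using assms fin by unfold_locales (auto simp: borel_compact emeasure_eq_ennreal_measure)
  obtain D where D: "0 < D"
    "\<And>s. 0 < s \<Longrightarrow> {z. cball z s \<subseteq> K} \<in> sets borel \<and> 1 - D * s \<le> measure lborel {z. cball z s \<subseteq> K}"
    using erosion_volume_ge[OF assms(1-3)] by blast
  define d where "d = DIM('a)"
  have d0: "0 < d" by (simp add: d_def)
  define l where "l = kappa TYPE('a) / 2 * a ^ d"
  have "kappa TYPE('a) = unit_ball_vol (real d)"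
    using content_ball[of 1 "0 :: 'a"] by (simp add: kappa_def d_def)
  then have l0: "0 < l" using assms(4) by (simp add: l_def unit_ball_vol_pos)
  \<comment> \<open>Fixed before \<open>\<theta>\<close> appears; the shape of \<open>K\<close>
    enters through the erosion constant \<open>D\<close>.\<close>
  define C where "C = l + 2 * (exp l * (4 + 4 * l + 32 * l\<^sup>2) + D * a / 2 + 2 ^ d * (2 * l)) * (l ^ 3 + 3 * l ^ 2 + 2 * l)"
  have "0 < C" using l0 D(1) assms(4) by (auto simp: C_def intro!: add_pos_nonneg mult_nonneg_nonneg add_nonneg_nonneg)
  have rate: "dKR (distr (mixed p) conf_space (xi_map (t powr (- 2 / real d) * a))) (mixed (poisson_pmf l)) \<le>
      ennreal (C * t powr (- min (2 / real d) 1))"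
    if "1 \<le> t" "(\<integral>\<^sup>+n. of_nat (n * (n - 1)) \<partial>measure_pmf p) * ennreal (l / t\<^sup>2) \<le> ennreal l + ennreal (l / t)"
      "\<And>k. ennreal (l ^ k / fact k * (exp (- l) - (4 + 4 * l + 32 * l\<^sup>2) * (1 + (real k)\<^sup>2) / t)) \<le>
        (\<integral>\<^sup>+n. ennreal (matching_weight (2 * l / t\<^sup>2) n k 1) \<partial>measure_pmf p)" for t p
    using dKR_xi_map_mixed_rate[OF assms(4) that(1) D that(2,3)[unfolded l_def d_def]]
    by (simp add: C_def l_def d_def)
  have poisson: "dKR (distr (mixed (poisson_pmf t)) conf_space (xi_map (t powr (- 2 / real d) * a))) (mixed (poisson_pmf l)) \<le>
      ennreal (C * t powr (- min (2 / real d) 1))" if t: "1 \<le> t" for t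
  proof (rule rate[OF t])
    \<comment> \<open>The second factorial moment is \<open>t^2\<close>, so the moment condition
      holds with no excess over \<open>l\<close>.\<close>
    have "real (n * (n - 1)) = (\<Prod>j<2. real (n - j))" for n
      unfolding falling_2 by (cases n) (simp_all add: algebra_simps)
    then have "(\<integral>\<^sup>+n. of_nat (n * (n - 1)) \<partial>measure_pmf (poisson_pmf t)) = ennreal (t ^ 2)"
      using nn_integral_poisson_factorial_moment[of t 2] t by (simp only: ennreal_of_nat_eq_real_of_nat)
    then show "(\<integral>\<^sup>+n. of_nat (n * (n - 1)) \<partial>measure_pmf (poisson_pmf t)) * ennreal (l / t\<^sup>2) \<le> ennreal l + ennreal (l / t)"
      using t l0 by (simp flip: ennreal_mult)
  qed (rule matching_weight_poisson_ge[OF t l0 refl])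
  have binomial: "dKR (distr (B (nat \<lceil>t\<rceil>)) conf_space (xi_map (t powr (- 2 / real d) * a))) (mixed (poisson_pmf l)) \<le>
      ennreal (C * t powr (- min (2 / real d) 1))" if t: "1 \<le> t" for t
    unfolding mixed_return[symmetric]
  proof (rule rate[OF t])
    define n where "n = nat \<lceil>t\<rceil>"
    have n: "1 \<le> n" "real n \<le> t + 1"
      using t unfolding n_def by linarith+
    \<comment> \<open>Rounding up gives \<open>n (n - 1) \<le> (t + 1) t\<close>, the source of the
      excess \<open>l / t\<close>.\<close>
    have "real (n * (n - 1)) * (l / t\<^sup>2) \<le> ((t + 1) * t) * (l / t\<^sup>2)"
      using n t l0 by (intro mult_right_mono) (auto simp: of_nat_diff intro!: mult_mono)
    also have "\<dots> = l + l / t" using t by (simp add: field_simps power2_eq_square)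
    finally have "ennreal (real (n * (n - 1)) * (l / t\<^sup>2)) \<le> ennreal (l + l / t)" by (rule ennreal_leI)
    moreover have "ennreal (real (n * (n - 1)) * (l / t\<^sup>2)) = of_nat (n * (n - 1)) * ennreal (l / t\<^sup>2)"
      using l0 by (subst ennreal_mult) (simp_all only: ennreal_of_nat_eq_real_of_nat, simp_all)
    ultimately show "(\<integral>\<^sup>+n. of_nat (n * (n - 1)) \<partial>measure_pmf (return_pmf (nat \<lceil>t\<rceil>))) * ennreal (l / t\<^sup>2) \<le> ennreal l + ennreal (l / t)"
      using l0 t by (simp add: nn_integral_return_pmf n_def[symmetric])
    show "ennreal (l ^ k / fact k * (exp (- l) - (4 + 4 * l + 32 * l\<^sup>2) * (1 + (real k)\<^sup>2) / t)) \<le>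
        (\<integral>\<^sup>+n. ennreal (matching_weight (2 * l / t\<^sup>2) n k 1) \<partial>measure_pmf (return_pmf (nat \<lceil>t\<rceil>)))" for k
      using matching_weight_binomial_ge[OF t l0 refl refl, of k] by (simp add: nn_integral_return_pmf ennreal_leI)
  qed
  show ?thesis
  proof (intro exI[of _ C] conjI \<open>0 < C\<close> allI impI)
    fix \<theta> :: "real \<Rightarrow> real"
    assume "(\<forall>t\<ge>1. \<theta> t > 0) \<and> filterlim (\<lambda>t. t\<^sup>2 * \<theta> t ^ DIM('a)) at_top at_top"
    then have \<theta>: "\<And>t. 1 \<le> t \<Longrightarrow> 0 < \<theta> t" and lim: "filterlim (\<lambda>t. t\<^sup>2 * \<theta> t ^ d) at_top at_top"
      by (auto simp: d_def)
    define S where "S = {t. t \<ge> 1 \<and> t\<^sup>2 * \<theta> t ^ d < a ^ d} \<union> {1}"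
    from lim have "eventually (\<lambda>t. a ^ d \<le> t\<^sup>2 * \<theta> t ^ d) at_top"
      by (simp add: filterlim_at_top)
    then obtain N where N: "\<And>t. N \<le> t \<Longrightarrow> a ^ d \<le> t\<^sup>2 * \<theta> t ^ d"
      by (auto simp: eventually_at_top_linorder)
    have bdd: "bdd_above S"
    proof (rule bdd_aboveI)
      fix t assume "t \<in> S"
      then show "t \<le> max N 1" using N[of t] by (auto simp: S_def max_def not_le intro: less_imp_le leI)
    qed
    \<comment> \<open>Above \<open>Sup S\<close> the inequality defining \<open>S\<close> fails, and
      its negation says that \<open>a t^(-2/d)\<close> is the minimum; the element 1 of
      \<open>S\<close> ensures \<open>t \<ge> 1\<close>.\<close>
    have radius: "1 \<le> t \<and> min (\<theta> t) (t powr (- 2 / real d) * a) = t powr (- 2 / real d) * a" if "Sup S < t" for t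
    proof -
      have "1 \<le> Sup S" using bdd by (intro cSup_upper) (auto simp: S_def)
      with that have t: "1 < t" by simp
      have "t \<notin> S" using that bdd cSup_upper[of t S] by auto
      then have "a ^ d \<le> t\<^sup>2 * \<theta> t ^ d" using t by (auto simp: S_def)
      moreover have "(t powr (- 2 / real d) * a) ^ d = a ^ d / t\<^sup>2"
      proof -
        have "(t powr (- 2 / real d)) ^ d = t powr (real d * (- 2 / real d))"
          using t by (simp add: powr_powr powr_realpow[symmetric] mult.commute)
        also have "\<dots> = 1 / t\<^sup>2" using d0 t by (simp add: powr_minus divide_simps)
        finally show ?thesis by (simp add: power_mult_distrib)
      qed
      moreover have "a ^ d / t\<^sup>2 \<le> \<theta> t ^ d \<longleftrightarrow> a ^ d \<le> t\<^sup>2 * \<theta> t ^ d"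
        using t by (simp add: pos_divide_le_eq mult.commute)
      ultimately have "(t powr (- 2 / real d) * a) ^ d \<le> \<theta> t ^ d" by simp
      then have "t powr (- 2 / real d) * a \<le> \<theta> t"
        using \<theta>[of t] t d0 by (simp add: power_mono_iff assms(4) less_imp_le)
      then show ?thesis using t by simp
    qed
    have main: "(\<forall>M. poisson_process_law (scaled_vol t K) M \<longrightarrow>
          dKR (distr M conf_space (xi_map (min (\<theta> t) (t powr (- 2 / real d) * a)))) Z \<le> ennreal (C * t powr (- min (2 / real d) 1))) \<and>
        dKR (distr (B (nat \<lceil>t\<rceil>)) conf_space (xi_map (min (\<theta> t) (t powr (- 2 / real d) * a)))) Z \<le> ennreal (C * t powr (- min (2 / real d) 1))"
      if Z: "poisson_process_law (scaled_vol l K) Z" and t: "Sup S < t" for Z t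
    proof -
      have "Z = mixed (poisson_pmf l)" using Z l0 by (rule poisson_process_law_unique)
      moreover have "M = mixed (poisson_pmf t)" if "poisson_process_law (scaled_vol t K) M" for M
        using that radius[OF t] by (intro poisson_process_law_unique) auto
      ultimately show ?thesis
        using poisson[of t] binomial[of t] radius[OF t] by auto
    qed
    show "let S = {t. t \<ge> 1 \<and> t\<^sup>2 * \<theta> t ^ DIM('a) < a ^ DIM('a)} \<union> {1};
          r = (\<lambda>t. min (\<theta> t) (t powr (- 2 / real DIM('a)) * a));
          bound = (\<lambda>t. ennreal (C * t powr (- min (2 / real DIM('a)) 1)))
      in bdd_above S \<and>
         (\<forall>Z. poisson_process_law (scaled_vol (kappa TYPE('a) / 2 * a ^ DIM('a)) K) Z \<longrightarrow>
           (\<forall>t > Sup S.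
              (\<forall>M. poisson_process_law (scaled_vol t K) M \<longrightarrow>
                   dKR (distr M conf_space (xi_map (r t))) Z \<le> bound t) \<and>
              dKR (distr (binomial_process_law K (nat \<lceil>t\<rceil>)) conf_space (xi_map (r t))) Z
                \<le> bound t))"
      using bdd main unfolding Let_def S_def l_def d_def by blast
  qed
qed

end
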